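(* Let $X$ be a P-complex in $V$ with compact cells and $S$ a supercommutative ring. For any convenient point $v\in\mathcal{U}(X)$ the product $\smile_v$ of cochains induces a well-defined product of cohomologies $H^p(X,S)\times H^q(X,S)\to H^{p+q}(X,S)$ (where $H^*(X,S)$ is the cohomology of $(C^*(X,S),d)$), and this product is independent of the choice of the convenient point $v$.
   Context: $V$ is a real vector space of finite dimension $n$, $V^*$ its dual. P-complex: a finite set $X$ of closed convex polyhedra in $V$ (its cells) such that every face of a cell is a cell and every non-empty intersection of two cells is a common face of both. All cells are assumed compact. Cochains: $S$ is a supercommutative ring ($\mathbb{Z}/2$-graded, $ab=(-1)^{|a||b|}ba$ for homogeneous $a,b$). $C^p(X,S)$ is the module of functions from oriented $p$-dimensional cells to $S$ that change sign when the orientation of the cell is reversed; $d\colon C^p(X,S)\to C^{p+1}(X,S)$ is the usual coboundary: $(dr)(\mu)$ is the sum of $r$ over the facets of $\mu$ with induced boundary orientation (outward normal first). For a cell $\delta$, $V_\delta\subset V$ is the linear subspace generated by differences of points of $\delta$. For a cell $\gamma$, let $X_\gamma$ be the P-complex in $V_\gamma$ of faces of $\gamma$ ($\gamma$ translated into $V_\gamma$; the choice is immaterial). For a face $\delta$ of $\gamma$ the dual cone $\delta^*\subset (V_\gamma)^*$ consists of all $w\in(V_\gamma)^*$ for which the maximum of $w$ on $\gamma$ is attained at every point of $\delta$; $\dim\delta^*=\dim\gamma-\dim\delta$. These cones form the dual fan $X_\gamma^*$, with $j$-dimensional skeleton $(X_\gamma^* )^j$. Let $\pi_\gamma\colon V^*\to(V_\gamma)^*$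 be the restriction map. Two P-complexes in a space are transversal if for any cells $\delta_1,\delta_2$ of them with $\delta_1\cap\delta_2\ne\emptyset$ one has $\operatorname{codim}(V_{\delta_1}\cap V_{\delta_2})=\operatorname{codim}V_{\delta_1}+\operatorname{codim}V_{\delta_2}$. A point $v\in V^*$ is $(p,q)$-convenient if $\pi_\gamma(v)+(X_\gamma^* )^q$ and $(X_\gamma^* )^p$ are transversal for every $\gamma\in X$ with $\dim\gamma=p+q$; $\mathcal{U}_{p,q}(X)$ is the set of such points, and $\mathcal{U}(X)=\bigcap_{p,q}\mathcal{U}_{p,q}(X)$ is the set of convenient points. Product: for $v\in\mathcal{U}_{p,q}(X)$ and an oriented cell $\gamma$ of dimension $p+q$, $(r_p\smile_v r_q)(\gamma)=\sum_{(\delta,\lambda)\in\mathcal{P}(p,q,\gamma,v)}r_p(\delta)r_q(\lambda)$, where $\mathcal{P}(p,q,\gamma,v)$ is the set of pairs $(\delta,\lambda)$ of faces of $\gamma$ of dimensions $p,q$ with $(\pi_\gamma(v)+\delta^* )\cap\lambda^*\neq\emptyset$, oriented so that $V_\gamma=V_\delta\oplus V_\lambda$ as oriented spaces. *)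

theory Defs
  imports
    "HOL-Analysis.Analysis"
    "HOL-Algebra.Coset"
    "HOL-Library.Function_Algebras"
    "Jordan_Normal_Form.Determinant"
begin

text \<open>Dual spaces are spaces of functions, so that \<^const>\<open>span\<close> and \<^const>\<open>dim\<close> apply to them.\<close>

instantiation "fun" :: (type, real_vector) real_vector
begin

definition scaleR_fun :: "real \<Rightarrow> ('a \<Rightarrow> 'b) \<Rightarrow> 'a \<Rightarrow> 'b"
  where "scaleR_fun c f = (\<lambda>x. c *\<^sub>R f x)"

instance
  by standard (auto simp: scaleR_fun_def fun_eq_iff algebra_simps)

end

section \<open>Polyhedral complexes\<close>

text \<open>The ambient space \<open>V\<close> is a linear subspace of a Euclidean type, so that every finite dimension,
  including 0, is covered; the inner product of the type plays no role. Since \<^const>\<open>face_of\<close>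
  also holds of the empty set, faces are explicitly required to be non-empty.\<close>

definition P_complex :: "'a::euclidean_space set \<Rightarrow> 'a set set \<Rightarrow> bool"
  where "P_complex V X \<longleftrightarrow>
    finite X \<and>
    (\<forall>\<gamma>\<in>X. polyhedron \<gamma> \<and> \<gamma> \<noteq> {} \<and> \<gamma> \<subseteq> V) \<and>
    (\<forall>\<gamma>\<in>X. \<forall>\<delta>. \<delta> face_of \<gamma> \<and> \<delta> \<noteq> {} \<longrightarrow> \<delta> \<in> X) \<and>
    (\<forall>\<gamma>\<in>X. \<forall>\<gamma>'\<in>X. \<gamma> \<inter> \<gamma>' \<noteq> {} \<longrightarrow> (\<gamma> \<inter> \<gamma>') face_of \<gamma> \<and> (\<gamma> \<inter> \<gamma>') face_of \<gamma>')"

definition direction_space :: "'b::real_vector set \<Rightarrow> 'b set"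
  where "direction_space C = span {x - y |x y. x \<in> C \<and> y \<in> C}"

definition cell_dim :: "'b::real_vector set \<Rightarrow> nat"
  where "cell_dim C = dim (direction_space C)"

definition skeleton :: "nat \<Rightarrow> 'b::real_vector set set \<Rightarrow> 'b set set"
  where "skeleton j A = {C \<in> A. cell_dim C \<le> j}"

definition codim_in :: "'b::real_vector set \<Rightarrow> 'b set \<Rightarrow> int"
  where "codim_in E W = int (dim E) - int (dim W)"

definition transversal :: "'b::real_vector set \<Rightarrow> 'b set set \<Rightarrow> 'b set set \<Rightarrow> bool"
  where "transversal E A B \<longleftrightarrow>
    (\<forall>C\<in>A. \<forall>D\<in>B. C \<inter> D \<noteq> {} \<longrightarrow>
      codim_in E (direction_space C \<inter> direction_space D) =
        codim_in E (direction_space C) + codim_in E (direction_space D))"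

section \<open>Dual fans and convenient points\<close>

text \<open>A functional on a subspace \<open>W\<close> is represented by its extension by 0 outside \<open>W\<close>.\<close>

definition dual_space :: "'a::real_vector set \<Rightarrow> ('a \<Rightarrow> real) set"
  where "dual_space W =
    {w. (\<forall>x\<in>W. \<forall>y\<in>W. w (x + y) = w x + w y) \<and>
        (\<forall>c. \<forall>x\<in>W. w (c *\<^sub>R x) = c * w x) \<and>
        (\<forall>x. x \<notin> W \<longrightarrow> w x = 0)}"

definition restrict_dual :: "'a::real_vector set \<Rightarrow> ('a \<Rightarrow> real) \<Rightarrow> 'a \<Rightarrow> real"
  where "restrict_dual \<gamma> v = (\<lambda>x. if x \<in> direction_space \<gamma> then v x else 0)"

text \<open>The point \<open>a\<close> serves to translate \<open>\<gamma>\<close> into its direction space.\<close>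

definition dual_cone :: "'a::real_vector set \<Rightarrow> 'a set \<Rightarrow> ('a \<Rightarrow> real) set"
  where "dual_cone \<gamma> \<delta> =
    {w \<in> dual_space (direction_space \<gamma>). \<forall>a\<in>\<gamma>. \<forall>y\<in>\<delta>. \<forall>x\<in>\<gamma>. w (x - a) \<le> w (y - a)}"

definition dual_fan :: "'a::real_vector set \<Rightarrow> ('a \<Rightarrow> real) set set"
  where "dual_fan \<gamma> = {dual_cone \<gamma> \<delta> |\<delta>. \<delta> face_of \<gamma> \<and> \<delta> \<noteq> {}}"

definition convenient_pq :: "'a::euclidean_space set \<Rightarrow> 'a set set \<Rightarrow> nat \<Rightarrow> nat \<Rightarrow> ('a \<Rightarrow> real) set"
  where "convenient_pq V X p q =
    {v \<in> dual_space V. \<forall>\<gamma>\<in>X. cell_dim \<gamma> = p + q \<longrightarrow>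
      transversal (dual_space (direction_space \<gamma>))
        ((\<lambda>C. (+) (restrict_dual \<gamma> v) ` C) ` skeleton q (dual_fan \<gamma>))
        (skeleton p (dual_fan \<gamma>))}"

definition convenient :: "'a::euclidean_space set \<Rightarrow> 'a set set \<Rightarrow> ('a \<Rightarrow> real) set"
  where "convenient V X = (\<Inter>p q. convenient_pq V X p q)"

section \<open>Orientations\<close>

definition ordered_basis :: "'a::real_vector set \<Rightarrow> 'a list \<Rightarrow> bool"
  where "ordered_basis W b \<longleftrightarrow> distinct b \<and> independent (set b) \<and> span (set b) = W"

definition transition_det :: "'a::real_vector list \<Rightarrow> 'a list \<Rightarrow> real"
  where "transition_det b b' =
    Determinant.det (mat (length b) (length b)
      (\<lambda>(i, j). representation (set b) (b' ! j) (b ! i)))"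

text \<open>An orientation assigns a sign to every ordered basis. In contrast to equivalence classes
  of bases, this also yields two opposite orientations \<open>\<omega>\<close> and \<open>- \<omega>\<close> of the zero space.\<close>

type_synonym 'a orientation = "'a list \<Rightarrow> int"

definition orientations :: "'a::real_vector set \<Rightarrow> 'a orientation set"
  where "orientations W =
    {\<omega>. (\<forall>b. ordered_basis W b \<longrightarrow> \<omega> b = 1 \<or> \<omega> b = - 1) \<and>
        (\<forall>b. \<not> ordered_basis W b \<longrightarrow> \<omega> b = 0) \<and>
        (\<forall>b b'. ordered_basis W b \<and> ordered_basis W b' \<longrightarrow>
          (\<omega> b = \<omega> b' \<longleftrightarrow> 0 < transition_det b b'))}"

definition oriented_direct_sum ::
    "'a::real_vector set \<Rightarrow> 'a orientation \<Rightarrow> 'a set \<Rightarrow> 'a orientation \<Rightarrow> 'a set \<Rightarrow> 'a orientation \<Rightarrow> bool"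
  where "oriented_direct_sum W \<omega> U \<alpha> U' \<beta> \<longleftrightarrow>
    W = {x + y |x y. x \<in> U \<and> y \<in> U'} \<and> U \<inter> U' = {0} \<and>
    (\<forall>b b'. ordered_basis U b \<and> ordered_basis U' b' \<longrightarrow> \<omega> (b @ b') = \<alpha> b * \<beta> b')"

text \<open>Outward normal first; any vector pointing out of \<open>\<mu>\<close> through the facet \<open>\<delta>\<close> may serve as
  normal, as the result does not depend on its choice.\<close>

definition boundary_orientation :: "'a::real_vector set \<Rightarrow> 'a set \<Rightarrow> 'a orientation \<Rightarrow> 'a orientation"
  where "boundary_orientation \<mu> \<delta> \<omega> =
    (\<lambda>b. if ordered_basis (direction_space \<delta>) b
         then \<omega> ((SOME n. \<exists>y\<in>\<delta>. \<exists>x\<in>\<mu> - \<delta>. n = y - x) # b) else 0)"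

section \<open>Cochains and cohomology\<close>

text \<open>The index \<open>True\<close> denotes the odd part. No unit is required, so that the zero ring
  and non-unital rings are included.\<close>

definition supercommutative_grading :: "(bool \<Rightarrow> 's::ring set) \<Rightarrow> bool"
  where "supercommutative_grading G \<longleftrightarrow>
    (\<forall>i. 0 \<in> G i \<and> (\<forall>a\<in>G i. \<forall>b\<in>G i. a - b \<in> G i)) \<and>
    (\<forall>s. \<exists>!ab. fst ab \<in> G False \<and> snd ab \<in> G True \<and> s = fst ab + snd ab) \<and>
    (\<forall>i j. \<forall>a\<in>G i. \<forall>b\<in>G j. a * b \<in> G (i \<noteq> j) \<and> a * b = (if i \<and> j then - (b * a) else b * a))"

type_synonym ('a, 's) cochain = "'a set \<times> 'a orientation \<Rightarrow> 's"

definition oriented_cells :: "'a::real_vector set set \<Rightarrow> nat \<Rightarrow> ('a set \<times> 'a orientation) set"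
  where "oriented_cells X p =
    {(\<delta>, \<omega>). \<delta> \<in> X \<and> cell_dim \<delta> = p \<and> \<omega> \<in> orientations (direction_space \<delta>)}"

definition cochains :: "'a::real_vector set set \<Rightarrow> nat \<Rightarrow> ('a, 's::ring) cochain set"
  where "cochains X p =
    {r. (\<forall>\<delta> \<omega>. (\<delta>, \<omega>) \<in> oriented_cells X p \<longrightarrow> r (\<delta>, - \<omega>) = - r (\<delta>, \<omega>)) \<and>
        (\<forall>c. c \<notin> oriented_cells X p \<longrightarrow> r c = 0)}"

definition coboundary ::
    "'a::euclidean_space set set \<Rightarrow> nat \<Rightarrow> ('a, 's::ring) cochain \<Rightarrow> ('a, 's) cochain"
  where "coboundary X p r =
    (\<lambda>(\<mu>, \<omega>). if (\<mu>, \<omega>) \<in> oriented_cells X (Suc p)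
       then \<Sum>\<delta> | \<delta> facet_of \<mu>. r (\<delta>, boundary_orientation \<mu> \<delta> \<omega>) else 0)"

definition cochain_group :: "'a::real_vector set set \<Rightarrow> nat \<Rightarrow> ('a, 's::ring) cochain monoid"
  where "cochain_group X p = \<lparr>carrier = cochains X p, mult = (+), one = 0\<rparr>"

definition cocycles :: "'a::euclidean_space set set \<Rightarrow> nat \<Rightarrow> ('a, 's::ring) cochain set"
  where "cocycles X p = kernel (cochain_group X p) (cochain_group X (Suc p)) (coboundary X p)"

definition coboundaries :: "'a::euclidean_space set set \<Rightarrow> nat \<Rightarrow> ('a, 's::ring) cochain set"
  where "coboundaries X p = (case p of 0 \<Rightarrow> {0} | Suc k \<Rightarrow> coboundary X k ` cochains X k)"

definition cocycle_group :: "'a::euclidean_space set set \<Rightarrow> nat \<Rightarrow> ('a, 's::ring) cochain monoid"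
  where "cocycle_group X p = (cochain_group X p)\<lparr>carrier := cocycles X p\<rparr>"

definition cohomology :: "'a::euclidean_space set set \<Rightarrow> nat \<Rightarrow> ('a, 's::ring) cochain set monoid"
  where "cohomology X p = cocycle_group X p Mod coboundaries X p"

definition cohomology_class ::
    "'a::euclidean_space set set \<Rightarrow> nat \<Rightarrow> ('a, 's::ring) cochain \<Rightarrow> ('a, 's) cochain set"
  where "cohomology_class X p r = coboundaries X p #>\<^bsub>cocycle_group X p\<^esub> r"

section \<open>The product\<close>

definition product_pairs ::
    "nat \<Rightarrow> nat \<Rightarrow> 'a::real_vector set \<Rightarrow> ('a \<Rightarrow> real) \<Rightarrow> ('a set \<times> 'a set) set"
  where "product_pairs p q \<gamma> v =
    {(\<delta>, \<eta>). \<delta> face_of \<gamma> \<and> \<delta> \<noteq> {} \<and> cell_dim \<delta> = p \<and>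
            \<eta> face_of \<gamma> \<and> \<eta> \<noteq> {} \<and> cell_dim \<eta> = q \<and>
            (+) (restrict_dual \<gamma> v) ` dual_cone \<gamma> \<delta> \<inter> dual_cone \<gamma> \<eta> \<noteq> {}}"

text \<open>For cochains \<open>r\<close> and \<open>s\<close> the summand does not depend on the chosen pair of orientations:
  the only other admissible pair is \<open>(- \<alpha>, - \<beta>)\<close>.\<close>

definition product_term ::
    "('a::real_vector, 's::ring) cochain \<Rightarrow> ('a, 's) cochain \<Rightarrow>
      'a set \<Rightarrow> 'a orientation \<Rightarrow> 'a set \<Rightarrow> 'a set \<Rightarrow> 's"
  where "product_term r s \<gamma> \<omega> \<delta> \<eta> =
    (let (\<alpha>, \<beta>) = (SOME (\<alpha>, \<beta>).
         \<alpha> \<in> orientations (direction_space \<delta>) \<and> \<beta> \<in> orientations (direction_space \<eta>) \<and>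
         oriented_direct_sum (direction_space \<gamma>) \<omega> (direction_space \<delta>) \<alpha> (direction_space \<eta>) \<beta>)
     in r (\<delta>, \<alpha>) * s (\<eta>, \<beta>))"

definition cochain_product ::
    "'a::real_vector set set \<Rightarrow> ('a \<Rightarrow> real) \<Rightarrow> nat \<Rightarrow> nat \<Rightarrow>
      ('a, 's::ring) cochain \<Rightarrow> ('a, 's) cochain \<Rightarrow> ('a, 's) cochain"
  where "cochain_product X v p q r s =
    (\<lambda>(\<gamma>, \<omega>). if (\<gamma>, \<omega>) \<in> oriented_cells X (p + q)
       then \<Sum>(\<delta>, \<eta>)\<in>product_pairs p q \<gamma> v. product_term r s \<gamma> \<omega> \<delta> \<eta> else 0)"

type_synonym ('a, 's) cohomology_product =
  "('a, 's) cochain set \<times> ('a, 's) cochain set \<Rightarrow> ('a, 's) cochain set"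

definition biadditive ::
    "('b, 'm) monoid_scheme \<Rightarrow> ('c, 'n) monoid_scheme \<Rightarrow> ('d, 'k) monoid_scheme \<Rightarrow>
      ('b \<times> 'c \<Rightarrow> 'd) \<Rightarrow> bool"
  where "biadditive A B C m \<longleftrightarrow>
    (\<forall>b\<in>carrier B. (\<lambda>a. m (a, b)) \<in> hom A C) \<and> (\<forall>a\<in>carrier A. (\<lambda>b. m (a, b)) \<in> hom B C)"

definition induced_product ::
    "'a::euclidean_space set set \<Rightarrow> ('a \<Rightarrow> real) \<Rightarrow> nat \<Rightarrow> nat \<Rightarrow>
      ('a, 's::ring) cohomology_product \<Rightarrow> bool"
  where "induced_product X v p q m \<longleftrightarrow>
    m \<in> carrier (cohomology X p) \<times> carrier (cohomology X q) \<rightarrow>\<^sub>E carrier (cohomology X (p + q)) \<and>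
    biadditive (cohomology X p) (cohomology X q) (cohomology X (p + q)) m \<and>
    (\<forall>r\<in>cocycles X p. \<forall>s\<in>cocycles X q.
      m (cohomology_class X p r, cohomology_class X q s) =
        cohomology_class X (p + q) (cochain_product X v p q r s))"

end

theory Submission
  imports Defs
begin

text \<open>Represent a functional on \<open>V\<close> by a vector. The product is dual to a cellular diagonal of each
  cell \<open>\<gamma>\<close>: a pair of faces \<open>(\<delta>, \<eta>)\<close> occurs iff some \<open>w\<close> is maximal on \<open>\<eta>\<close> while \<open>w - v\<close> is maximal on
  \<open>\<delta>\<close>. For the Leibniz rule, compare the coefficients of \<open>r(\<alpha>) s(\<beta>)\<close> where \<open>dim \<alpha> + dim \<beta> = dim \<gamma> - 1\<close>.
  The admissible \<open>w\<close> form a segment or a ray in a line with direction \<open>\<psi>\<close>. Its endpoints are the pairs in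
  which one of \<open>\<alpha>\<close>, \<open>\<beta>\<close> is replaced by a cell having it as a facet, its infinite end is the facet of \<open>\<gamma>\<close>
  where \<open>\<psi>\<close> or \<open>- \<psi>\<close> is maximal, and the orientation signs are the signs of \<open>\<psi>\<close> on outward vectors, so
  that the two ends cancel. Independence of \<open>v\<close> is the same count in \<open>V \<times> \<real>\<close> along a generic segment of
  displacements: the pairs met in the interior of the segment give a cochain homotopy. Any two convenient
  points are joined through a third, generic displacement.\<close>

text \<open>The direction space of a dual cone is the annihilator of \<open>ds A\<close>, so
  convenience says \<open>ds A \<inter> ds B = {0}\<close> for every selected pair whose dimensions
  add up to at least that of \<open>\<gamma>\<close>. Hence along a line of functionals a pair of
  maximal faces can grow by one dimension only, and exactly one face is replaced at an end. Along a
  segment of displacements this independence cannot be kept: a pair with intersecting directions is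
  selected as soon as the displacement annihilates the intersection, which may happen on the way.
  What can be kept is that the velocity \<open>u\<close> vanishes at no non-zero vector of the
  intersection; shearing by \<open>u\<close> then separates the two spaces in
  \<open>V \<times> \<real>\<close>. The segment between two given convenient points may violate
  even this, when it passes through a displacement that annihilates an intersection of dimension two
  or more. The third point is chosen off finitely many hyperplanes determined by the two given ones,
  so that neither of the two resulting segments does.\<close>

no_notation Matrix.scalar_prod (infix "\<bullet>" 70)
hide_const (open) Matrix.orthogonal
hide_fact (open) Matrix.orthogonal_def

section \<open>Integer multiples in a ring without unit\<close>

text \<open>Orientation signs are integers, and \<open>'s\<close> has no unit through which they
  could be embedded, so they act by repeated addition. For each \<open>k\<close> one of the two sums
  is empty, because \<open>nat\<close> cuts negative numbers off at 0.\<close>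

definition zs :: "int \<Rightarrow> 's::ab_group_add \<Rightarrow> 's"
  where "zs k x = (\<Sum>i<nat k. x) - (\<Sum>i<nat (- k). x)"

lemma zs_0 [simp]: "zs 0 x = 0"
  by (simp add: zs_def)

lemma zs_1 [simp]: "zs 1 x = x"
  by (simp add: zs_def)

lemma zs_succ: "zs (k + 1) x = zs k x + x"
proof (cases "k \<ge> 0")
  case True
  then have "nat (k + 1) = Suc (nat k)" "nat (- k) = 0" "nat (- (k + 1)) = 0" by auto
  then show ?thesis by (simp add: zs_def)
next
  case False
  then have "nat (- k) = Suc (nat (- (k + 1)))" "nat k = 0" "nat (k + 1) = 0" by auto
  then show ?thesis unfolding zs_def by (simp del: minus_add_distrib)
qed

lemma zs_pred: "zs (k - 1) x = zs k x - x"
  using zs_succ[of "k - 1" x] by (simp add: algebra_simps)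

lemma zs_add: "zs (j + k) x = zs j x + zs k x"
proof (induction k rule: int_induct[where k = 0])
  case (step1 i)
  then show ?case by (simp add: zs_succ add.assoc[symmetric])
next
  case (step2 i)
  then show ?case by (simp add: zs_pred add_diff_eq)
qed simp

lemma zs_minus: "zs (- k) x = - zs k x"
  using zs_add[of k "- k" x] by (simp add: eq_neg_iff_add_eq_0 add.commute)

lemma zs_diff: "zs (j - k) x = zs j x - zs k x"
  using zs_add[of j "- k" x] by (simp add: zs_minus)

lemma zs_sum: "zs (\<Sum>i\<in>A. f i) x = (\<Sum>i\<in>A. zs (f i) x)"
  by (induction A rule: infinite_finite_induct) (auto simp: zs_add)

lemma zs_zs: "zs j (zs k x) = zs (j * k) x"
proof (induction j rule: int_induct[where k = 0])
  case (step1 i)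
  then show ?case by (simp add: zs_succ distrib_right zs_add)
next
  case (step2 i)
  then show ?case by (simp add: zs_pred left_diff_distrib zs_diff)
qed simp

lemma zs_arg_add: "zs k (x + y) = zs k x + zs k y"
proof (induction k rule: int_induct[where k = 0])
  case (step1 i)
  then show ?case by (simp add: zs_succ)
next
  case (step2 i)
  then show ?case by (simp add: zs_pred)
qed simp

lemma zs_arg_0 [simp]: "zs k 0 = 0"
  using zs_arg_add[of k 0 0] by simp

lemma zs_arg_sum: "zs k (\<Sum>i\<in>A. f i) = (\<Sum>i\<in>A. zs k (f i))"
  by (induction A rule: infinite_finite_induct) (auto simp: zs_arg_add)

lemma zs_mult_left: "zs k x * y = zs k (x * y :: 's::ring)"
proof (induction k rule: int_induct[where k = 0])
  case (step1 i)
  then show ?case by (simp add: zs_succ distrib_right)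
next
  case (step2 i)
  then show ?case by (simp add: zs_pred left_diff_distrib)
qed simp

lemma zs_mult_right: "x * zs k y = zs k (x * y :: 's::ring)"
proof (induction k rule: int_induct[where k = 0])
  case (step1 i)
  then show ?case by (simp add: zs_succ distrib_left)
next
  case (step2 i)
  then show ?case by (simp add: zs_pred right_diff_distrib)
qed simp

section \<open>Transition determinants and orientations\<close>

lemma transition_det_self:
  assumes "distinct b" "independent (set b)"
  shows "transition_det b b = 1"
proof -
  have "mat (length b) (length b) (\<lambda>(i, j). representation (set b) (b ! j) (b ! i)) = 1\<^sub>m (length b)"
    using assms by (auto intro!: eq_matI simp: representation_basis nth_eq_iff_index_eq)
  then show ?thesis unfolding transition_det_def by simp
qed

text \<open>The vectors of \<open>y'\<close> have no coordinates along \<open>x\<close>, so the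
  matrix is block triangular and the coordinates of \<open>x'\<close> along \<open>y\<close> do not
  enter. This freedom makes signs insensitive to the choice of outward vector and to shears.\<close>

lemma transition_det_append:
  fixes x y x' y' :: "'a::real_vector list"
  assumes ind: "independent (set (x @ y))" and dist: "distinct (x @ y)"
    and len: "length x' = length x" "length y' = length y"
    and sub: "set y' \<subseteq> span (set y)"
  shows "transition_det (x @ y) (x' @ y') =
    Determinant.det (mat (length x) (length x) (\<lambda>(i, j). representation (set (x @ y)) (x' ! j) (x ! i)))
      * transition_det y y'"
proof -
  let ?R = "representation (set (x @ y))"
  let ?n = "length x" and ?m = "length y"
  let ?A = "mat ?n ?n (\<lambda>(i, j). ?R (x' ! j) (x ! i))"
  let ?C = "mat ?m ?n (\<lambda>(i, j). ?R (x' ! j) (y ! i))"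
  let ?D = "mat ?m ?m (\<lambda>(i, j). representation (set y) (y' ! j) (y ! i))"
  have ext: "?R (y' ! j) = representation (set y) (y' ! j)" if "j < ?m" for j
    by (rule representation_extend[OF ind]) (use that sub len in auto)
  have zero: "representation (set y) (y' ! j) (x ! i) = 0" if "i < ?n" for i j
  proof -
    have "x ! i \<notin> set y" using dist that by (auto simp: disjoint_iff)
    then show ?thesis using representation_ne_zero by metis
  qed
  have "mat (length (x @ y)) (length (x @ y)) (\<lambda>(i, j). ?R ((x' @ y') ! j) ((x @ y) ! i))
      = four_block_mat ?A (0\<^sub>m ?n ?m) ?C ?D"
    by (rule eq_matI) (auto simp: nth_append len ext[simplified] zero)
  then show ?thesis unfolding transition_det_def
    by (simp add: det_four_block_mat_upper_right_zero[where n = ?n and m = ?m])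
qed

lemma ordered_basis_length:
  assumes "ordered_basis W (b :: 'a::real_vector list)"
  shows "length b = dim W"
  using assms by (metis distinct_card dim_eq_card_independent dim_span ordered_basis_def)

lemma transition_det_mult:
  fixes b b' b'' :: "'a::real_vector list"
  assumes b: "ordered_basis W b" and b': "ordered_basis W b'" and b'': "set b'' \<subseteq> W"
    and len'': "length b'' = length b"
  shows "transition_det b b'' = transition_det b b' * transition_det b' b''"
proof -
  let ?n = "length b"
  let ?M = "\<lambda>b c. mat ?n ?n (\<lambda>(i, j). representation (set b) (c ! j) (b ! i))"
  have len: "length b' = length b" "length b'' = length b"
    using len'' ordered_basis_length[OF b] ordered_basis_length[OF b'] by auto
  have ib: "independent (set b)" and ib': "independent (set b')"
    and sb: "span (set b) = W" and sb': "span (set b') = W" and db': "distinct b'"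
    using b b' by (auto simp: ordered_basis_def)
  have "?M b b'' = ?M b b' * ?M b' b''"
  proof (rule eq_matI)
    fix i j assume i: "i < dim_row (?M b b' * ?M b' b'')" and j: "j < dim_col (?M b b' * ?M b' b'')"
    then have ij: "i < ?n" "j < ?n" by auto
    have mem: "b'' ! j \<in> W" using b'' ij len by auto
    have mem': "b' ! k \<in> W" if "k < ?n" for k
      using sb' len that by (metis nth_mem span_base)
    have "b'' ! j = (\<Sum>v\<in>set b'. representation (set b') (b'' ! j) v *\<^sub>R v)"
      using mem sb' ib' by (simp add: real_vector.sum_representation_eq)
    also have "\<dots> = (\<Sum>k<?n. representation (set b') (b'' ! j) (b' ! k) *\<^sub>R (b' ! k))"
      using bij_betw_nth[OF db' refl refl] len by (subst sum.reindex_bij_betw[symmetric, of "(!) b'" "{..<?n}"]) auto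
    finally have eq: "b'' ! j = (\<Sum>k<?n. representation (set b') (b'' ! j) (b' ! k) *\<^sub>R (b' ! k))" .
    have "representation (set b) (b'' ! j) =
        (\<lambda>v. \<Sum>k<?n. representation (set b') (b'' ! j) (b' ! k) * representation (set b) (b' ! k) v)"
      by (subst eq, subst representation_sum[OF ib])
        (auto simp: sb mem' representation_scale[OF ib] intro!: span_scale[of _ "set b", unfolded sb])
    then show "?M b b'' $$ (i, j) = (?M b b' * ?M b' b'') $$ (i, j)"
      using ij by (auto simp: scalar_prod_def lessThan_atLeast0 mult.commute intro!: sum.cong)
  qed auto
  then show ?thesis unfolding transition_det_def
    by (simp add: len Determinant.det_mult[where n = ?n])
qed

lemma ordered_basis_exists:
  assumes "subspace (W :: 'a::euclidean_space set)"
  shows "\<exists>b. ordered_basis W b"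
proof -
  obtain B where B: "B \<subseteq> W" "independent B" "W \<subseteq> span B" "card B = dim W"
    using basis_exists by blast
  moreover have "finite B" using B(2) by (simp add: independent_imp_finite)
  moreover have "span B = W" using B(1,3) assms by (simp add: span_minimal subset_antisym)
  ultimately show ?thesis
    unfolding ordered_basis_def by (metis finite_distinct_list)
qed

lemma ordered_basis_mem: "ordered_basis W b \<Longrightarrow> set b \<subseteq> W"
  by (metis ordered_basis_def span_superset)

lemma transition_det_inverse:
  assumes "ordered_basis W b" "ordered_basis W (b' :: 'a::real_vector list)"
  shows "transition_det b b' * transition_det b' b = 1"
proof -
  have "transition_det b b = transition_det b b' * transition_det b' b"
    by (rule transition_det_mult[OF assms ordered_basis_mem[OF assms(1)]]) simp
  then show ?thesis using assms by (simp add: transition_det_self ordered_basis_def)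
qed

lemma transition_det_nonzero:
  assumes "ordered_basis W b" "ordered_basis W (b' :: 'a::real_vector list)"
  shows "transition_det b b' \<noteq> 0"
  using transition_det_inverse[OF assms] by auto

section \<open>Orientations as signs of ordered bases\<close>

lemma orientation_value:
  assumes "\<omega> \<in> orientations W" "ordered_basis W b" "ordered_basis W b'"
  shows "\<omega> b' = (if 0 < transition_det b b' then \<omega> b else - \<omega> b)"
proof -
  have "\<omega> b = 1 \<or> \<omega> b = - 1" "\<omega> b' = 1 \<or> \<omega> b' = - 1" "\<omega> b = \<omega> b' \<longleftrightarrow> 0 < transition_det b b'"
    using assms unfolding orientations_def by blast+
  then show ?thesis by auto
qed

lemma orientation_sign:
  assumes "\<omega> \<in> orientations W" "ordered_basis W b"
  shows "\<omega> b = 1 \<or> \<omega> b = - 1" "\<omega> b * \<omega> b = 1"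
proof -
  show "\<omega> b = 1 \<or> \<omega> b = - 1" using assms unfolding orientations_def by blast
  then show "\<omega> b * \<omega> b = 1" by auto
qed

lemma orientation_not_basis:
  "\<omega> \<in> orientations W \<Longrightarrow> \<not> ordered_basis W b \<Longrightarrow> \<omega> b = 0"
  unfolding orientations_def by blast

lemma orientation_eqI:
  assumes "\<omega> \<in> orientations W" "\<omega>' \<in> orientations W" "ordered_basis W b" "\<omega> b = \<omega>' b"
  shows "\<omega> = \<omega>'"
proof
  fix b'
  show "\<omega> b' = \<omega>' b'"
    using orientation_value[OF assms(1,3)] orientation_value[OF assms(2,3)] assms(4)
      orientation_not_basis[OF assms(1)] orientation_not_basis[OF assms(2)]
    by (cases "ordered_basis W b'") simp_all
qed

lemma orientation_uminus:
  assumes "\<omega> \<in> orientations W"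
  shows "- \<omega> \<in> orientations W"
  using assms unfolding orientations_def by auto

lemma orientation_exists:
  assumes b: "ordered_basis W (b :: 'a::real_vector list)" and e: "e = 1 \<or> e = (- 1 :: int)"
  shows "\<exists>\<omega>\<in>orientations W. \<omega> b = e"
proof -
  define \<omega> where "\<omega> = (\<lambda>b'. if ordered_basis W b' then (if 0 < transition_det b b' then e else - e) else 0)"
  have "\<omega> c = \<omega> c' \<longleftrightarrow> 0 < transition_det c c'" if c: "ordered_basis W c" "ordered_basis W c'" for c c'
  proof -
    have "transition_det b c' = transition_det b c * transition_det c c'"
      by (rule transition_det_mult[OF b c(1) ordered_basis_mem[OF c(2)]])
        (simp add: ordered_basis_length[OF b] ordered_basis_length[OF c(2)])
    then show ?thesis
      using transition_det_nonzero[OF b c(1)] transition_det_nonzero[OF c] e c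
      by (auto simp: \<omega>_def zero_less_mult_iff)
  qed
  then have "\<omega> \<in> orientations W" using e by (auto simp: orientations_def \<omega>_def)
  moreover have "\<omega> b = e" using b by (simp add: \<omega>_def transition_det_self ordered_basis_def)
  ultimately show ?thesis by blast
qed

lemma transition_det_append_left:
  fixes x y y' :: "'a::real_vector list"
  assumes ind: "independent (set (x @ y))" and dist: "distinct (x @ y)"
    and len: "length y' = length y" and sub: "set y' \<subseteq> span (set y)"
  shows "transition_det (x @ y) (x @ y') = transition_det y y'"
proof -
  have "mat (length x) (length x) (\<lambda>(i, j). representation (set (x @ y)) (x ! j) (x ! i)) = 1\<^sub>m (length x)"
    using ind dist by (auto intro!: eq_matI simp: representation_basis nth_eq_iff_index_eq)
  then show ?thesis
    using transition_det_append[OF ind dist refl len sub] by simp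
qed

lemma transition_det_append_right:
  fixes x y x' :: "'a::real_vector list"
  assumes ind: "independent (set (x @ y))" and dist: "distinct (x @ y)"
    and len: "length x' = length x" and sub: "set x' \<subseteq> span (set x)"
  shows "transition_det (x @ y) (x' @ y) = transition_det x x'"
proof -
  have "representation (set (x @ y)) (x' ! j) = representation (set x) (x' ! j)" if "j < length x" for j
    using that sub len by (intro representation_extend[OF ind]) auto
  then have "mat (length x) (length x) (\<lambda>(i, j). representation (set (x @ y)) (x' ! j) (x ! i)) =
      mat (length x) (length x) (\<lambda>(i, j). representation (set x) (x' ! j) (x ! i))"
    by (intro eq_matI) (auto simp del: set_append)
  moreover have "independent (set y)" using ind by (rule independent_mono) auto
  ultimately show ?thesis
    using transition_det_append[OF ind dist len refl] dist
    by (simp add: transition_det_self span_superset) (simp add: transition_det_def)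
qed

lemma representation_nth:
  assumes "independent (set b)" "distinct b" "i < length b"
  shows "representation (set b) (\<Sum>k<length b. c k *\<^sub>R b ! k) (b ! i) = c i"
proof -
  have "representation (set b) (\<Sum>k<length b. c k *\<^sub>R b ! k) (b ! i)
     = (\<Sum>k<length b. c k * (if b ! i = b ! k then 1 else 0))"
    using assms by (subst representation_sum)
      (auto intro!: span_scale[OF span_base] sum.cong simp: representation_scale span_base representation_basis)
  also have "\<dots> = (\<Sum>k<length b. if k = i then c k else 0)"
    using assms by (intro sum.cong) (auto simp: nth_eq_iff_index_eq)
  finally show ?thesis using assms by simp
qed

lemma span_list_sum:
  assumes "independent (set b)" "distinct b" "x \<in> span (set b)"
  shows "x = (\<Sum>k<length b. representation (set b) x (b ! k) *\<^sub>R b ! k)"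
proof -
  have "x = (\<Sum>v\<in>set b. representation (set b) x v *\<^sub>R v)"
    using assms by (simp add: real_vector.sum_representation_eq)
  also have "\<dots> = (\<Sum>k<length b. representation (set b) x (b ! k) *\<^sub>R b ! k)"
    using bij_betw_nth[OF assms(2) refl refl] by (subst sum.reindex_bij_betw[symmetric, of "(!) b" "{..<length b}"]) auto
  finally show ?thesis .
qed

lemma transition_det_map:
  fixes T :: "'a::real_vector \<Rightarrow> 'e::real_vector"
  assumes T: "linear T" and inj: "inj_on T (span (set b))"
    and ind: "independent (set b)" and dist: "distinct b"
    and b': "set b' \<subseteq> span (set b)" and len: "length b' = length b"
  shows "transition_det (map T b) (map T b') = transition_det b b'"
proof -
  have ind': "independent (set (map T b))"
    using linear_independent_injective_image[OF T ind inj] by simp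
  have dist': "distinct (map T b)"
    using dist inj by (auto simp: distinct_map intro: inj_on_subset[OF _ span_superset])
  have "representation (set (map T b)) (map T b' ! j) (map T b ! i) = representation (set b) (b' ! j) (b ! i)"
    if ij: "i < length b" "j < length b" for i j
  proof -
    have "b' ! j \<in> span (set b)" using b' ij len by auto
    note eq = span_list_sum[OF ind dist this]
    have "T (b' ! j) = (\<Sum>k<length (map T b). representation (set b) (b' ! j) (b ! k) *\<^sub>R map T b ! k)"
      by (subst eq) (simp add: linear_sum[OF T] linear_scale[OF T])
    then show ?thesis
      using representation_nth[OF ind' dist', of i "\<lambda>k. representation (set b) (b' ! j) (b ! k)"] ij len by simp
  qed
  then show ?thesis unfolding transition_det_def
    by (intro arg_cong[where f = Determinant.det] eq_matI) (auto simp: len simp del: set_map nth_map)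
qed

text \<open>Only an embedded block of the basis changes while its context \<open>c1\<close>,
  \<open>c2\<close> stays. Block triangularity on either side of the block removes the context from
  the determinant.\<close>

lemma transition_det_context:
  fixes T :: "'a::real_vector \<Rightarrow> 'e::real_vector"
  assumes T: "linear T" and inj: "inj_on T (span (set b))"
    and bas: "ordered_basis E (c1 @ map T b @ c2)" and b: "independent (set b)" "distinct b"
    and b': "set b' \<subseteq> span (set b)" and len: "length b' = length b"
  shows "transition_det (c1 @ map T b @ c2) (c1 @ map T b' @ c2) = transition_det b b'"
proof -
  have ind: "independent (set (c1 @ (map T b @ c2)))" and dist: "distinct (c1 @ (map T b @ c2))"
    using bas by (auto simp: ordered_basis_def)
  have ind2: "independent (set (map T b @ c2))" using ind by (rule independent_mono) auto
  have dist2: "distinct (map T b @ c2)" using dist by auto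
  have sub: "set (map T b') \<subseteq> span (set (map T b))"
    using b' T by (auto simp: linear_span_image)
  then have "set (map T b' @ c2) \<subseteq> span (set (map T b @ c2))"
    using span_mono[of "set (map T b)" "set (map T b @ c2)"] by (auto intro: span_base)
  then have "transition_det (c1 @ map T b @ c2) (c1 @ map T b' @ c2) =
      transition_det (map T b @ c2) (map T b' @ c2)"
    by (intro transition_det_append_left ind dist) (simp_all add: len)
  also have "\<dots> = transition_det (map T b) (map T b')"
    by (rule transition_det_append_right[OF ind2 dist2 _ sub]) (simp add: len)
  also have "\<dots> = transition_det b b'"
    by (rule transition_det_map[OF T inj b b' len])
  finally show ?thesis .
qed

text \<open>One construction for all induced orientations: on a facet (\<open>c1\<close> is the
  outward vector), on a factor of a direct sum (\<open>c1\<close> or \<open>c2\<close> is a basis of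
  the other factor), and between \<open>V\<close> and \<open>V \<times> \<real>\<close>
  (\<open>T\<close> is a shear).\<close>

lemma orientation_pullback:
  fixes T :: "'a::real_vector \<Rightarrow> 'e::real_vector"
  assumes \<omega>: "\<omega> \<in> orientations E" and T: "linear T" and inj: "inj_on T U"
    and bas: "\<And>b. ordered_basis U b \<Longrightarrow> ordered_basis E (c1 @ map T b @ c2)"
  shows "(\<lambda>b. if ordered_basis U b then \<omega> (c1 @ map T b @ c2) else 0) \<in> orientations U"
proof -
  have "\<omega> (c1 @ map T b @ c2) = \<omega> (c1 @ map T b' @ c2) \<longleftrightarrow> 0 < transition_det b b'"
    if b: "ordered_basis U b" "ordered_basis U b'" for b b'
  proof -
    have "transition_det (c1 @ map T b @ c2) (c1 @ map T b' @ c2) = transition_det b b'"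
      using b inj ordered_basis_mem[OF b(2)] ordered_basis_length[OF b(1)] ordered_basis_length[OF b(2)]
      by (intro transition_det_context[OF T _ bas[OF b(1)]]) (auto simp: ordered_basis_def)
    then show ?thesis using \<omega> bas[OF b(1)] bas[OF b(2)] unfolding orientations_def by auto
  qed
  moreover have "\<omega> (c1 @ map T b @ c2) = 1 \<or> \<omega> (c1 @ map T b @ c2) = - 1" if "ordered_basis U b" for b
    using orientation_sign(1)[OF \<omega> bas[OF that]] .
  ultimately show ?thesis unfolding orientations_def by auto
qed

lemma ordered_basis_permute:
  assumes "set b = set b'" "length b = length b'"
  shows "ordered_basis W b \<longleftrightarrow> ordered_basis W b'"
  using assms by (metis card_distinct distinct_card ordered_basis_def)

lemma orientation_swap:
  fixes a b :: "'a::real_vector"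
  assumes \<omega>: "\<omega> \<in> orientations W"
  shows "\<omega> (xs @ a # b # ys) = - \<omega> (xs @ b # a # ys)"
proof (cases "ordered_basis W (xs @ b # a # ys)")
  case bas: True
  have bas': "ordered_basis W (xs @ a # b # ys)"
    using bas by (subst ordered_basis_permute[of _ "xs @ b # a # ys"]) auto
  then have ind: "independent (set (xs @ ([a, b] @ ys)))" and dist: "distinct (xs @ ([a, b] @ ys))"
    by (auto simp: ordered_basis_def)
  have ind2: "independent (set ([a, b] @ ys))" using ind by (rule independent_mono) auto
  have ind3: "independent (set [a, b])" using ind by (rule independent_mono) auto
  have "transition_det (xs @ [a, b] @ ys) (xs @ [b, a] @ ys) = transition_det ([a, b] @ ys) ([b, a] @ ys)"
    using dist by (intro transition_det_append_left ind) (auto intro: span_base)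
  also have "\<dots> = transition_det [a, b] [b, a]"
    using dist by (intro transition_det_append_right ind2) (auto intro: span_base)
  also have "\<dots> = - 1"
  proof -
    have ne: "a \<noteq> b" using dist by auto
    have "mat 2 2 (\<lambda>(i, j). representation (set [a, b]) ([b, a] ! j) ([a, b] ! i)) = swaprows 0 1 (1\<^sub>m 2)"
      using ind3 ne by (intro eq_matI) (auto simp: less_2_cases_iff representation_basis)
    then show ?thesis
      unfolding transition_det_def using det_swaprows[of 0 2 1 "1\<^sub>m 2 :: real mat"] by (simp add: numeral_2_eq_2)
  qed
  finally have "transition_det (xs @ a # b # ys) (xs @ b # a # ys) = - 1" by simp
  then show ?thesis using orientation_value[OF \<omega> bas' bas] by simp
next
  case False
  then have "\<not> ordered_basis W (xs @ a # b # ys)"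
    by (subst ordered_basis_permute[of _ "xs @ b # a # ys"]) auto
  then show ?thesis using False \<omega> by (simp add: orientation_not_basis)
qed

text \<open>Origin of the sign in the Leibniz rule: with \<open>xs\<close> a basis of the first,
  \<open>p\<close>-dimensional factor, the outward vector of the second factor has to pass
  \<open>p\<close> vectors to come first.\<close>

lemma orientation_move_front:
  fixes n :: "'a::real_vector"
  assumes \<omega>: "\<omega> \<in> orientations W"
  shows "\<omega> (xs @ n # ys) = (- 1) ^ length xs * \<omega> (n # xs @ ys)"
proof (induction xs arbitrary: ys rule: rev_induct)
  case (snoc x xs)
  have "\<omega> ((xs @ [x]) @ n # ys) = - \<omega> (xs @ n # x # ys)"
    using orientation_swap[OF \<omega>, of xs x n ys] by simp
  then show ?case using snoc[of "x # ys"] by simp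
qed simp

lemma ordered_basisI_span:
  assumes "span (set b) = W" "length b = dim W"
  shows "ordered_basis W (b :: 'a::euclidean_space list)"
proof -
  have "dim W \<le> card (set b)" using assms(1) by (metis List.finite_set dim_le_card span_superset subset_refl)
  then have c: "card (set b) = length b" using assms(2) card_length[of b] by linarith
  then have "distinct b" by (rule card_distinct)
  moreover have "independent (set b)"
    by (rule card_le_dim_spanning[of _ W]) (use assms c span_superset in auto)
  ultimately show ?thesis using assms by (simp add: ordered_basis_def)
qed

lemma ordered_basisI_independent:
  assumes "distinct b" "independent (set b)" "set b \<subseteq> W" "subspace W" "length b = dim W"
  shows "ordered_basis W (b :: 'a::euclidean_space list)"
proof -
  have "dim (set b) = dim W" using assms by (metis dim_eq_card_independent distinct_card)
  then have "span (set b) = W"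
    using assms by (metis dim_eq_span order_refl span_eq_iff)
  then show ?thesis using assms by (simp add: ordered_basis_def)
qed

definition isgn :: "real \<Rightarrow> int"
  where "isgn x = (if 0 < x then 1 else if x < 0 then - 1 else 0)"

lemma ordered_basis_Cons:
  fixes n :: "'a::euclidean_space"
  assumes c: "distinct c" "independent (set c)" "set c \<subseteq> E" and E: "subspace E" "dim E = length c + 1"
    and orth: "\<And>x. x \<in> set c \<Longrightarrow> \<psi> \<bullet> x = 0" and n: "n \<in> E" "\<psi> \<bullet> n \<noteq> 0"
  shows "ordered_basis E (n # c)"
proof -
  have "n \<notin> span (set c)"
  proof
    assume "n \<in> span (set c)"
    then have "orthogonal \<psi> n" by (rule orthogonal_to_span) (use orth in \<open>auto simp: orthogonal_def\<close>)
    then show False using n by (simp add: orthogonal_def)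
  qed
  then show ?thesis
    using c E n by (intro ordered_basisI_independent) (auto simp: independent_insert intro: span_base)
qed

text \<open>As \<open>\<psi>\<close> kills \<open>c\<close>, replacing \<open>n0\<close> by
  \<open>n\<close> in front of \<open>c\<close> has determinant
  \<open>(\<psi> \<bullet> n) / (\<psi> \<bullet> n0)\<close>. Thus all orientation signs in one
  coefficient become signs of a single functional, up to a common factor
  \<open>\<kappa>\<close>.\<close>

lemma orientation_Cons_sign:
  fixes \<psi> :: "'a::euclidean_space"
  assumes \<omega>: "\<omega> \<in> orientations E" and c: "distinct c" "independent (set c)" "set c \<subseteq> E"
    and E: "subspace E" "dim E = length c + 1"
    and orth: "\<And>x. x \<in> set c \<Longrightarrow> \<psi> \<bullet> x = 0"
  obtains \<kappa> where "\<kappa> = 1 \<or> \<kappa> = (- 1 :: int)" "\<And>n. n \<in> E \<Longrightarrow> \<psi> \<bullet> n \<noteq> 0 \<Longrightarrow> \<omega> (n # c) = \<kappa> * isgn (\<psi> \<bullet> n)"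
proof (cases "\<exists>n0\<in>E. \<psi> \<bullet> n0 \<noteq> 0")
  case True
  then obtain n0 where n0: "n0 \<in> E" "\<psi> \<bullet> n0 \<noteq> 0" by blast
  note bas = ordered_basis_Cons[OF c E orth]
  note b0 = bas[OF _ n0]
  then have ind: "independent (set ([n0] @ c))" and dist: "distinct ([n0] @ c)" and sp: "span (set ([n0] @ c)) = E"
    by (auto simp: ordered_basis_def)
  have "\<omega> (n # c) = (\<omega> (n0 # c) * isgn (\<psi> \<bullet> n0)) * isgn (\<psi> \<bullet> n)" if n: "n \<in> E" "\<psi> \<bullet> n \<noteq> 0" for n
  proof -
    let ?r = "representation (set ([n0] @ c)) n"
    have "n = (\<Sum>v\<in>set ([n0] @ c). ?r v *\<^sub>R v)"
      using n sp ind by (subst real_vector.sum_representation_eq) auto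
    also have "\<dots> = ?r n0 *\<^sub>R n0 + (\<Sum>v\<in>set c. ?r v *\<^sub>R v)" using dist by simp
    finally have "\<psi> \<bullet> n = \<psi> \<bullet> (?r n0 *\<^sub>R n0 + (\<Sum>v\<in>set c. ?r v *\<^sub>R v))" by metis
    also have "\<dots> = ?r n0 * (\<psi> \<bullet> n0)" using orth by (simp add: inner_add_right inner_sum_right)
    finally have r: "?r n0 = (\<psi> \<bullet> n) / (\<psi> \<bullet> n0)" using n0 by (simp add: field_simps)
    have "transition_det ([n0] @ c) ([n] @ c) = ?r n0 * transition_det c c"
      using transition_det_append[OF ind dist, of "[n]" c]
      by (simp add: span_superset det_single)
    also have "\<dots> = (\<psi> \<bullet> n) / (\<psi> \<bullet> n0)" using r c by (simp add: transition_det_self)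
    finally have "transition_det (n0 # c) (n # c) = (\<psi> \<bullet> n) / (\<psi> \<bullet> n0)" by simp
    with orientation_value[OF \<omega> b0 bas[OF _ n]] n n0 show ?thesis
      by (auto simp: isgn_def zero_less_divide_iff)
  qed
  moreover have "\<omega> (n0 # c) * isgn (\<psi> \<bullet> n0) = 1 \<or> \<omega> (n0 # c) * isgn (\<psi> \<bullet> n0) = - 1"
    using orientation_sign(1)[OF \<omega> b0] n0 by (auto simp: isgn_def)
  ultimately show ?thesis using that by blast
next
  \<comment> \<open>Here \<open>\<psi>\<close> vanishes on \<open>E\<close>, the formula is vacuous,
    and either sign will do.\<close>
  case False
  then show ?thesis using that[of 1] by auto
qed

definition msum :: "'a::real_vector set \<Rightarrow> 'a set \<Rightarrow> 'a set"
  where "msum U W = {x + y |x y. x \<in> U \<and> y \<in> W}"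

lemma ordered_basis_append:
  fixes b b' :: "'a::euclidean_space list"
  assumes b: "ordered_basis U b" "ordered_basis U' b'" and int: "U \<inter> U' = {0}"
  shows "ordered_basis (msum U U') (b @ b')"
proof (rule ordered_basisI_span)
  have U: "span (set b) = U" "span (set b') = U'" using b by (auto simp: ordered_basis_def)
  then have sub: "subspace U" "subspace U'" by (metis subspace_span)+
  show "span (set (b @ b')) = msum U U'" using U by (simp add: span_Un msum_def)
  have "dim (msum U U') = dim U + dim U'"
    using dim_sums_Int[OF sub] int by (simp add: msum_def)
  then show "length (b @ b') = dim (msum U U')" using ordered_basis_length[OF b(1)] ordered_basis_length[OF b(2)] by simp
qed

lemma ordered_basis_map:
  fixes T :: "'a::real_vector \<Rightarrow> 'e::real_vector"
  assumes b: "ordered_basis U b" and T: "linear T" "inj_on T U"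
  shows "ordered_basis (T ` U) (map T b)"
  using assms linear_independent_injective_image[OF T(1), of "set b"] linear_span_image[OF T(1), of "set b"]
  by (auto simp: ordered_basis_def distinct_map intro: inj_on_subset[OF _ span_superset])

section \<open>Direction spaces and faces of polytopes\<close>

abbreviation ds :: "'b::real_vector set \<Rightarrow> 'b set"
  where "ds \<equiv> direction_space"

lemma subspace_ds [simp]: "subspace (ds C)"
  by (simp add: direction_space_def)

lemma ds_diff: "x \<in> C \<Longrightarrow> y \<in> C \<Longrightarrow> x - y \<in> ds C"
  unfolding direction_space_def by (rule span_base) auto

lemma ds_mono: "C \<subseteq> D \<Longrightarrow> ds C \<subseteq> ds D"
  unfolding direction_space_def by (rule span_mono) auto

lemma ds_least: "subspace W \<Longrightarrow> (\<And>x y. x \<in> C \<Longrightarrow> y \<in> C \<Longrightarrow> x - y \<in> W) \<Longrightarrow> ds C \<subseteq> W"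
  unfolding direction_space_def by (rule span_minimal) auto

lemma ds_orthogonal_iff:
  "(\<forall>z\<in>ds C. f \<bullet> z = 0) \<longleftrightarrow> (\<forall>x\<in>C. \<forall>y\<in>C. f \<bullet> x = f \<bullet> y)"
proof
  assume "\<forall>z\<in>ds C. f \<bullet> z = 0"
  then show "\<forall>x\<in>C. \<forall>y\<in>C. f \<bullet> x = f \<bullet> y"
    using ds_diff[of _ C] by (fastforce simp: inner_diff_right)
next
  assume "\<forall>x\<in>C. \<forall>y\<in>C. f \<bullet> x = f \<bullet> y"
  then have "f \<bullet> (x - y) = 0" if "x \<in> C" "y \<in> C" for x y
    using that by (metis inner_diff_right right_minus_eq)
  then have "ds C \<subseteq> {z. f \<bullet> z = 0}"
    by (intro ds_least) (auto simp: subspace_hyperplane)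
  then show "\<forall>z\<in>ds C. f \<bullet> z = 0" by auto
qed

lemma ds_eq_span:
  assumes "a \<in> C"
  shows "ds C = span ((\<lambda>x. x - a) ` C)"
proof
  show "ds C \<subseteq> span ((\<lambda>x. x - a) ` C)"
  proof (rule ds_least)
    fix x y assume "x \<in> C" "y \<in> C"
    then have "(x - a) - (y - a) \<in> span ((\<lambda>x. x - a) ` C)" by (intro span_diff[OF span_base span_base]) auto
    then show "x - y \<in> span ((\<lambda>x. x - a) ` C)" by simp
  qed simp
  show "span ((\<lambda>x. x - a) ` C) \<subseteq> ds C"
    by (rule span_minimal) (auto simp: ds_diff assms)
qed

lemma aff_dim_cell_dim:
  fixes C :: "'a::euclidean_space set"
  assumes "C \<noteq> {}"
  shows "aff_dim C = int (cell_dim C)"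
proof -
  obtain a where a: "a \<in> C" using assms by auto
  have "aff_dim C = int (dim ((+) (- a) ` C))" using a by (intro aff_dim_eq_dim) (simp add: hull_inc)
  also have "(+) (- a) ` C = (\<lambda>x. x - a) ` C" by auto
  finally show ?thesis using ds_eq_span[OF a] by (simp add: cell_dim_def)
qed

lemma cell_dim_mono: "C \<subseteq> D \<Longrightarrow> cell_dim C \<le> cell_dim (D :: 'a::euclidean_space set)"
  by (simp add: cell_dim_def dim_subset ds_mono)

lemma face_eqI:
  fixes C :: "'a::euclidean_space set"
  assumes "C face_of D" "C \<noteq> {}" "convex D" "cell_dim D \<le> cell_dim C"
  shows "C = D"
proof (rule ccontr)
  assume "C \<noteq> D"
  then have "aff_dim C < aff_dim D" using assms face_of_aff_dim_lt by blast
  moreover have "D \<noteq> {}" using assms face_of_imp_subset by fastforce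
  ultimately show False using assms by (simp add: aff_dim_cell_dim)
qed

lemma facet_iff_cell_dim:
  fixes C :: "'a::euclidean_space set"
  shows "C facet_of D \<longleftrightarrow> C face_of D \<and> C \<noteq> {} \<and> cell_dim D = cell_dim C + 1"
proof (cases "C face_of D \<and> C \<noteq> {}")
  case True
  then have "D \<noteq> {}" using face_of_imp_subset by fastforce
  then show ?thesis using True by (auto simp: facet_of_def aff_dim_cell_dim)
qed (auto simp: facet_of_def)

lemma facet_subset: "C facet_of D \<Longrightarrow> C \<subseteq> D"
  by (simp add: facet_of_imp_subset)

lemma subspace_hyperplane_mem:
  fixes H E :: "'a::euclidean_space set"
  assumes "subspace H" "subspace E" "H \<subseteq> E" "dim E = dim H + 1"
    and "\<And>z. z \<in> H \<Longrightarrow> f \<bullet> z = 0" and "n \<in> E" "f \<bullet> n \<noteq> 0" and "z \<in> E" "f \<bullet> z = 0"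
  shows "z \<in> H"
proof -
  let ?K = "E \<inter> {x. f \<bullet> x = 0}"
  have K: "subspace ?K" using assms(2) subspace_hyperplane by (rule subspace_inter)
  have "?K \<subset> E" using assms by auto
  then have "dim ?K < dim E" using K assms(2) by (metis dim_psubset span_eq_iff)
  moreover have "H \<subseteq> ?K" using assms(3,5) by blast
  ultimately have "H = ?K" using assms(1,4) K by (intro subspace_dim_equal) linarith+
  then show ?thesis using assms(8,9) by blast
qed

section \<open>Maximal faces of linear functionals\<close>

text \<open>Dual cones without dual spaces: \<open>A \<subseteq> amax \<gamma> f\<close> says that
  \<open>f\<close> lies in the dual cone of \<open>A\<close>, and equality that it lies in the
  relative interior of that cone.\<close>

definition amax :: "'a::euclidean_space set \<Rightarrow> 'a \<Rightarrow> 'a set"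
  where "amax \<gamma> f = {y \<in> \<gamma>. \<forall>x\<in>\<gamma>. f \<bullet> x \<le> f \<bullet> y}"

lemma amax_subset: "amax \<gamma> f \<subseteq> \<gamma>"
  by (auto simp: amax_def)

lemma amax_face_of:
  assumes "convex \<gamma>"
  shows "amax \<gamma> f face_of \<gamma>"
proof (cases "amax \<gamma> f = {}")
  case False
  then obtain y where y: "y \<in> \<gamma>" "\<And>x. x \<in> \<gamma> \<Longrightarrow> f \<bullet> x \<le> f \<bullet> y" by (auto simp: amax_def)
  then have "amax \<gamma> f = \<gamma> \<inter> {x. f \<bullet> x = f \<bullet> y}" by (force simp: amax_def)
  then show ?thesis using face_of_Int_supporting_hyperplane_le[OF assms y(2)] by simp
qed simp

lemma amax_orthogonal:
  assumes "\<alpha> \<subseteq> amax \<gamma> f" "z \<in> ds \<alpha>"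
  shows "f \<bullet> z = 0"
proof -
  have "\<forall>x\<in>\<alpha>. \<forall>y\<in>\<alpha>. f \<bullet> x = f \<bullet> y" using assms(1) unfolding amax_def by (blast intro: antisym)
  then show ?thesis using assms(2) ds_orthogonal_iff by blast
qed

lemma amax_cong:
  assumes "\<And>z. z \<in> ds \<gamma> \<Longrightarrow> f \<bullet> z = g \<bullet> z"
  shows "amax \<gamma> f = amax \<gamma> g"
proof -
  have "f \<bullet> x \<le> f \<bullet> y \<longleftrightarrow> g \<bullet> x \<le> g \<bullet> y" if "x \<in> \<gamma>" "y \<in> \<gamma>" for x y
    using assms[OF ds_diff[OF that]] unfolding inner_diff_right by linarith
  then show ?thesis by (auto simp: amax_def)
qed

lemma amax_scale: "0 < c \<Longrightarrow> amax \<gamma> (c *\<^sub>R f) = amax \<gamma> f"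
  by (simp add: amax_def)

lemma amax_mono_set: "\<mu> \<subseteq> \<gamma> \<Longrightarrow> \<alpha> \<subseteq> \<mu> \<Longrightarrow> \<alpha> \<subseteq> amax \<gamma> f \<Longrightarrow> \<alpha> \<subseteq> amax \<mu> f"
  by (auto simp: amax_def)

lemma amax_const: "(\<And>z. z \<in> ds \<alpha> \<Longrightarrow> f \<bullet> z = 0) \<Longrightarrow> amax \<alpha> f = \<alpha>"
proof
  assume "\<And>z. z \<in> ds \<alpha> \<Longrightarrow> f \<bullet> z = 0"
  then have "\<forall>x\<in>\<alpha>. \<forall>y\<in>\<alpha>. f \<bullet> x = f \<bullet> y" by (simp add: ds_orthogonal_iff[symmetric])
  then show "\<alpha> \<subseteq> amax \<alpha> f" unfolding amax_def by (blast intro: eq_refl)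
qed (rule amax_subset)

lemma polytope_face_amax:
  assumes "polytope \<gamma>" "A face_of \<gamma>" "A \<noteq> {}"
  obtains f where "amax \<gamma> f = A"
proof -
  have "A exposed_face_of \<gamma>" using assms by (simp add: exposed_face_of_polyhedron polytope_imp_polyhedron)
  then obtain a b where ab: "\<gamma> \<subseteq> {x. a \<bullet> x \<le> b}" "A = \<gamma> \<inter> {x. a \<bullet> x = b}"
    by (auto simp: exposed_face_of_def)
  then have "amax \<gamma> a = A" using assms(3) by (fastforce simp: amax_def)
  then show ?thesis by (rule that)
qed

text \<open>Polytopes are convex hulls of finitely many points, so a large multiple of \<open>g\<close> dominates
  any functional \<open>f\<close> off the face where \<open>g\<close> is maximal.\<close>

lemma amax_add_large:
  assumes "polytope \<gamma>" "\<alpha> \<subseteq> amax (amax \<gamma> g) f"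
  obtains s0 where "\<And>s. s0 \<le> s \<Longrightarrow> \<alpha> \<subseteq> amax \<gamma> (f + s *\<^sub>R g)"
proof (cases "\<alpha> = {}")
  case False
  then obtain y0 where y0: "y0 \<in> \<alpha>" by auto
  obtain K where K: "finite K" "\<gamma> = convex hull K" using assms(1) by (auto simp: polytope_def)
  have y0\<gamma>: "y0 \<in> amax \<gamma> g" and fy0: "\<And>x. x \<in> amax \<gamma> g \<Longrightarrow> f \<bullet> x \<le> f \<bullet> y0"
    using assms(2) y0 by (auto simp: amax_def)
  \<comment> \<open>The multiple of \<open>g\<close> that makes up for the advantage of
    \<open>f\<close> at \<open>k\<close>. The absolute value lets the sum over \<open>K\<close>
    bound every summand; for \<open>k\<close> on the face the denominator is 0 and so is
    \<open>c k\<close>.\<close>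
  define c where "c k = \<bar>(f \<bullet> k - f \<bullet> y0) / (g \<bullet> y0 - g \<bullet> k)\<bar>" for k
  have "\<alpha> \<subseteq> amax \<gamma> (f + s *\<^sub>R g)" if s: "(\<Sum>k\<in>K. c k) \<le> s" for s
  proof -
    have "(f + s *\<^sub>R g) \<bullet> k \<le> (f + s *\<^sub>R g) \<bullet> y0" if k: "k \<in> K" for k
    proof -
      have k\<gamma>: "k \<in> \<gamma>" using k K by (simp add: hull_inc)
      show ?thesis
      proof (cases "k \<in> amax \<gamma> g")
        case True
        then have "g \<bullet> k = g \<bullet> y0" using y0\<gamma> by (auto simp: amax_def intro: antisym)
        then show ?thesis using fy0[OF True] by (simp add: inner_add_left)
      next
        case F: False
        then have less: "0 < g \<bullet> y0 - g \<bullet> k"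
          using k\<gamma> y0\<gamma> by (force simp: amax_def not_le)
        have "c k \<le> (\<Sum>k\<in>K. c k)" using k K by (intro member_le_sum) (auto simp: c_def)
        then have "(f \<bullet> k - f \<bullet> y0) / (g \<bullet> y0 - g \<bullet> k) \<le> s" using s abs_ge_self unfolding c_def by (meson order_trans)
        then have "f \<bullet> k - f \<bullet> y0 \<le> s * (g \<bullet> y0 - g \<bullet> k)" using less by (simp add: pos_divide_le_eq)
        then show ?thesis by (simp add: inner_add_left algebra_simps)
      qed
    qed
    then have "convex hull K \<subseteq> {x. (f + s *\<^sub>R g) \<bullet> x \<le> (f + s *\<^sub>R g) \<bullet> y0}"
      by (intro hull_minimal) (auto simp: convex_halfspace_le)
    moreover have "f \<bullet> y = f \<bullet> y0 \<and> g \<bullet> y = g \<bullet> y0 \<and> y \<in> \<gamma>" if "y \<in> \<alpha>" for y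
      using assms(2) that y0\<gamma> y0 by (auto simp: amax_def subset_iff intro!: antisym)
    ultimately show ?thesis using K by (auto simp: amax_def inner_add_left)
  qed
  then show ?thesis by (rule that)
qed (use that in auto)

text \<open>For \<open>s > 0\<close> the functional \<open>g + s f\<close> is \<open>s\<close> times
  \<open>f + (1/s) g\<close>, so a small perturbation of \<open>g\<close> is a large multiple of
  \<open>g\<close> added to \<open>f\<close>. The bound \<open>1 / (\<bar>s0\<bar> + 1)\<close>
  ensures \<open>s0 \<le> 1 / s\<close>.\<close>

lemma amax_perturb:
  assumes "polytope \<gamma>" "\<alpha> \<subseteq> amax (amax \<gamma> g) f"
  obtains e where "0 < e" "\<And>s. 0 \<le> s \<Longrightarrow> s \<le> e \<Longrightarrow> \<alpha> \<subseteq> amax \<gamma> (g + s *\<^sub>R f)"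
proof -
  obtain s0 where s0: "\<And>s. s0 \<le> s \<Longrightarrow> \<alpha> \<subseteq> amax \<gamma> (f + s *\<^sub>R g)"
    using amax_add_large[OF assms] by blast
  have "\<alpha> \<subseteq> amax \<gamma> (g + s *\<^sub>R f)" if s: "0 \<le> s" "s \<le> 1 / (\<bar>s0\<bar> + 1)" for s
  proof (cases "s = 0")
    case True
    then show ?thesis using assms(2) amax_subset by fastforce
  next
    case False
    then have "\<bar>s0\<bar> + 1 \<le> 1 / s" using s by (simp add: field_simps)
    then have "s0 \<le> 1 / s" by linarith
    from s0[OF this] have "\<alpha> \<subseteq> amax \<gamma> (s *\<^sub>R (f + (1 / s) *\<^sub>R g))"
      using False s by (simp add: amax_scale)
    then show ?thesis using False by (simp add: scaleR_add_right add.commute)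
  qed
  then show ?thesis by (intro that[of "1 / (\<bar>s0\<bar> + 1)"]) auto
qed

text \<open>The very choice made inside \<open>boundary_orientation\<close>, named so that
  functionals can be evaluated on it.\<close>

definition outward :: "'a::real_vector set \<Rightarrow> 'a set \<Rightarrow> 'a"
  where "outward \<mu> \<delta> = (SOME n. \<exists>y\<in>\<delta>. \<exists>x\<in>\<mu> - \<delta>. n = y - x)"

lemma outward_obtain:
  fixes \<mu> :: "'a::euclidean_space set"
  assumes "\<delta> facet_of \<mu>"
  obtains y x where "y \<in> \<delta>" "x \<in> \<mu> - \<delta>" "outward \<mu> \<delta> = y - x"
proof -
  have "\<delta> \<noteq> \<mu>" "\<delta> \<noteq> {}" "\<delta> \<subseteq> \<mu>" using assms by (auto simp: facet_of_def face_of_imp_subset)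
  then have "\<exists>n. \<exists>y\<in>\<delta>. \<exists>x\<in>\<mu> - \<delta>. n = y - x" by blast
  from someI_ex[OF this] show ?thesis using that unfolding outward_def by blast
qed

lemma outward_mem: "\<delta> facet_of \<mu> \<Longrightarrow> outward \<mu> \<delta> \<in> ds (\<mu> :: 'a::euclidean_space set)"
  using outward_obtain facet_subset by (metis Diff_iff ds_diff subsetD)

lemma outward_amax:
  assumes "\<delta> facet_of \<mu>" "\<delta> = amax \<mu> f"
  shows "0 < f \<bullet> outward \<mu> \<delta>"
proof -
  obtain y x where "y \<in> \<delta>" "x \<in> \<mu> - \<delta>" "outward \<mu> \<delta> = y - x" using outward_obtain[OF assms(1)] .
  moreover have "f \<bullet> x < f \<bullet> y" using calculation assms(2) by (force simp: amax_def not_le)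
  ultimately show ?thesis by (simp add: inner_diff_right)
qed

text \<open>A functional constant on a facet is on the direction space a multiple of the outward conormal.\<close>

lemma facet_cases:
  fixes M :: "'a::euclidean_space set"
  assumes M: "polytope M" and fac: "\<alpha> facet_of M"
    and orth: "\<And>z. z \<in> ds \<alpha> \<Longrightarrow> \<psi> \<bullet> z = 0" and ne: "\<exists>z\<in>ds M. \<psi> \<bullet> z \<noteq> 0"
  shows "0 < \<psi> \<bullet> outward M \<alpha> \<and> \<alpha> = amax M \<psi> \<or> \<psi> \<bullet> outward M \<alpha> < 0 \<and> \<alpha> = amax M (- \<psi>)"
proof -
  obtain g where g: "amax M g = \<alpha>"
    using polytope_face_amax[OF M, of \<alpha>] fac by (auto simp: facet_of_def)
  define n where "n = outward M \<alpha>"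
  have n: "n \<in> ds M" "0 < g \<bullet> n" using outward_mem[OF fac] outward_amax[OF fac g[symmetric]] by (auto simp: n_def)
  \<comment> \<open>Split \<open>z\<close> into a multiple of \<open>n\<close> and a vector killed
    by \<open>g\<close>. Within \<open>ds M\<close> the kernel of \<open>g\<close> is
    \<open>ds \<alpha>\<close> by dimension, and \<open>\<psi>\<close> vanishes there.\<close>
  have eq: "\<psi> \<bullet> z = (\<psi> \<bullet> n / (g \<bullet> n)) * (g \<bullet> z)" if z: "z \<in> ds M" for z
  proof -
    have "z - (g \<bullet> z / (g \<bullet> n)) *\<^sub>R n \<in> ds \<alpha>"
    proof (rule subspace_hyperplane_mem[of _ "ds M" g n])
      show "dim (ds M) = dim (ds \<alpha>) + 1" using fac by (simp add: facet_iff_cell_dim cell_dim_def)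
      show "g \<bullet> z = 0" if "z \<in> ds \<alpha>" for z using amax_orthogonal[of \<alpha> M g z] g that by auto
      show "g \<bullet> (z - (g \<bullet> z / (g \<bullet> n)) *\<^sub>R n) = 0" using n by (simp add: inner_diff_right)
    qed (use n z fac in \<open>auto simp: ds_mono facet_subset intro!: subspace_diff subspace_scale\<close>)
    from orth[OF this] show ?thesis by (simp add: inner_diff_right)
  qed
  then have "\<psi> \<bullet> n \<noteq> 0" using ne by auto
  then consider "0 < \<psi> \<bullet> n" | "\<psi> \<bullet> n < 0" by linarith
  then show ?thesis
  proof cases
    case 1
    then have "amax M \<psi> = amax M ((\<psi> \<bullet> n / (g \<bullet> n)) *\<^sub>R g)" using eq by (intro amax_cong) simp
    then show ?thesis using 1 n g by (simp add: amax_scale n_def)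
  next
    case 2
    then have "amax M (- \<psi>) = amax M ((- \<psi> \<bullet> n / (g \<bullet> n)) *\<^sub>R g)" using eq by (intro amax_cong) simp
    moreover have "0 < - \<psi> \<bullet> n / (g \<bullet> n)" using 2 n by (simp add: divide_neg_pos)
    ultimately show ?thesis using 2 g amax_scale by (metis n_def)
  qed
qed

section \<open>Pencils of functionals\<close>

lemma pencil_closed:
  assumes "\<alpha> \<subseteq> \<gamma>"
  shows "closed {s::real. \<alpha> \<subseteq> amax \<gamma> (f + s *\<^sub>R \<psi>)}"
proof -
  have "{s. \<alpha> \<subseteq> amax \<gamma> (f + s *\<^sub>R \<psi>)} =
      (\<Inter>y\<in>\<alpha>. \<Inter>x\<in>\<gamma>. {s. f \<bullet> x + s * (\<psi> \<bullet> x) \<le> f \<bullet> y + s * (\<psi> \<bullet> y)})"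
    using assms by (auto simp: amax_def inner_add_left)
  then show ?thesis by (auto intro!: closed_INT closed_Collect_le continuous_intros)
qed

lemma pencil_interval:
  assumes "\<alpha> \<subseteq> amax \<gamma> (f + s1 *\<^sub>R \<psi>)" "\<alpha> \<subseteq> amax \<gamma> (f + s2 *\<^sub>R \<psi>)" "s1 \<le> s" "s \<le> s2"
  shows "\<alpha> \<subseteq> amax \<gamma> (f + s *\<^sub>R \<psi>)"
proof -
  have "f \<bullet> x + s * (\<psi> \<bullet> x) \<le> f \<bullet> y + s * (\<psi> \<bullet> y)" if "y \<in> \<alpha>" "x \<in> \<gamma>" for x y
  proof -
    have 1: "(f \<bullet> x - f \<bullet> y) + s1 * (\<psi> \<bullet> x - \<psi> \<bullet> y) \<le> 0" "(f \<bullet> x - f \<bullet> y) + s2 * (\<psi> \<bullet> x - \<psi> \<bullet> y) \<le> 0"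
      using assms(1,2) that by (auto simp: amax_def inner_add_left algebra_simps)
    have "(f \<bullet> x - f \<bullet> y) + s * (\<psi> \<bullet> x - \<psi> \<bullet> y) \<le> 0"
    proof (cases "0 \<le> \<psi> \<bullet> x - \<psi> \<bullet> y")
      case True
      then show ?thesis using 1(2) mult_right_mono[OF assms(4) True] by linarith
    next
      case False
      then have "s * (\<psi> \<bullet> x - \<psi> \<bullet> y) \<le> s1 * (\<psi> \<bullet> x - \<psi> \<bullet> y)"
        using assms(3) by (intro mult_right_mono_neg) auto
      then show ?thesis using 1(1) by linarith
    qed
    then show ?thesis by (simp add: algebra_simps)
  qed
  then show ?thesis using assms(1) by (auto simp: amax_def inner_add_left)
qed

text \<open>Decreasing the parameter adds a small multiple of \<open>- \<psi>\<close>; this leaves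
  \<open>\<alpha>\<close> maximal provided \<open>- \<psi>\<close> is maximal on
  \<open>\<alpha>\<close> within the present maximal face.\<close>

lemma pencil_extend:
  assumes "polytope \<gamma>" "\<alpha> \<subseteq> amax (amax \<gamma> (f + s *\<^sub>R \<psi>)) (- \<psi>)"
  obtains e where "0 < e" "\<And>s'. s - e \<le> s' \<Longrightarrow> s' \<le> s \<Longrightarrow> \<alpha> \<subseteq> amax \<gamma> (f + s' *\<^sub>R \<psi>)"
proof -
  obtain e where e: "0 < e" "\<And>r. 0 \<le> r \<Longrightarrow> r \<le> e \<Longrightarrow> \<alpha> \<subseteq> amax \<gamma> ((f + s *\<^sub>R \<psi>) + r *\<^sub>R (- \<psi>))"
    using amax_perturb[OF assms] by blast
  have "\<alpha> \<subseteq> amax \<gamma> (f + s' *\<^sub>R \<psi>)" if "s - e \<le> s'" "s' \<le> s" for s'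
    using e(2)[of "s - s'"] that by (simp add: algebra_simps)
  with e(1) show ?thesis by (rule that)
qed

text \<open>A point of \<open>\<alpha>\<close> and a point of \<open>A - \<alpha>\<close> have the
  same value at \<open>s\<close>. Since \<open>\<psi>\<close> is larger at the former, decreasing
  the parameter lets the latter win.\<close>

lemma pencil_end:
  assumes A: "polytope A" "A \<subseteq> amax \<gamma> (f + s *\<^sub>R \<psi>)" and fac: "\<alpha> facet_of A"
    and orth: "\<And>z. z \<in> ds \<alpha> \<Longrightarrow> \<psi> \<bullet> z = 0" and pos: "0 < \<psi> \<bullet> outward A \<alpha>" and s': "s' < s"
  shows "\<not> \<alpha> \<subseteq> amax \<gamma> (f + s' *\<^sub>R \<psi>)"
proof
  assume sub: "\<alpha> \<subseteq> amax \<gamma> (f + s' *\<^sub>R \<psi>)"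
  obtain y x where yx: "y \<in> \<alpha>" "x \<in> A - \<alpha>" "outward A \<alpha> = y - x"
    using outward_obtain[OF fac] .
  have mem: "x \<in> amax \<gamma> (f + s *\<^sub>R \<psi>)" "y \<in> amax \<gamma> (f + s' *\<^sub>R \<psi>)" "y \<in> \<gamma>" "x \<in> \<gamma>"
    using A sub yx facet_subset[OF fac] amax_subset by blast+
  then have "f \<bullet> y + s * (\<psi> \<bullet> y) \<le> f \<bullet> x + s * (\<psi> \<bullet> x)" "f \<bullet> x + s' * (\<psi> \<bullet> x) \<le> f \<bullet> y + s' * (\<psi> \<bullet> y)"
    by (auto simp: amax_def inner_add_left)
  then have "(s - s') * (\<psi> \<bullet> y - \<psi> \<bullet> x) \<le> 0" by (simp add: algebra_simps)
  then show False using s' pos yx(3) by (simp add: mult_le_0_iff inner_diff_right)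
qed

text \<open>The parameters satisfying \<open>pencil\<close> form an interval; \<open>simple_pencil\<close> says that at an endpoint
  exactly one of the two maximal faces grows, by one dimension.\<close>

definition pencil ::
    "'a::euclidean_space set \<Rightarrow> 'a set \<Rightarrow> 'a set \<Rightarrow> 'a \<Rightarrow> 'a \<Rightarrow> 'a \<Rightarrow> 'a \<Rightarrow> real \<Rightarrow> bool"
  where "pencil \<gamma> \<alpha> \<beta> f1 \<psi>1 f2 \<psi>2 s \<longleftrightarrow> \<alpha> \<subseteq> amax \<gamma> (f1 + s *\<^sub>R \<psi>1) \<and> \<beta> \<subseteq> amax \<gamma> (f2 + s *\<^sub>R \<psi>2)"

definition simple_pencil ::
    "'a::euclidean_space set \<Rightarrow> 'a set \<Rightarrow> 'a set \<Rightarrow> 'a \<Rightarrow> 'a \<Rightarrow> 'a \<Rightarrow> 'a \<Rightarrow> real set \<Rightarrow> bool"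
  where "simple_pencil \<gamma> \<alpha> \<beta> f1 \<psi>1 f2 \<psi>2 J \<longleftrightarrow>
    polytope \<gamma> \<and> \<alpha> face_of \<gamma> \<and> \<alpha> \<noteq> {} \<and> \<beta> face_of \<gamma> \<and> \<beta> \<noteq> {} \<and>
    (\<forall>z\<in>ds \<alpha>. \<psi>1 \<bullet> z = 0) \<and> (\<forall>z\<in>ds \<beta>. \<psi>2 \<bullet> z = 0) \<and>
    (\<forall>s\<in>J. pencil \<gamma> \<alpha> \<beta> f1 \<psi>1 f2 \<psi>2 s \<longrightarrow>
      (let A = amax \<gamma> (f1 + s *\<^sub>R \<psi>1); B = amax \<gamma> (f2 + s *\<^sub>R \<psi>2) in
        A = \<alpha> \<and> B = \<beta> \<or>
        \<alpha> facet_of A \<and> B = \<beta> \<and> (\<exists>z\<in>ds A. \<psi>1 \<bullet> z \<noteq> 0) \<or>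
        A = \<alpha> \<and> \<beta> facet_of B \<and> (\<exists>z\<in>ds B. \<psi>2 \<bullet> z \<noteq> 0)))"

text \<open>The cells that can take the place of \<open>\<alpha>\<close> at an endpoint; those for
  \<open>\<beta>\<close> arise by exchanging the two families. \<open>J\<close> is the parameter
  range: the whole line for the Leibniz rule, the preimage of the time interval for the
  homotopy.\<close>

definition end_faces ::
    "'a::euclidean_space set \<Rightarrow> 'a set \<Rightarrow> 'a set \<Rightarrow> 'a \<Rightarrow> 'a \<Rightarrow> 'a \<Rightarrow> 'a \<Rightarrow> real set \<Rightarrow> 'a set set"
  where "end_faces \<gamma> \<alpha> \<beta> f1 \<psi>1 f2 \<psi>2 J =
    {A. A face_of \<gamma> \<and> \<alpha> facet_of A \<and> (\<exists>s\<in>J. pencil \<gamma> A \<beta> f1 \<psi>1 f2 \<psi>2 s)}"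

lemma pencil_swap: "pencil \<gamma> \<alpha> \<beta> f1 \<psi>1 f2 \<psi>2 s = pencil \<gamma> \<beta> \<alpha> f2 \<psi>2 f1 \<psi>1 s"
  by (auto simp: pencil_def)

lemma simple_pencil_swap: "simple_pencil \<gamma> \<alpha> \<beta> f1 \<psi>1 f2 \<psi>2 J \<Longrightarrow> simple_pencil \<gamma> \<beta> \<alpha> f2 \<psi>2 f1 \<psi>1 J"
  unfolding simple_pencil_def pencil_swap[of \<gamma> \<beta>] Let_def by blast

lemma pencil_reverse: "pencil \<gamma> \<alpha> \<beta> f1 (- \<psi>1) f2 (- \<psi>2) s = pencil \<gamma> \<alpha> \<beta> f1 \<psi>1 f2 \<psi>2 (- s)"
  by (simp add: pencil_def)

lemma simple_pencil_reverse:
  assumes "simple_pencil \<gamma> \<alpha> \<beta> f1 \<psi>1 f2 \<psi>2 J"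
  shows "simple_pencil \<gamma> \<alpha> \<beta> f1 (- \<psi>1) f2 (- \<psi>2) (uminus ` J)"
  using assms unfolding simple_pencil_def by (auto simp: pencil_reverse Let_def)

lemma end_faces_reverse:
  "end_faces \<gamma> \<alpha> \<beta> f1 (- \<psi>1) f2 (- \<psi>2) (uminus ` J) = end_faces \<gamma> \<alpha> \<beta> f1 \<psi>1 f2 \<psi>2 J"
  by (auto simp: end_faces_def pencil_reverse)

lemma finite_end_faces: "simple_pencil \<gamma> \<alpha> \<beta> f1 \<psi>1 f2 \<psi>2 J \<Longrightarrow> finite (end_faces \<gamma> \<alpha> \<beta> f1 \<psi>1 f2 \<psi>2 J)"
  by (rule finite_subset[OF _ finite_polytope_faces[of \<gamma>]]) (auto simp: end_faces_def simple_pencil_def)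

section \<open>Counting the endpoints of a pencil with signs\<close>

definition lower_end :: "(real \<Rightarrow> bool) \<Rightarrow> real \<Rightarrow> bool"
  where "lower_end P s \<longleftrightarrow> P s \<and> (\<forall>s'<s. \<not> P s')"

text \<open>A positive sign on the outward vector means that \<open>\<alpha>\<close> ceases to be
  maximal below \<open>s\<close>, so \<open>s\<close> is the lower end. By simplicity the maximal
  face exceeds \<open>\<alpha>\<close> by one dimension, which leaves no room between it and
  \<open>A\<close>.\<close>

lemma end_face_lower:
  assumes simp: "simple_pencil \<gamma> \<alpha> \<beta> f1 \<psi>1 f2 \<psi>2 J"
    and A: "A face_of \<gamma>" "\<alpha> facet_of A" "pencil \<gamma> A \<beta> f1 \<psi>1 f2 \<psi>2 s" "s \<in> J" "0 < \<psi>1 \<bullet> outward A \<alpha>"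
  shows "lower_end (pencil \<gamma> \<alpha> \<beta> f1 \<psi>1 f2 \<psi>2) s \<and> A = amax \<gamma> (f1 + s *\<^sub>R \<psi>1) \<and> \<beta> = amax \<gamma> (f2 + s *\<^sub>R \<psi>2)"
proof -
  let ?A = "amax \<gamma> (f1 + s *\<^sub>R \<psi>1)" and ?B = "amax \<gamma> (f2 + s *\<^sub>R \<psi>2)"
  have poly: "polytope \<gamma>" and orth: "\<And>z. z \<in> ds \<alpha> \<Longrightarrow> \<psi>1 \<bullet> z = 0"
    using simp by (auto simp: simple_pencil_def)
  have pA: "polytope A" using poly A(1) face_of_polytope_polytope by blast
  have sub: "A \<subseteq> ?A" "\<beta> \<subseteq> ?B" using A(3) by (auto simp: pencil_def)
  have I: "pencil \<gamma> \<alpha> \<beta> f1 \<psi>1 f2 \<psi>2 s" using sub facet_subset[OF A(2)] by (auto simp: pencil_def)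
  have "\<not> \<alpha> \<subseteq> amax \<gamma> (f1 + s' *\<^sub>R \<psi>1)" if "s' < s" for s'
    by (rule pencil_end[OF pA sub(1) A(2) orth A(5) that])
  then have lower: "lower_end (pencil \<gamma> \<alpha> \<beta> f1 \<psi>1 f2 \<psi>2) s" using I by (auto simp: lower_end_def pencil_def)
  have "\<alpha> \<noteq> A" using A(2) by (auto simp: facet_of_def)
  then have "?A \<noteq> \<alpha>" using sub(1) facet_subset[OF A(2)] by blast
  then have fac: "\<alpha> facet_of ?A" and B: "?B = \<beta>"
    using simp I A(4) unfolding simple_pencil_def Let_def by blast+
  have "A face_of ?A"
    using face_of_subset[OF A(1) sub(1) amax_subset] .
  then have "A = ?A"
    using fac A(2) poly
    by (intro face_eqI) (auto simp: facet_iff_cell_dim intro: face_of_imp_convex[OF amax_face_of] polytope_imp_convex)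
  then show ?thesis using lower B by simp
qed

text \<open>Otherwise \<open>- \<psi>1\<close> and \<open>- \<psi>2\<close> are maximal on
  \<open>\<alpha>\<close> and \<open>\<beta>\<close> within the two maximal faces: trivially on a
  face that has not grown, and by the sign alternative of \<open>facet_cases\<close> on one that
  has. Then the pencil extends further down.\<close>

lemma lower_end_face:
  assumes simp: "simple_pencil \<gamma> \<alpha> \<beta> f1 \<psi>1 f2 \<psi>2 J"
    and s: "s \<in> J" "lower_end (pencil \<gamma> \<alpha> \<beta> f1 \<psi>1 f2 \<psi>2) s"
  shows "\<alpha> facet_of amax \<gamma> (f1 + s *\<^sub>R \<psi>1) \<and> amax \<gamma> (f2 + s *\<^sub>R \<psi>2) = \<beta> \<and> 0 < \<psi>1 \<bullet> outward (amax \<gamma> (f1 + s *\<^sub>R \<psi>1)) \<alpha> \<or>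
    amax \<gamma> (f1 + s *\<^sub>R \<psi>1) = \<alpha> \<and> \<beta> facet_of amax \<gamma> (f2 + s *\<^sub>R \<psi>2) \<and> 0 < \<psi>2 \<bullet> outward (amax \<gamma> (f2 + s *\<^sub>R \<psi>2)) \<beta>"
proof (rule ccontr)
  let ?A = "amax \<gamma> (f1 + s *\<^sub>R \<psi>1)" and ?B = "amax \<gamma> (f2 + s *\<^sub>R \<psi>2)"
  assume contr: "\<not> ?thesis"
  have poly: "polytope \<gamma>" and orth: "\<And>z. z \<in> ds \<alpha> \<Longrightarrow> \<psi>1 \<bullet> z = 0" "\<And>z. z \<in> ds \<beta> \<Longrightarrow> \<psi>2 \<bullet> z = 0"
    using simp by (auto simp: simple_pencil_def)
  have pol: "polytope ?A" "polytope ?B"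
    using poly by (meson amax_face_of face_of_polytope_polytope polytope_imp_convex)+
  have c: "\<alpha> = amax \<alpha> (- \<psi>1)" "\<beta> = amax \<beta> (- \<psi>2)" using orth by (simp_all add: amax_const)
  have I: "pencil \<gamma> \<alpha> \<beta> f1 \<psi>1 f2 \<psi>2 s" using s by (simp add: lower_end_def)
  have "?A = \<alpha> \<and> ?B = \<beta> \<or> \<alpha> facet_of ?A \<and> ?B = \<beta> \<and> (\<exists>z\<in>ds ?A. \<psi>1 \<bullet> z \<noteq> 0) \<or>
      ?A = \<alpha> \<and> \<beta> facet_of ?B \<and> (\<exists>z\<in>ds ?B. \<psi>2 \<bullet> z \<noteq> 0)"
    using simp I s(1) by (simp add: simple_pencil_def Let_def)
  then have "\<alpha> \<subseteq> amax ?A (- \<psi>1) \<and> \<beta> \<subseteq> amax ?B (- \<psi>2)"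
    using facet_cases[OF pol(1) _ orth(1)] facet_cases[OF pol(2) _ orth(2)] contr c by (metis order_refl)
  then obtain e1 e2 where e: "0 < e1" "\<And>s'. s - e1 \<le> s' \<Longrightarrow> s' \<le> s \<Longrightarrow> \<alpha> \<subseteq> amax \<gamma> (f1 + s' *\<^sub>R \<psi>1)"
      "0 < e2" "\<And>s'. s - e2 \<le> s' \<Longrightarrow> s' \<le> s \<Longrightarrow> \<beta> \<subseteq> amax \<gamma> (f2 + s' *\<^sub>R \<psi>2)"
    using pencil_extend[OF poly, of \<alpha> f1 s \<psi>1] pencil_extend[OF poly, of \<beta> f2 s \<psi>2] by metis
  then have "pencil \<gamma> \<alpha> \<beta> f1 \<psi>1 f2 \<psi>2 (s - min e1 e2)" by (auto simp: pencil_def)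
  moreover have "s - min e1 e2 < s" using e by auto
  ultimately show False using s(2) by (auto simp: lower_end_def)
qed

text \<open>The parameter \<open>s\<close> need not lie in \<open>J\<close>: since neither face
  grows at \<open>s\<close>, the pencil is also simple on \<open>{s}\<close>, where a lower end
  would require a growing face. This rules out ends exactly at the generic times 0 and 1.\<close>

lemma pencil_extend_below:
  assumes simp: "simple_pencil \<gamma> \<alpha> \<beta> f1 \<psi>1 f2 \<psi>2 J"
    and s: "amax \<gamma> (f1 + s *\<^sub>R \<psi>1) = \<alpha>" "amax \<gamma> (f2 + s *\<^sub>R \<psi>2) = \<beta>"
  shows "\<not> lower_end (pencil \<gamma> \<alpha> \<beta> f1 \<psi>1 f2 \<psi>2) s"
proof
  assume l: "lower_end (pencil \<gamma> \<alpha> \<beta> f1 \<psi>1 f2 \<psi>2) s"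
  have "simple_pencil \<gamma> \<alpha> \<beta> f1 \<psi>1 f2 \<psi>2 {s}" using simp s by (auto simp: simple_pencil_def Let_def)
  from lower_end_face[OF this _ l] s show False by (auto simp: facet_of_def)
qed

lemma lower_end_unique: "lower_end P s \<Longrightarrow> lower_end P s' \<Longrightarrow> s = s'"
  unfolding lower_end_def by (meson linorder_less_linear)

text \<open>Positive signs belong to the lower end, which is unique, and there exactly one of the
  two faces is replaced.\<close>

lemma end_count:
  assumes simp: "simple_pencil \<gamma> \<alpha> \<beta> f1 \<psi>1 f2 \<psi>2 J"
  shows "card {A \<in> end_faces \<gamma> \<alpha> \<beta> f1 \<psi>1 f2 \<psi>2 J. 0 < \<psi>1 \<bullet> outward A \<alpha>} +
      card {B \<in> end_faces \<gamma> \<beta> \<alpha> f2 \<psi>2 f1 \<psi>1 J. 0 < \<psi>2 \<bullet> outward B \<beta>} =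
      of_bool (\<exists>s\<in>J. lower_end (pencil \<gamma> \<alpha> \<beta> f1 \<psi>1 f2 \<psi>2) s)"
    (is "card ?Ap + card ?Bp = of_bool ?lo")
proof (cases ?lo)
  case True
  then obtain s0 where s0: "s0 \<in> J" "lower_end (pencil \<gamma> \<alpha> \<beta> f1 \<psi>1 f2 \<psi>2) s0" by blast
  let ?A = "amax \<gamma> (f1 + s0 *\<^sub>R \<psi>1)" and ?B = "amax \<gamma> (f2 + s0 *\<^sub>R \<psi>2)"
  have swap: "pencil \<gamma> \<beta> \<alpha> f2 \<psi>2 f1 \<psi>1 = pencil \<gamma> \<alpha> \<beta> f1 \<psi>1 f2 \<psi>2"
    by (intro ext) (rule pencil_swap)
  have Ap: "A = ?A \<and> ?B = \<beta> \<and> \<alpha> facet_of ?A" if "A \<in> ?Ap" for A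
  proof -
    from that obtain s where "A face_of \<gamma>" "\<alpha> facet_of A" "pencil \<gamma> A \<beta> f1 \<psi>1 f2 \<psi>2 s" "s \<in> J" "0 < \<psi>1 \<bullet> outward A \<alpha>"
      by (auto simp: end_faces_def)
    with end_face_lower[OF simp this] lower_end_unique[OF s0(2)] show ?thesis by blast
  qed
  have Bp: "B = ?B \<and> ?A = \<alpha> \<and> \<beta> facet_of ?B" if "B \<in> ?Bp" for B
  proof -
    from that obtain s where "B face_of \<gamma>" "\<beta> facet_of B" "pencil \<gamma> B \<alpha> f2 \<psi>2 f1 \<psi>1 s" "s \<in> J" "0 < \<psi>2 \<bullet> outward B \<beta>"
      by (auto simp: end_faces_def)
    with end_face_lower[OF simple_pencil_swap[OF simp] this] lower_end_unique[OF s0(2)] swap show ?thesis by metis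
  qed
  have sub: "\<alpha> \<subseteq> ?A" "\<beta> \<subseteq> ?B" using s0(2) by (auto simp: lower_end_def pencil_def)
  have conv: "convex \<gamma>" using simp by (simp add: simple_pencil_def polytope_imp_convex)
  have irr: "\<not> \<alpha> facet_of \<alpha>" "\<not> \<beta> facet_of \<beta>" by (auto simp: facet_of_def)
  from lower_end_face[OF simp s0] show ?thesis
  proof
    assume *: "\<alpha> facet_of ?A \<and> ?B = \<beta> \<and> 0 < \<psi>1 \<bullet> outward ?A \<alpha>"
    then have "?A \<in> ?Ap" using sub s0(1) conv by (auto simp: end_faces_def pencil_def amax_face_of intro!: bexI[of _ s0])
    then have "?Ap = {?A}" using Ap by blast
    moreover have "False" if "B \<in> ?Bp" for B using Bp[OF that] conjunct1[OF *] irr(1) by metis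
    then have "?Bp = {}" by blast
    ultimately show ?thesis using True by (simp only: card.empty) simp
  next
    assume *: "?A = \<alpha> \<and> \<beta> facet_of ?B \<and> 0 < \<psi>2 \<bullet> outward ?B \<beta>"
    then have "?B \<in> ?Bp" using sub s0(1) conv by (auto simp: end_faces_def pencil_def amax_face_of intro!: bexI[of _ s0])
    then have "?Bp = {?B}" using Bp by blast
    moreover have "False" if "A \<in> ?Ap" for A using Ap[OF that] conjunct1[OF conjunct2[OF *]] irr(2) by metis
    then have "?Ap = {}" by blast
    ultimately show ?thesis using True by (simp only: card.empty) simp
  qed
next
  case False
  have "?Ap = {}" using False end_face_lower[OF simp] by (auto simp: end_faces_def)
  moreover have "?Bp = {}"
    using False end_face_lower[OF simple_pencil_swap[OF simp]] pencil_swap[of \<gamma> \<alpha> \<beta> f1 \<psi>1 f2 \<psi>2]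
    by (auto simp: end_faces_def lower_end_def)
  ultimately show ?thesis using False by (simp only: card.empty) simp
qed

lemma sum_isgn:
  assumes "finite S"
  shows "(\<Sum>x\<in>S. isgn (g x)) = int (card {x \<in> S. 0 < g x}) - int (card {x \<in> S. g x < 0})"
proof -
  have "(\<Sum>x\<in>S. isgn (g x)) = (\<Sum>x\<in>S. of_bool (0 < g x) - of_bool (g x < 0))"
    by (intro sum.cong) (auto simp: isgn_def)
  then show ?thesis using assms by (simp add: sum_subtractf sum_of_bool_eq Int_def conj_commute)
qed

text \<open>Negative signs become positive when the pencil is run backwards, so they count the upper
  end. A lower end of the reflected predicate at \<open>- s\<close> is an upper end at
  \<open>s\<close>.\<close>

lemma end_sum:
  assumes simp: "simple_pencil \<gamma> \<alpha> \<beta> f1 \<psi>1 f2 \<psi>2 J"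
  shows "(\<Sum>A\<in>end_faces \<gamma> \<alpha> \<beta> f1 \<psi>1 f2 \<psi>2 J. isgn (\<psi>1 \<bullet> outward A \<alpha>)) +
      (\<Sum>B\<in>end_faces \<gamma> \<beta> \<alpha> f2 \<psi>2 f1 \<psi>1 J. isgn (\<psi>2 \<bullet> outward B \<beta>)) =
      of_bool (\<exists>s\<in>J. lower_end (pencil \<gamma> \<alpha> \<beta> f1 \<psi>1 f2 \<psi>2) s) -
      of_bool (\<exists>s\<in>J. lower_end (\<lambda>r. pencil \<gamma> \<alpha> \<beta> f1 \<psi>1 f2 \<psi>2 (- r)) (- s))"
proof -
  have rev: "pencil \<gamma> \<alpha> \<beta> f1 (- \<psi>1) f2 (- \<psi>2) = (\<lambda>r. pencil \<gamma> \<alpha> \<beta> f1 \<psi>1 f2 \<psi>2 (- r))"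
    by (intro ext) (rule pencil_reverse)
  have "int (card {A \<in> end_faces \<gamma> \<alpha> \<beta> f1 \<psi>1 f2 \<psi>2 J. 0 < \<psi>1 \<bullet> outward A \<alpha>}) +
      int (card {B \<in> end_faces \<gamma> \<beta> \<alpha> f2 \<psi>2 f1 \<psi>1 J. 0 < \<psi>2 \<bullet> outward B \<beta>}) =
      of_bool (\<exists>s\<in>J. lower_end (pencil \<gamma> \<alpha> \<beta> f1 \<psi>1 f2 \<psi>2) s)"
    using arg_cong[OF end_count[OF simp], of int] by (simp only: of_nat_add of_nat_of_bool)
  moreover have "int (card {A \<in> end_faces \<gamma> \<alpha> \<beta> f1 \<psi>1 f2 \<psi>2 J. \<psi>1 \<bullet> outward A \<alpha> < 0}) +
      int (card {B \<in> end_faces \<gamma> \<beta> \<alpha> f2 \<psi>2 f1 \<psi>1 J. \<psi>2 \<bullet> outward B \<beta> < 0}) =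
      of_bool (\<exists>s\<in>J. lower_end (\<lambda>r. pencil \<gamma> \<alpha> \<beta> f1 \<psi>1 f2 \<psi>2 (- r)) (- s))"
    using arg_cong[OF end_count[OF simple_pencil_reverse[OF simp]], of int]
    by (simp only: of_nat_add of_nat_of_bool end_faces_reverse rev inner_minus_left neg_0_less_iff_less bex_simps)
  ultimately show ?thesis
    unfolding sum_isgn[OF finite_end_faces[OF simp]] sum_isgn[OF finite_end_faces[OF simple_pencil_swap[OF simp]]]
    by linarith
qed

lemma interval_lower_end:
  assumes cl: "closed {s. P s}" and int: "\<And>s1 s2 s. P s1 \<Longrightarrow> P s2 \<Longrightarrow> s1 \<le> s \<Longrightarrow> s \<le> s2 \<Longrightarrow> P s"
    and ne: "P s0"
  shows "(\<exists>s. lower_end P s) \<longleftrightarrow> \<not> (\<exists>s1. \<forall>s\<le>s1. P s)"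
proof
  assume "\<exists>s. lower_end P s"
  then obtain s where s: "\<And>s'. s' < s \<Longrightarrow> \<not> P s'" by (auto simp: lower_end_def)
  have "\<not> P (min s1 (s - 1))" for s1 by (rule s) auto
  then show "\<not> (\<exists>s1. \<forall>s\<le>s1. P s)" by (meson min.cobounded1)
next
  assume nu: "\<not> (\<exists>s1. \<forall>s\<le>s1. P s)"
  then obtain m where m: "m \<le> s0" "\<not> P m" by blast
  have lb: "m \<le> s" if "P s" for s using int[OF that ne] m by (meson linear)
  then have bdd: "bdd_below {s. P s}" by (auto simp: bdd_below_def)
  then have "Inf {s. P s} \<in> {s. P s}" using ne by (intro closed_contains_Inf cl) auto
  moreover have "\<not> P s'" if "s' < Inf {s. P s}" for s'
    using cInf_lower[OF _ bdd, of s'] that by force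
  ultimately show "\<exists>s. lower_end P s" by (auto simp: lower_end_def)
qed

text \<open>For the homotopy, \<open>sa\<close> and \<open>sb\<close> are the parameters of the two
  extreme times. Since the interval does not begin exactly at \<open>sa\<close>, it either begins
  strictly inside the window or already contains \<open>sa\<close>.\<close>

lemma interval_lower_end_within:
  assumes cl: "closed {s. P s}" and int: "\<And>s1 s2 s. P s1 \<Longrightarrow> P s2 \<Longrightarrow> s1 \<le> s \<Longrightarrow> s \<le> s2 \<Longrightarrow> P s"
    and ne: "P s0" "sa \<le> s0" "s0 \<le> sb" and end_sa: "\<not> lower_end P sa"
  shows "(\<exists>s\<in>{sa..sb}. lower_end P s) \<longleftrightarrow> \<not> P sa"
proof
  assume "\<exists>s\<in>{sa..sb}. lower_end P s"
  then show "\<not> P sa" using end_sa by (metis atLeastAtMost_iff lower_end_def order_le_less)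
next
  assume sa: "\<not> P sa"
  then have "\<not> (\<exists>s1. \<forall>s\<le>s1. P s)" using int[OF _ ne(1) _ ne(2)] by (meson linear order_refl)
  moreover have "(\<exists>s. lower_end P s) \<longleftrightarrow> \<not> (\<exists>s1. \<forall>s\<le>s1. P s)"
    by (rule interval_lower_end[OF cl _ ne(1)]) (rule int)
  ultimately obtain s where s: "lower_end P s" by blast
  have "s \<le> s0" using s ne(1) by (auto simp: lower_end_def not_less)
  moreover have "sa \<le> s" using s sa int[of s s0 sa] ne by (force simp: lower_end_def)
  ultimately show "\<exists>s\<in>{sa..sb}. lower_end P s" using s ne by auto
qed

lemma pencil_set_closed:
  assumes "\<alpha> \<subseteq> \<gamma>" "\<beta> \<subseteq> \<gamma>"
  shows "closed {s. pencil \<gamma> \<alpha> \<beta> f1 \<psi>1 f2 \<psi>2 s}" "closed {s. pencil \<gamma> \<alpha> \<beta> f1 \<psi>1 f2 \<psi>2 (- s)}"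
  using pencil_closed[OF assms(1), of f1 \<psi>1] pencil_closed[OF assms(2), of f2 \<psi>2]
    pencil_closed[OF assms(1), of f1 "- \<psi>1"] pencil_closed[OF assms(2), of f2 "- \<psi>2"]
  unfolding pencil_def by (auto simp: Collect_conj_eq)

lemma pencil_set_interval:
  assumes "pencil \<gamma> \<alpha> \<beta> f1 \<psi>1 f2 \<psi>2 s1" "pencil \<gamma> \<alpha> \<beta> f1 \<psi>1 f2 \<psi>2 s2" "s1 \<le> s" "s \<le> s2"
  shows "pencil \<gamma> \<alpha> \<beta> f1 \<psi>1 f2 \<psi>2 s"
  using assms pencil_interval unfolding pencil_def by metis

section \<open>Pairs of faces selected by a displacement\<close>

definition dpair :: "'a::euclidean_space set \<Rightarrow> 'a \<Rightarrow> 'a set \<Rightarrow> 'a set \<Rightarrow> bool"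
  where "dpair \<gamma> a A B \<longleftrightarrow> (\<exists>w. A \<subseteq> amax \<gamma> (w - a) \<and> B \<subseteq> amax \<gamma> w)"

lemma dpair_mono: "dpair \<gamma> a A B \<Longrightarrow> A' \<subseteq> A \<Longrightarrow> B' \<subseteq> B \<Longrightarrow> dpair \<gamma> a A' B'"
  unfolding dpair_def by blast

text \<open>Let \<open>g\<close> be maximal exactly on \<open>\<mu>\<close>. Adding the same large
  multiple of \<open>g\<close> to both functionals moves their maxima over \<open>\<gamma>\<close>
  into \<open>\<mu>\<close> and leaves their difference \<open>a\<close> unchanged.\<close>

lemma dpair_facet:
  assumes \<gamma>: "polytope \<gamma>" and \<mu>: "\<mu> facet_of \<gamma>" and d: "dpair \<mu> a \<alpha> \<beta>"
  shows "dpair \<gamma> a \<alpha> \<beta>"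
proof -
  obtain g where g: "amax \<gamma> g = \<mu>"
    using polytope_face_amax[OF \<gamma>, of \<mu>] \<mu> by (auto simp: facet_of_def)
  obtain w where w: "\<alpha> \<subseteq> amax \<mu> (w - a)" "\<beta> \<subseteq> amax \<mu> w" using d by (auto simp: dpair_def)
  obtain s1 where s1: "\<And>s. s1 \<le> s \<Longrightarrow> \<alpha> \<subseteq> amax \<gamma> ((w - a) + s *\<^sub>R g)"
    using amax_add_large[OF \<gamma>, of \<alpha> g] w g by metis
  obtain s2 where s2: "\<And>s. s2 \<le> s \<Longrightarrow> \<beta> \<subseteq> amax \<gamma> (w + s *\<^sub>R g)"
    using amax_add_large[OF \<gamma>, of \<beta> g] w g by metis
  show ?thesis
    using s1[of "max s1 s2"] s2[of "max s1 s2"] unfolding dpair_def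
    by (intro exI[of _ "w + max s1 s2 *\<^sub>R g"]) (auto simp: algebra_simps)
qed

section \<open>The ends of a pencil at infinity\<close>

lemma dim_hyperplane_Int:
  fixes E :: "'a::euclidean_space set"
  assumes E: "subspace E" and n: "n \<in> E" "\<psi> \<bullet> n \<noteq> 0"
  shows "dim {x \<in> E. \<psi> \<bullet> x = 0} + 1 = dim E"
proof -
  let ?K = "{x \<in> E. \<psi> \<bullet> x = 0}"
  have K: "subspace ?K" using E by (auto simp: subspace_def inner_add_right)
  have "z \<in> span (insert n ?K)" if z: "z \<in> E" for z
  proof -
    have "z - (\<psi> \<bullet> z / (\<psi> \<bullet> n)) *\<^sub>R n \<in> ?K"
      using z n E by (auto simp: inner_diff_right intro!: subspace_diff subspace_scale)
    then show ?thesis unfolding span_breakdown_eq by (intro exI span_base)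
  qed
  moreover have "span (insert n ?K) \<subseteq> E" using n E by (intro span_minimal) auto
  ultimately have "E = span (insert n ?K)" by blast
  then have "dim E = dim (insert n ?K)" by (metis dim_span)
  moreover have "n \<notin> span ?K" using K n by (simp add: span_eq_iff[THEN iffD2])
  ultimately show ?thesis by (simp add: dim_insert)
qed

text \<open>The direction spaces of \<open>\<alpha>\<close> and \<open>\<beta>\<close> together fill
  the kernel of \<open>\<psi>\<close>, so a facet through both has that kernel as direction space
  and is the maximal face of \<open>\<psi>\<close> or of \<open>- \<psi>\<close>. As the parameter
  tends to minus infinity, \<open>- \<psi>\<close> dominates: the facet with negative sign exists
  exactly if the pencil is unbounded below.\<close>

lemma infinity_count:
  assumes \<gamma>: "polytope \<gamma>"
    and ker: "\<And>x. x \<in> ds \<gamma> \<Longrightarrow> \<psi> \<bullet> x = 0 \<Longrightarrow> x \<in> msum (ds \<alpha>) (ds \<beta>)"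
    and orth: "\<And>z. z \<in> ds \<alpha> \<union> ds \<beta> \<Longrightarrow> \<psi> \<bullet> z = 0"
    and n: "n \<in> ds \<gamma>" "\<psi> \<bullet> n \<noteq> 0" and nonempty: "\<alpha> \<noteq> {}" "\<beta> \<noteq> {}"
    and w: "\<alpha> \<subseteq> amax \<gamma> (w - a)" "\<beta> \<subseteq> amax \<gamma> w"
  shows "card {\<mu>. \<mu> facet_of \<gamma> \<and> \<alpha> \<subseteq> \<mu> \<and> \<beta> \<subseteq> \<mu> \<and> dpair \<mu> a \<alpha> \<beta> \<and> \<psi> \<bullet> outward \<gamma> \<mu> < 0} =
    of_bool (\<exists>s1. \<forall>s\<le>s1. pencil \<gamma> \<alpha> \<beta> (w - a) \<psi> w \<psi> s)"
    and "\<And>\<mu>. \<mu> facet_of \<gamma> \<Longrightarrow> \<alpha> \<subseteq> \<mu> \<Longrightarrow> \<beta> \<subseteq> \<mu> \<Longrightarrow> \<psi> \<bullet> outward \<gamma> \<mu> \<noteq> 0"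
proof -
  let ?K = "{x \<in> ds \<gamma>. \<psi> \<bullet> x = 0}"
  have sub: "\<alpha> \<subseteq> \<gamma>" "\<beta> \<subseteq> \<gamma>" using w amax_subset by blast+
  have K: "subspace ?K" using subspace_ds[of \<gamma>] by (auto simp: subspace_def inner_add_right)
  have dimK: "dim ?K + 1 = dim (ds \<gamma>)" by (rule dim_hyperplane_Int[OF subspace_ds n])
  have K_sub: "?K \<subseteq> ds \<mu>" if "\<alpha> \<subseteq> \<mu>" "\<beta> \<subseteq> \<mu>" for \<mu>
    using ker ds_mono[OF that(1)] ds_mono[OF that(2)] subspace_add[OF subspace_ds[of \<mu>]] by (fastforce simp: msum_def)
  have ds_facet: "ds \<mu> = ?K" if "\<mu> facet_of \<gamma>" "\<alpha> \<subseteq> \<mu>" "\<beta> \<subseteq> \<mu>" for \<mu>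
    using that(1) dimK subspace_dim_equal[OF K subspace_ds K_sub[OF that(2,3)]]
    by (simp add: facet_iff_cell_dim cell_dim_def)
  have cases: "0 < \<psi> \<bullet> outward \<gamma> \<mu> \<and> \<mu> = amax \<gamma> \<psi> \<or> \<psi> \<bullet> outward \<gamma> \<mu> < 0 \<and> \<mu> = amax \<gamma> (- \<psi>)"
    if "\<mu> facet_of \<gamma>" "\<alpha> \<subseteq> \<mu>" "\<beta> \<subseteq> \<mu>" for \<mu>
    using ds_facet[OF that] n by (intro facet_cases[OF \<gamma> that(1)]) auto
  then show "\<And>\<mu>. \<mu> facet_of \<gamma> \<Longrightarrow> \<alpha> \<subseteq> \<mu> \<Longrightarrow> \<beta> \<subseteq> \<mu> \<Longrightarrow> \<psi> \<bullet> outward \<gamma> \<mu> \<noteq> 0" by force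
  let ?M = "{\<mu>. \<mu> facet_of \<gamma> \<and> \<alpha> \<subseteq> \<mu> \<and> \<beta> \<subseteq> \<mu> \<and> dpair \<mu> a \<alpha> \<beta> \<and> \<psi> \<bullet> outward \<gamma> \<mu> < 0}"
  show "card ?M = of_bool (\<exists>s1. \<forall>s\<le>s1. pencil \<gamma> \<alpha> \<beta> (w - a) \<psi> w \<psi> s)"
  proof (cases "\<exists>s1. \<forall>s\<le>s1. pencil \<gamma> \<alpha> \<beta> (w - a) \<psi> w \<psi> s")
    case True
    then obtain s1 where s1: "\<And>s. s \<le> s1 \<Longrightarrow> pencil \<gamma> \<alpha> \<beta> (w - a) \<psi> w \<psi> s" by blast
    have dominated: "C \<subseteq> amax \<gamma> (- \<psi>)"
      if C: "C \<subseteq> \<gamma>" "\<And>s. s \<le> s1 \<Longrightarrow> C \<subseteq> amax \<gamma> (f + s *\<^sub>R \<psi>)" for C f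
    proof -
      have "\<psi> \<bullet> y \<le> \<psi> \<bullet> x" if yx: "y \<in> C" "x \<in> \<gamma>" for x y
      proof (rule ccontr)
        assume "\<not> \<psi> \<bullet> y \<le> \<psi> \<bullet> x"
        then have pos: "0 < \<psi> \<bullet> y - \<psi> \<bullet> x" by simp
        \<comment> \<open>Comparing \<open>y\<close> with \<open>x\<close> bounds the admissible
          parameters below by this quotient; \<open>s\<close> stays below \<open>s1\<close> and at
          least 1 below the quotient.\<close>
        define s where "s = min s1 ((f \<bullet> x - f \<bullet> y) / (\<psi> \<bullet> y - \<psi> \<bullet> x) - 1)"
        have "f \<bullet> x + s * (\<psi> \<bullet> x) \<le> f \<bullet> y + s * (\<psi> \<bullet> y)"
          using C(2)[of s] yx by (auto simp: s_def amax_def inner_add_left)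
        then have "(f \<bullet> x - f \<bullet> y) / (\<psi> \<bullet> y - \<psi> \<bullet> x) \<le> s"
          using pos by (simp add: pos_divide_le_eq algebra_simps)
        then show False by (auto simp: s_def min_def split: if_splits)
      qed
      then show ?thesis using C(1) by (auto simp: amax_def)
    qed
    let ?\<mu> = "amax \<gamma> (- \<psi>)"
    have sub\<mu>: "\<alpha> \<subseteq> ?\<mu>" "\<beta> \<subseteq> ?\<mu>"
      using dominated[OF sub(1), of "w - a"] dominated[OF sub(2), of w] s1 by (auto simp: pencil_def)
    have "ds ?\<mu> = ?K"
      using amax_orthogonal[of ?\<mu> \<gamma> "- \<psi>"] ds_mono[OF amax_subset, of \<gamma> "- \<psi>"] K_sub[OF sub\<mu>] by auto
    then have fac: "?\<mu> facet_of \<gamma>"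
      using dimK sub\<mu> nonempty \<gamma>
      by (auto simp: facet_iff_cell_dim cell_dim_def amax_face_of polytope_imp_convex)
    moreover have "dpair ?\<mu> a \<alpha> \<beta>"
      using w sub\<mu> amax_mono_set[OF amax_subset] unfolding dpair_def by blast
    moreover have "\<psi> \<bullet> outward \<gamma> ?\<mu> < 0" using outward_amax[OF fac refl] by simp
    ultimately have "?\<mu> \<in> ?M" using sub\<mu> by blast
    moreover have "\<mu> = ?\<mu>" if "\<mu> \<in> ?M" for \<mu> using that cases[of \<mu>] by auto
    ultimately have "?M = {?\<mu>}" by blast
    then show ?thesis using True by (simp only: card_1_singleton_iff of_bool_def if_True) simp
  next
    case False
    have "\<mu> \<notin> ?M" for \<mu>
    proof
      assume \<mu>: "\<mu> \<in> ?M"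
      then have ms: "\<mu> facet_of \<gamma>" "\<alpha> \<subseteq> \<mu>" "\<beta> \<subseteq> \<mu>" "\<psi> \<bullet> outward \<gamma> \<mu> < 0" by auto
      then have "\<mu> = amax \<gamma> (- \<psi>)" using cases[of \<mu>] by linarith
      with ms have "\<alpha> \<subseteq> amax \<gamma> (- \<psi>)" "\<beta> \<subseteq> amax \<gamma> (- \<psi>)" by blast+
      \<comment> \<open>Such an \<open>s\<close> adds a non-negative multiple of
        \<open>- \<psi>\<close>, and sums of functionals maximal on \<open>C\<close> are maximal on
        \<open>C\<close>.\<close>
      then have "C \<subseteq> amax \<gamma> (f + s *\<^sub>R \<psi>)" if "s \<le> 0" "C \<subseteq> amax \<gamma> f" "C \<subseteq> amax \<gamma> (- \<psi>)" for C f s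
      proof -
        have "f \<bullet> x + s * (\<psi> \<bullet> x) \<le> f \<bullet> y + s * (\<psi> \<bullet> y)" if yx: "y \<in> C" "x \<in> \<gamma>" for x y
        proof -
          have "f \<bullet> x \<le> f \<bullet> y" "\<psi> \<bullet> y \<le> \<psi> \<bullet> x"
            using \<open>C \<subseteq> amax \<gamma> f\<close> \<open>C \<subseteq> amax \<gamma> (- \<psi>)\<close> yx by (auto simp: amax_def)
          moreover have "s * (\<psi> \<bullet> x) \<le> s * (\<psi> \<bullet> y)" using calculation(2) \<open>s \<le> 0\<close> by (rule mult_left_mono_neg)
          ultimately show ?thesis by linarith
        qed
        then show ?thesis using \<open>C \<subseteq> amax \<gamma> f\<close> by (auto simp: amax_def inner_add_left)
      qed
      then have "pencil \<gamma> \<alpha> \<beta> (w - a) \<psi> w \<psi> s" if "s \<le> 0" for s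
        using w \<open>\<alpha> \<subseteq> amax \<gamma> (- \<psi>)\<close> \<open>\<beta> \<subseteq> amax \<gamma> (- \<psi>)\<close> that by (simp add: pencil_def)
      then show False using False by blast
    qed
    then have "?M = {}" by blast
    then show ?thesis using False by (simp only: card.empty) simp
  qed
qed

text \<open>A facet through \<open>\<alpha>\<close> and \<open>\<beta>\<close> stands for a missing
  end: negative sign for no lower end, positive sign for no upper end. Hence the total is the same
  difference of indicators as in \<open>end_sum\<close>, and this is the cancellation behind the
  Leibniz rule.\<close>

lemma infinity_sum:
  assumes \<gamma>: "polytope \<gamma>"
    and ker: "\<And>x. x \<in> ds \<gamma> \<Longrightarrow> \<psi> \<bullet> x = 0 \<Longrightarrow> x \<in> msum (ds \<alpha>) (ds \<beta>)"
    and orth: "\<And>z. z \<in> ds \<alpha> \<union> ds \<beta> \<Longrightarrow> \<psi> \<bullet> z = 0"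
    and n: "n \<in> ds \<gamma>" "\<psi> \<bullet> n \<noteq> 0" and nonempty: "\<alpha> \<noteq> {}" "\<beta> \<noteq> {}"
    and w: "\<alpha> \<subseteq> amax \<gamma> (w - a)" "\<beta> \<subseteq> amax \<gamma> w"
  shows "(\<Sum>\<mu> | \<mu> facet_of \<gamma> \<and> \<alpha> \<subseteq> \<mu> \<and> \<beta> \<subseteq> \<mu> \<and> dpair \<mu> a \<alpha> \<beta>. isgn (\<psi> \<bullet> outward \<gamma> \<mu>)) =
    of_bool (\<exists>s. lower_end (pencil \<gamma> \<alpha> \<beta> (w - a) \<psi> w \<psi>) s) -
    of_bool (\<exists>s. lower_end (\<lambda>r. pencil \<gamma> \<alpha> \<beta> (w - a) \<psi> w \<psi> (- r)) (- s))"
proof -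
  let ?P = "pencil \<gamma> \<alpha> \<beta> (w - a) \<psi> w \<psi>" and ?S = "{\<mu>. \<mu> facet_of \<gamma> \<and> \<alpha> \<subseteq> \<mu> \<and> \<beta> \<subseteq> \<mu> \<and> dpair \<mu> a \<alpha> \<beta>}"
  have sub: "\<alpha> \<subseteq> \<gamma>" "\<beta> \<subseteq> \<gamma>" using w amax_subset by blast+
  have P0: "?P 0" using w by (simp add: pencil_def)
  have fin: "finite ?S" by (rule finite_subset[OF _ finite_polytope_faces[OF \<gamma>]]) (auto simp: facet_of_def)
  have neg: "card {\<mu>\<in>?S. \<psi> \<bullet> outward \<gamma> \<mu> < 0} = of_bool (\<exists>s1. \<forall>s\<le>s1. ?P s)"
    using infinity_count(1)[OF \<gamma> ker orth n nonempty w] by (simp add: conj_assoc)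
  have "(\<lambda>s. pencil \<gamma> \<alpha> \<beta> (w - a) (- \<psi>) w (- \<psi>) s) = (\<lambda>s. ?P (- s))" by (simp add: pencil_reverse)
  moreover have "card {\<mu>\<in>?S. - \<psi> \<bullet> outward \<gamma> \<mu> < 0} =
      of_bool (\<exists>s1. \<forall>s\<le>s1. pencil \<gamma> \<alpha> \<beta> (w - a) (- \<psi>) w (- \<psi>) s)"
    using infinity_count(1)[OF \<gamma> _ _ n(1) _ nonempty w, of "- \<psi>"] ker orth n by (simp add: conj_assoc)
  ultimately have pos: "card {\<mu>\<in>?S. 0 < \<psi> \<bullet> outward \<gamma> \<mu>} = of_bool (\<exists>s1. \<forall>s\<le>s1. ?P (- s))"
    by simp
  have lo: "(\<exists>s. lower_end ?P s) \<longleftrightarrow> \<not> (\<exists>s1. \<forall>s\<le>s1. ?P s)"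
    by (rule interval_lower_end[OF pencil_set_closed(1)[OF sub] pencil_set_interval P0])
  have hi: "(\<exists>s. lower_end (\<lambda>r. ?P (- r)) s) \<longleftrightarrow> \<not> (\<exists>s1. \<forall>s\<le>s1. ?P (- s))"
  proof (rule interval_lower_end[OF pencil_set_closed(2)[OF sub], of _ _ _ _ 0])
    show "?P (- s)" if "?P (- s1)" "?P (- s2)" "s1 \<le> s" "s \<le> s2" for s1 s2 s
      using pencil_set_interval[OF that(2,1), of "- s"] that by simp
  qed (use P0 in simp)
  have hi': "(\<exists>s. lower_end (\<lambda>r. ?P (- r)) (- s)) \<longleftrightarrow> (\<exists>s. lower_end (\<lambda>r. ?P (- r)) s)"
    by (metis minus_minus)
  show ?thesis unfolding sum_isgn[OF fin] neg pos lo hi' hi of_nat_of_bool of_bool_not_iff by simp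
qed

section \<open>From transversality to simple pencils\<close>

lemma dim_image_inj:
  fixes T :: "'a::euclidean_space \<Rightarrow> 'e::euclidean_space"
  assumes "linear T" "inj T"
  shows "dim (T ` S) = dim S"
  using dim_image_eq[OF assms(1)] assms(2) by (metis inj_on_subset subset_UNIV)

lemma subspace_msum: "subspace U \<Longrightarrow> subspace W \<Longrightarrow> subspace (msum U W)"
  unfolding msum_def by (rule subspace_sums)

lemma dim_msum:
  fixes U W :: "'a::euclidean_space set"
  assumes "subspace U" "subspace W" "U \<inter> W = {0}"
  shows "dim (msum U W) = dim U + dim W"
  using dim_sums_Int[OF assms(1,2)] assms(3) by (simp add: msum_def)

lemma msum_subset: "subspace E \<Longrightarrow> U \<subseteq> E \<Longrightarrow> W \<subseteq> E \<Longrightarrow> msum U W \<subseteq> E"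
  by (auto simp: msum_def intro: subspace_add)

text \<open>Transversality turns the growth of a pair of maximal faces at an endpoint of a pencil into the
  growth of exactly one face by one dimension. The embeddings are identities for the Leibniz rule
  and shears into \<open>V \<times> \<real>\<close> for the homotopy.\<close>

lemma simple_pencilI:
  fixes T1 T2 :: "'a::euclidean_space \<Rightarrow> 'e::euclidean_space"
  assumes \<gamma>: "polytope \<gamma>" and \<alpha>: "\<alpha> face_of \<gamma>" "\<alpha> \<noteq> {}" and \<beta>: "\<beta> face_of \<gamma>" "\<beta> \<noteq> {}"
    and T: "linear T1" "inj T1" "linear T2" "inj T2"
    and E: "subspace E" "T1 ` ds \<gamma> \<subseteq> E" "T2 ` ds \<gamma> \<subseteq> E" "dim E = cell_dim \<alpha> + cell_dim \<beta> + 1"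
    and \<psi>: "\<psi> \<in> E" "\<psi> \<noteq> 0" "\<And>z. z \<in> ds \<alpha> \<Longrightarrow> \<psi> \<bullet> T1 z = 0" "\<And>z. z \<in> ds \<beta> \<Longrightarrow> \<psi> \<bullet> T2 z = 0"
    and adj: "\<And>x. \<psi>1 \<bullet> x = \<psi> \<bullet> T1 x" "\<And>x. \<psi>2 \<bullet> x = \<psi> \<bullet> T2 x"
    and trans: "\<And>s A B. s \<in> J \<Longrightarrow> A face_of \<gamma> \<Longrightarrow> B face_of \<gamma> \<Longrightarrow> \<alpha> \<subseteq> A \<Longrightarrow> \<beta> \<subseteq> B \<Longrightarrow>
      dim E \<le> cell_dim A + cell_dim B \<Longrightarrow> pencil \<gamma> A B f1 \<psi>1 f2 \<psi>2 s \<Longrightarrow> T1 ` ds A \<inter> T2 ` ds B = {0}"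
  shows "simple_pencil \<gamma> \<alpha> \<beta> f1 \<psi>1 f2 \<psi>2 J"
proof -
  have conv: "convex \<gamma>" using \<gamma> by (rule polytope_imp_convex)
  \<comment> \<open>By dimension the two images span \<open>E\<close>; a vector of \<open>E\<close>
    orthogonal to both would be orthogonal to itself. This shows that the growing face is one on
    which the functional is not constant.\<close>
  have orth_all: "x = 0" if A: "A \<subseteq> \<gamma>" "B \<subseteq> \<gamma>" "T1 ` ds A \<inter> T2 ` ds B = {0}" "dim E \<le> cell_dim A + cell_dim B"
    and o: "\<And>z. z \<in> ds A \<Longrightarrow> \<psi> \<bullet> T1 z = 0" "\<And>z. z \<in> ds B \<Longrightarrow> \<psi> \<bullet> T2 z = 0" and "x = \<psi>" for A B x
  proof -
    have sub: "T1 ` ds A \<subseteq> E" "T2 ` ds B \<subseteq> E" using ds_mono A(1,2) E(2,3) by blast+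
    have ss: "subspace (T1 ` ds A)" "subspace (T2 ` ds B)" using T subspace_ds by (auto intro: linear_subspace_image)
    have "dim (msum (T1 ` ds A) (T2 ` ds B)) = cell_dim A + cell_dim B"
      using dim_msum[OF ss A(3)] T by (simp add: dim_image_inj cell_dim_def)
    then have "msum (T1 ` ds A) (T2 ` ds B) = E"
      using A(4) by (intro subspace_dim_equal subspace_msum ss E(1) msum_subset sub) simp
    then have "\<psi> \<in> msum (T1 ` ds A) (T2 ` ds B)" using \<psi>(1) by simp
    then obtain y z where yz: "y \<in> ds A" "z \<in> ds B" "\<psi> = T1 y + T2 z" by (auto simp: msum_def)
    have "\<psi> \<bullet> \<psi> = \<psi> \<bullet> T1 y + \<psi> \<bullet> T2 z" using yz(3) by (metis inner_add_right)
    then show ?thesis using o yz \<open>x = \<psi>\<close> by simp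
  qed
  \<comment> \<open>Independent images inside \<open>E\<close> bound the total growth by one
    dimension.\<close>
  have dim_le: "cell_dim A + cell_dim B \<le> dim E"
    if A: "A \<subseteq> \<gamma>" "B \<subseteq> \<gamma>" "T1 ` ds A \<inter> T2 ` ds B = {0}" for A B
  proof -
    have sub: "T1 ` ds A \<subseteq> E" "T2 ` ds B \<subseteq> E" using ds_mono A(1,2) E(2,3) by blast+
    have ss: "subspace (T1 ` ds A)" "subspace (T2 ` ds B)" using T subspace_ds by (auto intro: linear_subspace_image)
    have "dim (msum (T1 ` ds A) (T2 ` ds B)) = cell_dim A + cell_dim B"
      using dim_msum[OF ss A(3)] T by (simp add: dim_image_inj cell_dim_def)
    then show ?thesis using dim_subset[OF msum_subset[OF E(1) sub]] by simp
  qed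
  have "A = \<alpha> \<and> B = \<beta> \<or> \<alpha> facet_of A \<and> B = \<beta> \<and> (\<exists>z\<in>ds A. \<psi>1 \<bullet> z \<noteq> 0) \<or>
        A = \<alpha> \<and> \<beta> facet_of B \<and> (\<exists>z\<in>ds B. \<psi>2 \<bullet> z \<noteq> 0)"
    if s: "s \<in> J" "pencil \<gamma> \<alpha> \<beta> f1 \<psi>1 f2 \<psi>2 s"
      and AB: "A = amax \<gamma> (f1 + s *\<^sub>R \<psi>1)" "B = amax \<gamma> (f2 + s *\<^sub>R \<psi>2)" for s A B
  proof -
    have sub: "\<alpha> \<subseteq> A" "\<beta> \<subseteq> B" using s AB by (auto simp: pencil_def)
    have face: "A face_of \<gamma>" "B face_of \<gamma>" using AB conv amax_face_of by auto
    have sub\<gamma>: "A \<subseteq> \<gamma>" "B \<subseteq> \<gamma>" using AB amax_subset by auto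
    have f: "\<alpha> face_of A" "\<beta> face_of B" using \<alpha>(1) \<beta>(1) sub sub\<gamma> face_of_subset by blast+
    have convAB: "convex A" "convex B" using face face_of_imp_convex by blast+
    have le: "cell_dim \<alpha> \<le> cell_dim A" "cell_dim \<beta> \<le> cell_dim B" using sub by (simp_all add: cell_dim_mono)
    have eqA: "A = \<alpha>" if "cell_dim A \<le> cell_dim \<alpha>" using face_eqI[OF f(1) \<alpha>(2) convAB(1) that] by simp
    have eqB: "B = \<beta>" if "cell_dim B \<le> cell_dim \<beta>" using face_eqI[OF f(2) \<beta>(2) convAB(2) that] by simp
    show ?thesis
    proof (cases "cell_dim A + cell_dim B \<le> cell_dim \<alpha> + cell_dim \<beta>")
      case True
      then show ?thesis using eqA eqB le by linarith
    next
      case False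
      then have ge: "dim E \<le> cell_dim A + cell_dim B" using E(4) by linarith
      have "pencil \<gamma> A B f1 \<psi>1 f2 \<psi>2 s" using AB by (simp add: pencil_def)
      from trans[OF s(1) face sub ge this] have t: "T1 ` ds A \<inter> T2 ` ds B = {0}" .
      have "cell_dim A + cell_dim B = cell_dim \<alpha> + cell_dim \<beta> + 1"
        using dim_le[OF sub\<gamma> t] ge E(4) by linarith
      then consider "cell_dim A = cell_dim \<alpha> + 1" "cell_dim B = cell_dim \<beta>"
        | "cell_dim A = cell_dim \<alpha>" "cell_dim B = cell_dim \<beta> + 1"
        using le by linarith
      then show ?thesis
      proof cases
        case 1
        then have "B = \<beta>" "\<alpha> facet_of A" using eqB f(1) \<alpha>(2) by (auto simp: facet_iff_cell_dim)
        moreover have "\<exists>z\<in>ds A. \<psi>1 \<bullet> z \<noteq> 0"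
        proof (rule ccontr)
          assume "\<not> ?thesis"
          then show False using orth_all[OF sub\<gamma> t ge] adj \<psi>(2,4) \<open>B = \<beta>\<close> by metis
        qed
        ultimately show ?thesis by blast
      next
        case 2
        then have "A = \<alpha>" "\<beta> facet_of B" using eqA f(2) \<beta>(2) by (auto simp: facet_iff_cell_dim)
        moreover have "\<exists>z\<in>ds B. \<psi>2 \<bullet> z \<noteq> 0"
        proof (rule ccontr)
          assume "\<not> ?thesis"
          then show False using orth_all[OF sub\<gamma> t ge] adj \<psi>(2,3) \<open>A = \<alpha>\<close> by metis
        qed
        ultimately show ?thesis by blast
      qed
    qed
  qed
  moreover have "\<forall>z\<in>ds \<alpha>. \<psi>1 \<bullet> z = 0" "\<forall>z\<in>ds \<beta>. \<psi>2 \<bullet> z = 0" using adj \<psi> by auto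
  ultimately show ?thesis unfolding simple_pencil_def Let_def using \<gamma> \<alpha> \<beta> by blast
qed

text \<open>Excludes sign 0, where \<open>orientation_Cons_sign\<close> gives no information: by
  simplicity \<open>A\<close> is the whole maximal face, and \<open>\<psi>1\<close> is not constant
  on it.\<close>

lemma end_face_nonzero:
  assumes simp: "simple_pencil \<gamma> \<alpha> \<beta> f1 \<psi>1 f2 \<psi>2 J" and A: "A \<in> end_faces \<gamma> \<alpha> \<beta> f1 \<psi>1 f2 \<psi>2 J"
  shows "\<psi>1 \<bullet> outward A \<alpha> \<noteq> 0" "A \<subseteq> \<gamma>" "outward A \<alpha> \<in> ds \<gamma>"
proof -
  obtain s where s: "A face_of \<gamma>" "\<alpha> facet_of A" "s \<in> J" "pencil \<gamma> A \<beta> f1 \<psi>1 f2 \<psi>2 s"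
    using A by (auto simp: end_faces_def)
  let ?A = "amax \<gamma> (f1 + s *\<^sub>R \<psi>1)"
  have \<gamma>: "polytope \<gamma>" and orth: "\<And>z. z \<in> ds \<alpha> \<Longrightarrow> \<psi>1 \<bullet> z = 0" using simp by (auto simp: simple_pencil_def)
  have sub: "A \<subseteq> ?A" using s(4) by (simp add: pencil_def)
  show sub\<gamma>: "A \<subseteq> \<gamma>" using s(1) face_of_imp_subset by blast
  then show "outward A \<alpha> \<in> ds \<gamma>" using outward_mem[OF s(2)] ds_mono by blast
  have I: "pencil \<gamma> \<alpha> \<beta> f1 \<psi>1 f2 \<psi>2 s" using s(4) facet_subset[OF s(2)] by (auto simp: pencil_def)
  have "\<alpha> \<noteq> A" using s(2) by (auto simp: facet_of_def)
  then have "?A \<noteq> \<alpha>" using sub facet_subset[OF s(2)] by blast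
  then have fac: "\<alpha> facet_of ?A" and ne: "\<exists>z\<in>ds ?A. \<psi>1 \<bullet> z \<noteq> 0"
    using simp I s(3) unfolding simple_pencil_def Let_def by blast+
  have "A = ?A"
    using fac s(2) \<gamma> face_of_subset[OF s(1) sub amax_subset]
    by (intro face_eqI) (auto simp: facet_iff_cell_dim intro: face_of_imp_convex[OF amax_face_of] polytope_imp_convex)
  then have "polytope A" "\<exists>z\<in>ds A. \<psi>1 \<bullet> z \<noteq> 0" using ne \<gamma> s(1) face_of_polytope_polytope by auto
  from facet_cases[OF this(1) s(2) orth this(2)] show "\<psi>1 \<bullet> outward A \<alpha> \<noteq> 0" by auto
qed

text \<open>The last property is why the admissible functionals form a line: two of them differ by
  one that vanishes on \<open>H\<close>.\<close>

lemma hyperplane_normal: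
  fixes H E :: "'e::euclidean_space set"
  assumes H: "subspace H" and E: "subspace E" and sub: "H \<subseteq> E" and d: "dim E = dim H + 1"
  obtains \<psi> where "\<psi> \<in> E" "\<psi> \<noteq> 0" "\<And>z. z \<in> H \<Longrightarrow> \<psi> \<bullet> z = 0"
    "\<And>z. z \<in> E \<Longrightarrow> \<psi> \<bullet> z = 0 \<Longrightarrow> z \<in> H"
    "\<And>v. \<forall>z\<in>H. v \<bullet> z = 0 \<Longrightarrow> \<exists>s. \<forall>z\<in>E. v \<bullet> z = s * (\<psi> \<bullet> z)"
proof -
  have "H \<noteq> E" using d by auto
  then have "span H \<subset> span E" using sub H E span_eq_iff by (metis psubsetI)
  then obtain \<psi> where \<psi>: "\<psi> \<noteq> 0" "\<psi> \<in> span E" "\<And>y. y \<in> span H \<Longrightarrow> orthogonal \<psi> y"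
    using orthogonal_to_subspace_exists_gen by blast
  have mem: "\<psi> \<in> E" using \<psi>(2) E span_eq_iff by metis
  have orth: "\<psi> \<bullet> z = 0" if "z \<in> H" for z using \<psi>(3)[OF span_base[OF that]] by (simp add: orthogonal_def)
  have \<psi>\<psi>: "\<psi> \<bullet> \<psi> \<noteq> 0" using \<psi>(1) by simp
  have ker: "z \<in> H" if "z \<in> E" "\<psi> \<bullet> z = 0" for z
    by (rule subspace_hyperplane_mem[OF H E sub d orth mem \<psi>\<psi> that])
  have "\<exists>s. \<forall>z\<in>E. v \<bullet> z = s * (\<psi> \<bullet> z)" if v: "\<forall>z\<in>H. v \<bullet> z = 0" for v
  proof (intro exI ballI)
    fix z assume z: "z \<in> E"
    have "z - (\<psi> \<bullet> z / (\<psi> \<bullet> \<psi>)) *\<^sub>R \<psi> \<in> H"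
      using z mem E \<psi>\<psi> by (intro ker) (auto simp: inner_diff_right intro!: subspace_diff subspace_scale)
    from bspec[OF v this] show "v \<bullet> z = (v \<bullet> \<psi> / (\<psi> \<bullet> \<psi>)) * (\<psi> \<bullet> z)"
      by (simp add: inner_diff_right)
  qed
  then show ?thesis using that[OF mem \<psi>(1) orth ker] by blast
qed

lemma end_faces_sum:
  fixes T1 T2 :: "'a::euclidean_space \<Rightarrow> 'e::euclidean_space"
  assumes simp: "simple_pencil \<gamma> \<alpha> \<beta> f1 \<psi>1 f2 \<psi>2 J"
    and E: "T1 ` ds \<gamma> \<subseteq> E" "T2 ` ds \<gamma> \<subseteq> E"
    and adj: "\<And>x. \<psi>1 \<bullet> x = \<psi> \<bullet> T1 x" "\<And>x. \<psi>2 \<bullet> x = \<psi> \<bullet> T2 x"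
    and \<kappa>: "\<And>n. n \<in> E \<Longrightarrow> \<psi> \<bullet> n \<noteq> 0 \<Longrightarrow> \<omega> (n # c) = \<kappa> * isgn (\<psi> \<bullet> n)"
  shows "(\<Sum>A\<in>end_faces \<gamma> \<alpha> \<beta> f1 \<psi>1 f2 \<psi>2 J. \<omega> (T1 (outward A \<alpha>) # c)) +
      (\<Sum>B\<in>end_faces \<gamma> \<beta> \<alpha> f2 \<psi>2 f1 \<psi>1 J. \<omega> (T2 (outward B \<beta>) # c)) =
      \<kappa> * (of_bool (\<exists>s\<in>J. lower_end (pencil \<gamma> \<alpha> \<beta> f1 \<psi>1 f2 \<psi>2) s) -
      of_bool (\<exists>s\<in>J. lower_end (\<lambda>r. pencil \<gamma> \<alpha> \<beta> f1 \<psi>1 f2 \<psi>2 (- r)) (- s)))"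
proof -
  have "(\<Sum>A\<in>end_faces \<gamma> \<alpha> \<beta> f1 \<psi>1 f2 \<psi>2 J. \<omega> (T1 (outward A \<alpha>) # c)) =
      (\<Sum>A\<in>end_faces \<gamma> \<alpha> \<beta> f1 \<psi>1 f2 \<psi>2 J. \<kappa> * isgn (\<psi>1 \<bullet> outward A \<alpha>))"
    using end_face_nonzero[OF simp] E(1) by (intro sum.cong refl) (auto simp: adj intro!: \<kappa>)
  moreover have "(\<Sum>B\<in>end_faces \<gamma> \<beta> \<alpha> f2 \<psi>2 f1 \<psi>1 J. \<omega> (T2 (outward B \<beta>) # c)) =
      (\<Sum>B\<in>end_faces \<gamma> \<beta> \<alpha> f2 \<psi>2 f1 \<psi>1 J. \<kappa> * isgn (\<psi>2 \<bullet> outward B \<beta>))"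
    using end_face_nonzero[OF simple_pencil_swap[OF simp]] E(2) by (intro sum.cong refl) (auto simp: adj intro!: \<kappa>)
  ultimately show ?thesis
    using end_sum[OF simp] by (simp only: sum_distrib_left[symmetric] distrib_left[symmetric])
qed

section \<open>The coefficients in the Leibniz rule\<close>

text \<open>Genericity of a displacement, stated in the cell instead of its dual fan.\<close>

definition adm :: "'a::euclidean_space set \<Rightarrow> 'a \<Rightarrow> bool"
  where "adm \<gamma> a \<longleftrightarrow> (\<forall>A B. A face_of \<gamma> \<and> A \<noteq> {} \<and> B face_of \<gamma> \<and> B \<noteq> {} \<and> dpair \<gamma> a A B \<and>
    cell_dim \<gamma> \<le> cell_dim A + cell_dim B \<longrightarrow> ds A \<inter> ds B = {0})"

lemma admD:
  "adm \<gamma> a \<Longrightarrow> dpair \<gamma> a A B \<Longrightarrow> A face_of \<gamma> \<Longrightarrow> A \<noteq> {} \<Longrightarrow> B face_of \<gamma> \<Longrightarrow> B \<noteq> {} \<Longrightarrow>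
    cell_dim \<gamma> \<le> cell_dim A + cell_dim B \<Longrightarrow> ds A \<inter> ds B = {0}"
  by (auto simp: adm_def)

lemma ds_Int_zero_mono:
  assumes "ds A \<inter> ds B = {0}" "A' \<subseteq> A" "B' \<subseteq> B"
  shows "ds A' \<inter> ds B' = {0}"
proof -
  have "ds A' \<inter> ds B' \<subseteq> {0}" using assms(1) ds_mono[OF assms(2)] ds_mono[OF assms(3)] by blast
  then show ?thesis using subspace_0[OF subspace_ds[of A']] subspace_0[OF subspace_ds[of B']] by auto
qed

text \<open>The first two sums count the finite ends of the line of admissible functionals, the
  third its ends at infinity. Genericity of \<open>\<gamma>\<close> controls the former; genericity
  of the facets is needed for pairs that have complementary dimensions inside a facet.\<close>

lemma leibniz_coefficient:
  fixes \<gamma> :: "'a::euclidean_space set"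
  assumes \<gamma>: "polytope \<gamma>" and \<alpha>: "\<alpha> face_of \<gamma>" "\<alpha> \<noteq> {}" and \<beta>: "\<beta> face_of \<gamma>" "\<beta> \<noteq> {}"
    and d: "cell_dim \<gamma> = cell_dim \<alpha> + cell_dim \<beta> + 1"
    and adm: "adm \<gamma> a" "\<And>\<mu>. \<mu> facet_of \<gamma> \<Longrightarrow> adm \<mu> a"
    and \<omega>: "\<omega> \<in> orientations (ds \<gamma>)" and b: "ordered_basis (ds \<alpha>) b\<alpha>" "ordered_basis (ds \<beta>) b\<beta>"
  shows "(\<Sum>A | A face_of \<gamma> \<and> \<alpha> facet_of A \<and> dpair \<gamma> a A \<beta>. \<omega> (outward A \<alpha> # b\<alpha> @ b\<beta>)) +
      (\<Sum>B | B face_of \<gamma> \<and> \<beta> facet_of B \<and> dpair \<gamma> a \<alpha> B. \<omega> (outward B \<beta> # b\<alpha> @ b\<beta>)) =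
      (\<Sum>\<mu> | \<mu> facet_of \<gamma> \<and> \<alpha> \<subseteq> \<mu> \<and> \<beta> \<subseteq> \<mu> \<and> dpair \<mu> a \<alpha> \<beta>. \<omega> (outward \<gamma> \<mu> # b\<alpha> @ b\<beta>))"
    (is "sum ?f1 ?S1 + sum ?f2 ?S2 = sum ?f3 ?S3")
proof (cases "dpair \<gamma> a \<alpha> \<beta> \<and> ds \<alpha> \<inter> ds \<beta> = {0}")
  \<comment> \<open>Each summand would come from a generic selected pair containing
    \<open>(\<alpha>, \<beta>)\<close>, in \<open>\<gamma>\<close> or in a facet. Both properties
    pass from that pair to \<open>(\<alpha>, \<beta>)\<close>, so all three sums are empty.\<close>
  case False
  have S1: "?S1 = {}"
  proof -
    have "False" if A: "A face_of \<gamma>" "\<alpha> facet_of A" "dpair \<gamma> a A \<beta>" for A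
    proof -
      have sub: "\<alpha> \<subseteq> A" using A(2) by (rule facet_subset)
      have "ds A \<inter> ds \<beta> = {0}"
        using A d \<alpha>(2) sub \<beta> by (intro admD[OF adm(1) A(3) A(1)]) (auto simp: facet_iff_cell_dim)
      then show False using False ds_Int_zero_mono[OF _ sub order_refl] dpair_mono[OF A(3) sub order_refl] by blast
    qed
    then show ?thesis by blast
  qed
  have S2: "?S2 = {}"
  proof -
    have "False" if B: "B face_of \<gamma>" "\<beta> facet_of B" "dpair \<gamma> a \<alpha> B" for B
    proof -
      have sub: "\<beta> \<subseteq> B" using B(2) by (rule facet_subset)
      have "ds \<alpha> \<inter> ds B = {0}"
        using B d \<beta>(2) sub \<alpha> by (intro admD[OF adm(1) B(3) _ _ B(1)]) (auto simp: facet_iff_cell_dim)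
      then show False using False ds_Int_zero_mono[OF _ order_refl sub] dpair_mono[OF B(3) order_refl sub] by blast
    qed
    then show ?thesis by blast
  qed
  have S3: "?S3 = {}"
  proof -
    have "False" if M: "\<mu> facet_of \<gamma>" "\<alpha> \<subseteq> \<mu>" "\<beta> \<subseteq> \<mu>" "dpair \<mu> a \<alpha> \<beta>" for \<mu>
    proof -
      have "\<alpha> face_of \<mu>" "\<beta> face_of \<mu>"
        using face_of_subset[OF \<alpha>(1) M(2) facet_subset[OF M(1)]] face_of_subset[OF \<beta>(1) M(3) facet_subset[OF M(1)]] by auto
      then have "ds \<alpha> \<inter> ds \<beta> = {0}"
        using M d \<alpha>(2) \<beta>(2) by (intro admD[OF adm(2) M(4)]) (auto simp: facet_iff_cell_dim)
      then show False using False dpair_facet[OF \<gamma> M(1,4)] by blast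
    qed
    then show ?thesis by blast
  qed
  show ?thesis unfolding S1 S2 S3 by simp
next
  case True
  then obtain w where w: "\<alpha> \<subseteq> amax \<gamma> (w - a)" "\<beta> \<subseteq> amax \<gamma> w" by (auto simp: dpair_def)
  let ?H = "msum (ds \<alpha>) (ds \<beta>)" and ?E = "ds \<gamma>" and ?c = "b\<alpha> @ b\<beta>"
  have sub: "\<alpha> \<subseteq> \<gamma>" "\<beta> \<subseteq> \<gamma>" using \<alpha>(1) \<beta>(1) face_of_imp_subset by blast+
  have HE: "?H \<subseteq> ?E" using sub by (intro msum_subset ds_mono) auto
  have dH: "dim ?E = dim ?H + 1" using d True by (simp add: dim_msum cell_dim_def)
  obtain \<psi> where \<psi>: "\<psi> \<in> ?E" "\<psi> \<noteq> 0" "\<And>z. z \<in> ?H \<Longrightarrow> \<psi> \<bullet> z = 0"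
    "\<And>z. z \<in> ?E \<Longrightarrow> \<psi> \<bullet> z = 0 \<Longrightarrow> z \<in> ?H"
    "\<And>v. \<forall>z\<in>?H. v \<bullet> z = 0 \<Longrightarrow> \<exists>s. \<forall>z\<in>?E. v \<bullet> z = s * (\<psi> \<bullet> z)"
    by (rule hyperplane_normal[OF subspace_msum[OF subspace_ds subspace_ds] subspace_ds HE dH]) (rule that)
  have H1: "z \<in> ?H" if "z \<in> ds \<alpha> \<union> ds \<beta>" for z
  proof -
    have "x = x + 0 \<and> x = 0 + x" "0 \<in> ds \<alpha>" "0 \<in> ds \<beta>" for x :: 'a using subspace_0[OF subspace_ds] by auto
    then show ?thesis using that unfolding msum_def by blast
  qed
  then have orth: "\<psi> \<bullet> z = 0" if "z \<in> ds \<alpha> \<union> ds \<beta>" for z using that \<psi>(3) by blast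
  have c: "ordered_basis ?H ?c" using ordered_basis_append[OF b] True by simp
  obtain \<kappa> where \<kappa>: "\<And>n. n \<in> ?E \<Longrightarrow> \<psi> \<bullet> n \<noteq> 0 \<Longrightarrow> \<omega> (n # ?c) = \<kappa> * isgn (\<psi> \<bullet> n)"
  proof (rule orientation_Cons_sign[OF \<omega>, of ?c \<psi>])
    show "distinct ?c" "independent (set ?c)" using c by (simp_all add: ordered_basis_def)
    show "set ?c \<subseteq> ?E" using ordered_basis_mem[OF c] HE by blast
    show "dim ?E = length ?c + 1" using ordered_basis_length[OF c] dH by simp
    show "\<psi> \<bullet> x = 0" if "x \<in> set ?c" for x using ordered_basis_mem[OF c] that \<psi>(3) by blast
  qed auto
  have simp: "simple_pencil \<gamma> \<alpha> \<beta> (w - a) \<psi> w \<psi> UNIV"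
  proof (rule simple_pencilI[where ?T1.0 = "\<lambda>x. x" and ?T2.0 = "\<lambda>x. x" and E = ?E and \<psi> = \<psi>])
    fix s :: real and A B
    assume AB: "A face_of \<gamma>" "B face_of \<gamma>" "\<alpha> \<subseteq> A" "\<beta> \<subseteq> B" "dim ?E \<le> cell_dim A + cell_dim B"
      "pencil \<gamma> A B (w - a) \<psi> w \<psi> s"
    have "dpair \<gamma> a A B"
      using AB(6) unfolding dpair_def pencil_def by (intro exI[of _ "w + s *\<^sub>R \<psi>"]) (simp add: algebra_simps)
    then show "(\<lambda>x. x) ` ds A \<inter> (\<lambda>x. x) ` ds B = {0}"
      using admD[OF adm(1) _ AB(1) _ AB(2)] AB \<alpha>(2) \<beta>(2) by (auto simp: cell_dim_def)
  qed (use \<gamma> \<alpha> \<beta> d \<psi> orth in \<open>auto simp: cell_dim_def linear_ident\<close>)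
  \<comment> \<open>A second functional selecting a pair above \<open>(\<alpha>, \<beta>)\<close>
    has the same values as \<open>w\<close> on \<open>ds \<alpha>\<close> and on
    \<open>ds \<beta>\<close>, hence differs from \<open>w\<close> by a multiple of
    \<open>\<psi>\<close> on \<open>ds \<gamma>\<close>.\<close>
  have pencil_iff: "dpair \<gamma> a A B \<longleftrightarrow> (\<exists>s\<in>UNIV. pencil \<gamma> A B (w - a) \<psi> w \<psi> s)"
    if AB: "\<alpha> \<subseteq> A" "\<beta> \<subseteq> B" for A B
  proof
    assume "dpair \<gamma> a A B"
    then obtain w' where w': "A \<subseteq> amax \<gamma> (w' - a)" "B \<subseteq> amax \<gamma> w'" by (auto simp: dpair_def)
    have "(w' - w) \<bullet> z = 0" if z: "z \<in> ?H" for z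
    proof -
      obtain x y where xy: "x \<in> ds \<alpha>" "y \<in> ds \<beta>" "z = x + y" using z by (auto simp: msum_def)
      have "(w' - a) \<bullet> x = 0" "w' \<bullet> y = 0" "(w - a) \<bullet> x = 0" "w \<bullet> y = 0"
        using amax_orthogonal[OF order_trans[OF AB(1) w'(1)] xy(1)] amax_orthogonal[OF order_trans[OF AB(2) w'(2)] xy(2)]
          amax_orthogonal[OF w(1) xy(1)] amax_orthogonal[OF w(2) xy(2)] by auto
      then show ?thesis using xy(3) by (simp add: inner_add_right inner_diff_left)
    qed
    then obtain s where s: "\<And>z. z \<in> ?E \<Longrightarrow> (w' - w) \<bullet> z = s * (\<psi> \<bullet> z)" using \<psi>(5)[of "w' - w"] by blast
    have "amax \<gamma> (w' - a) = amax \<gamma> (w - a + s *\<^sub>R \<psi>)" "amax \<gamma> w' = amax \<gamma> (w + s *\<^sub>R \<psi>)"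
      using s by (auto intro!: amax_cong simp: inner_diff_left inner_add_left algebra_simps)
    then show "\<exists>s\<in>UNIV. pencil \<gamma> A B (w - a) \<psi> w \<psi> s" using w' by (auto simp: pencil_def)
  next
    assume "\<exists>s\<in>UNIV. pencil \<gamma> A B (w - a) \<psi> w \<psi> s"
    then obtain s where "pencil \<gamma> A B (w - a) \<psi> w \<psi> s" by blast
    then show "dpair \<gamma> a A B"
      unfolding dpair_def pencil_def by (intro exI[of _ "w + s *\<^sub>R \<psi>"]) (simp add: algebra_simps)
  qed
  have S1: "?S1 = end_faces \<gamma> \<alpha> \<beta> (w - a) \<psi> w \<psi> UNIV"
    using pencil_iff[OF facet_subset order_refl] by (auto simp: end_faces_def)
  have S2: "?S2 = end_faces \<gamma> \<beta> \<alpha> w \<psi> (w - a) \<psi> UNIV"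
    using pencil_iff[OF order_refl facet_subset] by (auto simp: end_faces_def pencil_swap[of \<gamma> _ \<alpha> w])
  have nz: "\<psi> \<bullet> \<psi> \<noteq> 0" using \<psi>(2) by simp
  have "?f3 \<mu> = \<kappa> * isgn (\<psi> \<bullet> outward \<gamma> \<mu>)" if "\<mu> \<in> ?S3" for \<mu>
    using that infinity_count(2)[OF \<gamma> \<psi>(4) orth \<psi>(1) nz \<alpha>(2) \<beta>(2) w] \<kappa> outward_mem by blast
  then have "sum ?f3 ?S3 = \<kappa> * (\<Sum>\<mu>\<in>?S3. isgn (\<psi> \<bullet> outward \<gamma> \<mu>))"
    by (simp add: sum_distrib_left)
  also have "\<dots> = \<kappa> * (of_bool (\<exists>s\<in>UNIV. lower_end (pencil \<gamma> \<alpha> \<beta> (w - a) \<psi> w \<psi>) s) -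
      of_bool (\<exists>s\<in>UNIV. lower_end (\<lambda>r. pencil \<gamma> \<alpha> \<beta> (w - a) \<psi> w \<psi> (- r)) (- s)))"
    using infinity_sum[OF \<gamma> \<psi>(4) orth \<psi>(1) nz \<alpha>(2) \<beta>(2) w] by simp
  also have "\<dots> = sum ?f1 ?S1 + sum ?f2 ?S2"
    unfolding S1 S2
    by (rule end_faces_sum[OF simp, of "\<lambda>x. x" ?E "\<lambda>x. x" \<psi> \<omega> ?c \<kappa>, symmetric]) (use \<kappa> in auto)
  finally show ?thesis by simp
qed

section \<open>The coefficients in the homotopy formula\<close>

definition hpair :: "'a::euclidean_space set \<Rightarrow> 'a \<Rightarrow> 'a \<Rightarrow> 'a set \<Rightarrow> 'a set \<Rightarrow> bool"
  where "hpair \<gamma> a u A B \<longleftrightarrow> (\<exists>t\<in>{0..1}. dpair \<gamma> (a + t *\<^sub>R u) A B)"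

text \<open>Genericity of the segment from \<open>a\<close> to \<open>a + u\<close>.\<close>

definition hadm :: "'a::euclidean_space set \<Rightarrow> 'a \<Rightarrow> 'a \<Rightarrow> bool"
  where "hadm \<gamma> a u \<longleftrightarrow> (\<forall>A B. \<forall>t\<in>{0..1}. A face_of \<gamma> \<and> A \<noteq> {} \<and> B face_of \<gamma> \<and> B \<noteq> {} \<and>
    dpair \<gamma> (a + t *\<^sub>R u) A B \<and> cell_dim \<gamma> \<le> cell_dim A + cell_dim B \<longrightarrow>
    (\<forall>x\<in>ds A \<inter> ds B. u \<bullet> x = 0 \<longrightarrow> x = 0) \<and> (t = 0 \<or> t = 1 \<longrightarrow> ds A \<inter> ds B = {0}))"

text \<open>Points \<open>(w, t)\<close> of the dual of \<open>V \<times> \<real>\<close> evaluate on \<open>shear u x\<close> to \<open>(w - t u)(x)\<close>, the part of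
  the functional \<open>w - (a + t u)\<close> that depends on \<open>(w, t)\<close>.\<close>

definition shear :: "'a::euclidean_space \<Rightarrow> 'a \<Rightarrow> 'a \<times> real"
  where "shear u x = (x, - (u \<bullet> x))"

lemma linear_shear [simp]: "linear (shear u)"
  by (rule linearI) (auto simp: shear_def inner_add_right)

lemma inj_shear [simp]: "inj (shear u)"
  by (auto simp: inj_def shear_def)

lemma dim_Times_UNIV:
  fixes W :: "'a::euclidean_space set"
  assumes "subspace W"
  shows "dim (W \<times> (UNIV :: real set)) = dim W + 1"
  using dim_Times[OF assms, of "UNIV :: real set"] by simp

text \<open>A common vector is \<open>(x, 0)\<close> with \<open>x\<close> in both direction spaces
  and \<open>u \<bullet> x = 0\<close>. So inside the segment the spaces may meet in a line, as long
  as \<open>u\<close> does not vanish on it.\<close>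

lemma shear_Int:
  assumes "\<forall>x\<in>ds A \<inter> ds B. u \<bullet> x = 0 \<longrightarrow> x = 0"
  shows "shear u ` ds A \<inter> shear 0 ` ds B = {0}"
proof -
  have "shear u ` ds A \<inter> shear 0 ` ds B \<subseteq> {0}" using assms by (auto simp: shear_def zero_prod_def)
  moreover have "0 \<in> shear u ` ds A" "0 \<in> shear 0 ` ds B"
    using subspace_0[OF linear_subspace_image[OF linear_shear subspace_ds]] by blast+
  ultimately show ?thesis by blast
qed

lemma hpair_mono: "hpair \<gamma> a u A B \<Longrightarrow> A' \<subseteq> A \<Longrightarrow> B' \<subseteq> B \<Longrightarrow> hpair \<gamma> a u A' B'"
  unfolding hpair_def using dpair_mono by blast

lemma hadm_transversal:
  assumes "hadm \<gamma> a u" "hpair \<gamma> a u A B" "A face_of \<gamma>" "A \<noteq> {}" "B face_of \<gamma>" "B \<noteq> {}"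
    "cell_dim \<gamma> \<le> cell_dim A + cell_dim B" "A' \<subseteq> A" "B' \<subseteq> B"
  shows "\<forall>x\<in>ds A' \<inter> ds B'. u \<bullet> x = 0 \<longrightarrow> x = 0"
  using assms(1-7) ds_mono[OF assms(8)] ds_mono[OF assms(9)] unfolding hadm_def hpair_def by blast

lemma hadm_ends:
  assumes "hadm \<gamma> a u" "A face_of \<gamma>" "A \<noteq> {}" "B face_of \<gamma>" "B \<noteq> {}" "cell_dim \<gamma> \<le> cell_dim A + cell_dim B"
    and "dpair \<gamma> a A B \<or> dpair \<gamma> (a + u) A B"
  shows "ds A \<inter> ds B = {0}"
proof -
  have "dpair \<gamma> (a + 0 *\<^sub>R u) A B \<or> dpair \<gamma> (a + 1 *\<^sub>R u) A B" using assms(7) by simp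
  then show ?thesis using assms(1-6) unfolding hadm_def by (metis atLeastAtMost_iff order_refl zero_le_one)
qed

text \<open>The line of admissible pairs of functional and time has direction
  \<open>(\<rho>, \<tau>)\<close>. If \<open>\<tau> \<noteq> 0\<close>, it crosses the time window;
  an end missing in the window is a crossing of time 0 or 1, that is, a term of one of the two
  products, and no facet contains both faces. If \<open>\<tau> = 0\<close>, time is constant on the
  line, neither product has a term, and facets at infinity balance the ends as in the Leibniz
  rule.\<close>

lemma homotopy_coefficient:
  fixes \<gamma> :: "'a::euclidean_space set"
  assumes \<gamma>: "polytope \<gamma>" and \<alpha>: "\<alpha> face_of \<gamma>" "\<alpha> \<noteq> {}" and \<beta>: "\<beta> face_of \<gamma>" "\<beta> \<noteq> {}"
    and d: "cell_dim \<gamma> = cell_dim \<alpha> + cell_dim \<beta>"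
    and adm: "hadm \<gamma> a u" "\<And>\<mu>. \<mu> facet_of \<gamma> \<Longrightarrow> hadm \<mu> a u"
    and \<omega>: "\<omega> \<in> orientations (ds \<gamma> \<times> UNIV)" and b: "ordered_basis (ds \<alpha>) b\<alpha>" "ordered_basis (ds \<beta>) b\<beta>"
  defines "c \<equiv> map (shear u) b\<alpha> @ map (shear 0) b\<beta>"
  shows "(\<Sum>A | A face_of \<gamma> \<and> \<alpha> facet_of A \<and> hpair \<gamma> a u A \<beta>. \<omega> (shear u (outward A \<alpha>) # c)) +
      (\<Sum>B | B face_of \<gamma> \<and> \<beta> facet_of B \<and> hpair \<gamma> a u \<alpha> B. \<omega> (shear 0 (outward B \<beta>) # c)) =
      (of_bool (dpair \<gamma> (a + u) \<alpha> \<beta>) - of_bool (dpair \<gamma> a \<alpha> \<beta>)) * \<omega> ((0, 1) # c) +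
      (\<Sum>\<mu> | \<mu> facet_of \<gamma> \<and> \<alpha> \<subseteq> \<mu> \<and> \<beta> \<subseteq> \<mu> \<and> hpair \<mu> a u \<alpha> \<beta>. \<omega> (shear 0 (outward \<gamma> \<mu>) # c))"
    (is "sum ?f1 ?S1 + sum ?f2 ?S2 = ?D + sum ?f3 ?S3")
proof -
  have tr0: "\<forall>x\<in>ds \<alpha> \<inter> ds \<beta>. u \<bullet> x = 0 \<longrightarrow> x = 0" if "dpair \<gamma> a \<alpha> \<beta> \<or> dpair \<gamma> (a + u) \<alpha> \<beta>"
    using hadm_ends[OF adm(1) \<alpha> \<beta> _ that] d by auto
  have hp0: "hpair \<gamma> a u \<alpha> \<beta>" if "dpair \<gamma> a \<alpha> \<beta> \<or> dpair \<gamma> (a + u) \<alpha> \<beta>"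
    using that unfolding hpair_def
    by (metis add.right_neutral atLeastAtMost_iff order_refl scaleR_one scaleR_zero_left zero_le_one)
  have trA: "(\<forall>x\<in>ds \<alpha> \<inter> ds \<beta>. u \<bullet> x = 0 \<longrightarrow> x = 0) \<and> hpair \<gamma> a u \<alpha> \<beta>"
    if A: "A face_of \<gamma>" "\<alpha> facet_of A" "hpair \<gamma> a u A \<beta>" for A
    using hadm_transversal[OF adm(1) A(3,1) _ \<beta> _ facet_subset[OF A(2)] order_refl] A(2) d \<alpha>(2)
      hpair_mono[OF A(3) facet_subset[OF A(2)] order_refl] facet_subset[OF A(2)]
    by (auto simp: facet_iff_cell_dim)
  have trB: "(\<forall>x\<in>ds \<alpha> \<inter> ds \<beta>. u \<bullet> x = 0 \<longrightarrow> x = 0) \<and> hpair \<gamma> a u \<alpha> \<beta>"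
    if B: "B face_of \<gamma>" "\<beta> facet_of B" "hpair \<gamma> a u \<alpha> B" for B
    using hadm_transversal[OF adm(1) B(3) \<alpha> B(1) _ _ order_refl facet_subset[OF B(2)]] B(2) d \<beta>(2)
      hpair_mono[OF B(3) order_refl facet_subset[OF B(2)]] facet_subset[OF B(2)]
    by (auto simp: facet_iff_cell_dim)
  have trM: "(\<forall>x\<in>ds \<alpha> \<inter> ds \<beta>. u \<bullet> x = 0 \<longrightarrow> x = 0) \<and> hpair \<gamma> a u \<alpha> \<beta>"
    if M: "\<mu> facet_of \<gamma>" "\<alpha> \<subseteq> \<mu>" "\<beta> \<subseteq> \<mu>" "hpair \<mu> a u \<alpha> \<beta>" for \<mu>
  proof -
    have "\<alpha> face_of \<mu>" "\<beta> face_of \<mu>"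
      using face_of_subset[OF \<alpha>(1) M(2) facet_subset[OF M(1)]] face_of_subset[OF \<beta>(1) M(3) facet_subset[OF M(1)]] by auto
    then have "\<forall>x\<in>ds \<alpha> \<inter> ds \<beta>. u \<bullet> x = 0 \<longrightarrow> x = 0"
      using M(1) d \<alpha>(2) \<beta>(2)
      by (intro hadm_transversal[OF adm(2)[OF M(1)] M(4)]) (auto simp: facet_iff_cell_dim)
    then show ?thesis using M(4) dpair_facet[OF \<gamma> M(1)] unfolding hpair_def by blast
  qed
  show ?thesis
  proof (cases "(\<forall>x\<in>ds \<alpha> \<inter> ds \<beta>. u \<bullet> x = 0 \<longrightarrow> x = 0) \<and> hpair \<gamma> a u \<alpha> \<beta>")
    case False
    have S1: "?S1 = {}" using trA False by blast
    have S2: "?S2 = {}" using trB False by blast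
    have S3: "?S3 = {}" using trM False by blast
    have "\<not> dpair \<gamma> a \<alpha> \<beta>" "\<not> dpair \<gamma> (a + u) \<alpha> \<beta>" using tr0 hp0 False by blast+
    then show ?thesis unfolding S1 S2 S3 by simp
  next
    case True
    then have tr: "\<forall>x\<in>ds \<alpha> \<inter> ds \<beta>. u \<bullet> x = 0 \<longrightarrow> x = 0" and "hpair \<gamma> a u \<alpha> \<beta>" by auto
    then obtain t0 w where t0: "0 \<le> t0" "t0 \<le> 1"
      and w: "\<alpha> \<subseteq> amax \<gamma> (w - (a + t0 *\<^sub>R u))" "\<beta> \<subseteq> amax \<gamma> w"
      by (auto simp: hpair_def dpair_def)
    let ?U = "shear u ` ds \<alpha>" and ?U' = "shear 0 ` ds \<beta>" and ?E = "ds \<gamma> \<times> (UNIV :: real set)"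
    let ?H = "msum ?U ?U'"
    have sub: "\<alpha> \<subseteq> \<gamma>" "\<beta> \<subseteq> \<gamma>" using \<alpha>(1) \<beta>(1) face_of_imp_subset by blast+
    have E: "subspace ?E" "dim ?E = dim (ds \<gamma>) + 1"
      by (simp_all add: subspace_Times dim_Times_UNIV)
    have TE: "shear v ` ds \<gamma> \<subseteq> ?E" for v by (auto simp: shear_def)
    have UE: "?U \<subseteq> ?E" "?U' \<subseteq> ?E" using TE ds_mono[OF sub(1)] ds_mono[OF sub(2)] by blast+
    have ss: "subspace ?U" "subspace ?U'" by (simp_all add: linear_subspace_image)
    have int: "?U \<inter> ?U' = {0}" by (rule shear_Int[OF tr])
    have HE: "?H \<subseteq> ?E" by (rule msum_subset[OF E(1) UE])
    have dH: "dim ?E = dim ?H + 1"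
      using d dim_msum[OF ss int] E(2) by (simp add: dim_image_inj cell_dim_def)
    have c: "ordered_basis ?H c"
      unfolding c_def
      by (intro ordered_basis_append int ordered_basis_map b linear_shear inj_on_subset[OF inj_shear]) auto
    have H1: "z \<in> ?H" if "z \<in> ?U \<union> ?U'" for z
    proof -
      have "x = x + 0 \<and> x = 0 + x" "0 \<in> ?U" "0 \<in> ?U'" for x :: "'a \<times> real" using subspace_0 ss by auto
      then show ?thesis using that unfolding msum_def by blast
    qed
    obtain \<psi>' where \<psi>': "\<psi>' \<in> ?E" "\<psi>' \<noteq> 0" "\<And>z. z \<in> ?H \<Longrightarrow> \<psi>' \<bullet> z = 0"
      "\<And>z. z \<in> ?E \<Longrightarrow> \<psi>' \<bullet> z = 0 \<Longrightarrow> z \<in> ?H"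
      "\<And>v. \<forall>z\<in>?H. v \<bullet> z = 0 \<Longrightarrow> \<exists>s. \<forall>z\<in>?E. v \<bullet> z = s * (\<psi>' \<bullet> z)"
      by (rule hyperplane_normal[OF subspace_msum[OF ss] E(1) HE dH]) (rule that)
    \<comment> \<open>The sign is normalised so that time does not decrease with the
      parameter.\<close>
    define \<psi> where "\<psi> = (if 0 \<le> snd \<psi>' then \<psi>' else - \<psi>')"
    have pm: "\<psi> \<bullet> z = 0 \<longleftrightarrow> \<psi>' \<bullet> z = 0" for z by (simp add: \<psi>_def)
    have \<psi>: "\<psi> \<in> ?E" "\<psi> \<noteq> 0" "\<And>z. z \<in> ?H \<Longrightarrow> \<psi> \<bullet> z = 0"
      "\<And>z. z \<in> ?E \<Longrightarrow> \<psi> \<bullet> z = 0 \<Longrightarrow> z \<in> ?H" "0 \<le> snd \<psi>"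
    proof -
      show "\<psi> \<in> ?E" "\<psi> \<noteq> 0" "0 \<le> snd \<psi>"
        using \<psi>'(1,2) subspace_neg[OF E(1) \<psi>'(1)] by (simp_all add: \<psi>_def)
    qed (use \<psi>'(3,4) pm in blast)+
    have \<psi>5: "\<exists>s. \<forall>z\<in>?E. v \<bullet> z = s * (\<psi> \<bullet> z)" if v: "\<forall>z\<in>?H. v \<bullet> z = 0" for v
    proof -
      obtain s where "\<forall>z\<in>?E. v \<bullet> z = s * (\<psi>' \<bullet> z)" using \<psi>'(5)[OF v] by blast
      then have "\<forall>z\<in>?E. v \<bullet> z = (if 0 \<le> snd \<psi>' then s else - s) * (\<psi> \<bullet> z)" by (simp add: \<psi>_def)
      then show ?thesis by blast
    qed
    define \<rho> \<tau> where "\<rho> = fst \<psi>" and "\<tau> = snd \<psi>"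
    have \<psi>_eq: "\<psi> = (\<rho>, \<tau>)" by (simp add: \<rho>_def \<tau>_def)
    \<comment> \<open>A step \<open>s\<close> changes \<open>w\<close> by \<open>s \<rho>\<close>
      and the time by \<open>s \<tau>\<close>, hence changes \<open>w - (a + t u)\<close> by
      \<open>s (\<rho> - \<tau> u)\<close>.\<close>
    define f1 \<psi>1 where "f1 = w - (a + t0 *\<^sub>R u)" and "\<psi>1 = \<rho> - \<tau> *\<^sub>R u"
    define J where "J = {s. 0 \<le> t0 + s * \<tau> \<and> t0 + s * \<tau> \<le> 1}"
    let ?P = "pencil \<gamma> \<alpha> \<beta> f1 \<psi>1 w \<rho>"
    have P0: "?P 0" using w by (simp add: pencil_def f1_def)
    have adj: "\<psi>1 \<bullet> x = \<psi> \<bullet> shear u x" "\<rho> \<bullet> x = \<psi> \<bullet> shear 0 x" for x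
      by (simp_all add: \<psi>_eq \<psi>1_def shear_def inner_diff_left)
    have param: "f1 + s *\<^sub>R \<psi>1 = (w + s *\<^sub>R \<rho>) - (a + (t0 + s * \<tau>) *\<^sub>R u)" for s
      by (simp add: f1_def \<psi>1_def algebra_simps)
    have pencil_dpair: "dpair \<gamma> (a + (t0 + s * \<tau>) *\<^sub>R u) A B" if "pencil \<gamma> A B f1 \<psi>1 w \<rho> s" for s A B
      using that unfolding dpair_def pencil_def param by blast
    have orth: "\<psi> \<bullet> shear u z = 0" if "z \<in> ds \<alpha>" for z using that H1 \<psi>(3) by blast
    have orth': "\<psi> \<bullet> shear 0 z = 0" if "z \<in> ds \<beta>" for z using that H1 \<psi>(3) by blast
    obtain \<kappa> where \<kappa>: "\<And>n. n \<in> ?E \<Longrightarrow> \<psi> \<bullet> n \<noteq> 0 \<Longrightarrow> \<omega> (n # c) = \<kappa> * isgn (\<psi> \<bullet> n)"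
    proof (rule orientation_Cons_sign[OF \<omega>, of c \<psi>])
      show "distinct c" "independent (set c)" using c by (simp_all add: ordered_basis_def)
      show "set c \<subseteq> ?E" using ordered_basis_mem[OF c] HE by blast
      show "dim ?E = length c + 1" using ordered_basis_length[OF c] dH by simp
      show "\<psi> \<bullet> x = 0" if "x \<in> set c" for x using ordered_basis_mem[OF c] that \<psi>(3) by blast
    qed (use E in auto)
    have simp: "simple_pencil \<gamma> \<alpha> \<beta> f1 \<psi>1 w \<rho> J"
    proof (rule simple_pencilI[where ?T1.0 = "shear u" and ?T2.0 = "shear 0" and E = ?E and \<psi> = \<psi>])
      fix s :: real and A B
      assume AB: "s \<in> J" "A face_of \<gamma>" "B face_of \<gamma>" "\<alpha> \<subseteq> A" "\<beta> \<subseteq> B" "dim ?E \<le> cell_dim A + cell_dim B"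
        "pencil \<gamma> A B f1 \<psi>1 w \<rho> s"
      have "hpair \<gamma> a u A B" using pencil_dpair[OF AB(7)] AB(1) by (auto simp: hpair_def J_def)
      then show "shear u ` ds A \<inter> shear 0 ` ds B = {0}"
        using AB E(2) \<alpha>(2) \<beta>(2)
        by (intro shear_Int hadm_transversal[OF adm(1) _ AB(2) _ AB(3)]) (auto simp: cell_dim_def)
    qed (use \<gamma> \<alpha> \<beta> d \<psi> orth orth' adj E TE in \<open>auto simp: cell_dim_def\<close>)
    \<comment> \<open>The displacement in functional and time between two selections vanishes on
      both sheared spaces, so it is a multiple of \<open>\<psi>\<close>; its last coordinate gives
      the time.\<close>
    have dpair_pencil: "\<exists>s. t = t0 + s * \<tau> \<and> pencil \<gamma> A B f1 \<psi>1 w \<rho> s"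
      if AB: "\<alpha> \<subseteq> A" "\<beta> \<subseteq> B" and dp: "dpair \<gamma> (a + t *\<^sub>R u) A B" for A B t
    proof -
      obtain w' where w': "A \<subseteq> amax \<gamma> (w' - (a + t *\<^sub>R u))" "B \<subseteq> amax \<gamma> w'" using dp by (auto simp: dpair_def)
      have "(w' - w, t - t0) \<bullet> z = 0" if z: "z \<in> ?H" for z
      proof -
        obtain x y where xy: "x \<in> ds \<alpha>" "y \<in> ds \<beta>" "z = shear u x + shear 0 y" using z unfolding msum_def by blast
        have "(w' - (a + t *\<^sub>R u)) \<bullet> x = 0" "w' \<bullet> y = 0" "(w - (a + t0 *\<^sub>R u)) \<bullet> x = 0" "w \<bullet> y = 0"
          using amax_orthogonal[OF order_trans[OF AB(1) w'(1)] xy(1)] amax_orthogonal[OF order_trans[OF AB(2) w'(2)] xy(2)]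
            amax_orthogonal[OF w(1) xy(1)] amax_orthogonal[OF w(2) xy(2)] by auto
        then show ?thesis
          using xy(3) by (simp add: shear_def inner_add_right inner_diff_left inner_add_left algebra_simps)
      qed
      then obtain s where s: "\<And>z. z \<in> ?E \<Longrightarrow> (w' - w, t - t0) \<bullet> z = s * (\<psi> \<bullet> z)"
        using \<psi>5[of "(w' - w, t - t0)"] by blast
      have t: "t = t0 + s * \<tau>" using s[of "(0, 1)"] subspace_0[OF subspace_ds[of \<gamma>]] by (simp add: \<psi>_eq algebra_simps)
      have w_eq: "w' \<bullet> z = (w + s *\<^sub>R \<rho>) \<bullet> z" if "z \<in> ds \<gamma>" for z
        using s[of "(z, 0)"] that by (simp add: \<psi>_eq inner_diff_left inner_add_left)
      have "amax \<gamma> (w' - (a + t *\<^sub>R u)) = amax \<gamma> (f1 + s *\<^sub>R \<psi>1)" "amax \<gamma> w' = amax \<gamma> (w + s *\<^sub>R \<rho>)"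
        unfolding param t using w_eq by (auto intro!: amax_cong simp: inner_diff_left)
      then show ?thesis using w' t by (auto simp: pencil_def)
    qed
    have hpair_iff: "hpair \<gamma> a u A B \<longleftrightarrow> (\<exists>s\<in>J. pencil \<gamma> A B f1 \<psi>1 w \<rho> s)" if AB: "\<alpha> \<subseteq> A" "\<beta> \<subseteq> B" for A B
    proof
      assume "hpair \<gamma> a u A B"
      then obtain t where t: "0 \<le> t" "t \<le> 1" "dpair \<gamma> (a + t *\<^sub>R u) A B" by (auto simp: hpair_def)
      from dpair_pencil[OF AB t(3)] show "\<exists>s\<in>J. pencil \<gamma> A B f1 \<psi>1 w \<rho> s" using t by (auto simp: J_def)
    next
      assume "\<exists>s\<in>J. pencil \<gamma> A B f1 \<psi>1 w \<rho> s"
      then obtain s where s: "s \<in> J" "pencil \<gamma> A B f1 \<psi>1 w \<rho> s" by blast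
      show "hpair \<gamma> a u A B"
        unfolding hpair_def using pencil_dpair[OF s(2)] s(1) by (intro bexI) (auto simp: J_def)
    qed
    have S1: "?S1 = end_faces \<gamma> \<alpha> \<beta> f1 \<psi>1 w \<rho> J"
      using hpair_iff[OF facet_subset order_refl] by (auto simp: end_faces_def)
    have S2: "?S2 = end_faces \<gamma> \<beta> \<alpha> w \<rho> f1 \<psi>1 J"
      using hpair_iff[OF order_refl facet_subset] by (auto simp: end_faces_def pencil_swap[of \<gamma> _ \<alpha> w])
    have ends: "sum ?f1 ?S1 + sum ?f2 ?S2 = \<kappa> * (of_bool (\<exists>s\<in>J. lower_end ?P s) -
        of_bool (\<exists>s\<in>J. lower_end (\<lambda>r. ?P (- r)) (- s)))"
      unfolding S1 S2 by (rule end_faces_sum[OF simp TE TE adj \<kappa>])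
    have zeroE: "(0, 1) \<in> ?E" using subspace_0[OF subspace_ds] by simp
    show ?thesis
    proof (cases "\<tau> = 0")
      case True
      \<comment> \<open>With \<open>\<tau> = 0\<close> the time direction lies in \<open>?H\<close>.
        Writing it as a sum of sheared vectors gives a vector common to \<open>ds \<alpha>\<close>
        and \<open>ds \<beta>\<close> on which \<open>u\<close> is not zero, contradicting
        genericity at the extreme times.\<close>
      have no: "\<not> dpair \<gamma> a \<alpha> \<beta> \<and> \<not> dpair \<gamma> (a + u) \<alpha> \<beta>"
      proof (rule ccontr)
        assume "\<not> ?thesis"
        then have z: "ds \<alpha> \<inter> ds \<beta> = {0}" using hadm_ends[OF adm(1) \<alpha> \<beta>] d by auto
        have "(0, 1) \<in> ?H" using \<psi>(4)[OF zeroE] True by (simp add: \<psi>_eq)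
        then obtain x y where xy: "x \<in> ds \<alpha>" "y \<in> ds \<beta>" "(0, 1) = shear u x + shear 0 y" unfolding msum_def by blast
        then have "x = - y" by (simp add: shear_def eq_neg_iff_add_eq_0)
        then have "x \<in> ds \<alpha> \<inter> ds \<beta>" using xy subspace_neg[OF subspace_ds] by auto
        then show False using z xy by (auto simp: shear_def)
      qed
      have J: "J = UNIV" using True t0 by (auto simp: J_def)
      have \<psi>1: "\<psi>1 = \<rho>" using True by (simp add: \<psi>1_def)
      have \<rho>: "\<rho> \<in> ds \<gamma>" "\<rho> \<bullet> \<rho> \<noteq> 0" using \<psi>(1,2) True by (auto simp: \<psi>_eq zero_prod_def)
      have ker: "x \<in> msum (ds \<alpha>) (ds \<beta>)" if x: "x \<in> ds \<gamma>" "\<rho> \<bullet> x = 0" for x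
      proof -
        have "(x, 0) \<in> ?H" using x by (intro \<psi>(4)) (auto simp: \<psi>_eq)
        then obtain y z where yz: "y \<in> ds \<alpha>" "z \<in> ds \<beta>" "(x, 0) = shear u y + shear 0 z" unfolding msum_def by blast
        then have "x = y + z" by (simp add: shear_def)
        then show ?thesis using yz unfolding msum_def by blast
      qed
      have orth_\<rho>: "\<rho> \<bullet> z = 0" if "z \<in> ds \<alpha> \<union> ds \<beta>" for z
        using that orth orth' adj \<psi>1 by (metis UnE)
      \<comment> \<open>Time is constant on the line, so a facet can select the pair at time
        \<open>t0\<close> only.\<close>
      have S3: "?S3 = {\<mu>. \<mu> facet_of \<gamma> \<and> \<alpha> \<subseteq> \<mu> \<and> \<beta> \<subseteq> \<mu> \<and> dpair \<mu> (a + t0 *\<^sub>R u) \<alpha> \<beta>}" (is "_ = ?S4")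
      proof -
        have "hpair \<mu> a u \<alpha> \<beta> \<longleftrightarrow> dpair \<mu> (a + t0 *\<^sub>R u) \<alpha> \<beta>" if \<mu>: "\<mu> facet_of \<gamma>" for \<mu>
        proof
          assume "hpair \<mu> a u \<alpha> \<beta>"
          then obtain t where t: "dpair \<mu> (a + t *\<^sub>R u) \<alpha> \<beta>" by (auto simp: hpair_def)
          have "t = t0" using dpair_pencil[OF order_refl order_refl dpair_facet[OF \<gamma> \<mu> t]] True by simp
          then show "dpair \<mu> (a + t0 *\<^sub>R u) \<alpha> \<beta>" using t by simp
        next
          assume "dpair \<mu> (a + t0 *\<^sub>R u) \<alpha> \<beta>"
          then show "hpair \<mu> a u \<alpha> \<beta>" using t0 by (auto simp: hpair_def)
        qed
        then show ?thesis by blast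
      qed
      have "?f3 \<mu> = \<kappa> * isgn (\<rho> \<bullet> outward \<gamma> \<mu>)" if "\<mu> \<in> ?S4" for \<mu>
      proof -
        have "\<rho> \<bullet> outward \<gamma> \<mu> \<noteq> 0" "shear 0 (outward \<gamma> \<mu>) \<in> ?E"
          using that infinity_count(2)[OF \<gamma> ker orth_\<rho> \<rho> \<alpha>(2) \<beta>(2) w] outward_mem TE by blast+
        then show ?thesis using \<kappa> adj(2) by simp
      qed
      then have "sum ?f3 ?S3 = \<kappa> * (\<Sum>\<mu>\<in>?S4. isgn (\<rho> \<bullet> outward \<gamma> \<mu>))"
        unfolding S3 by (simp add: sum_distrib_left)
      also have "\<dots> = \<kappa> * (of_bool (\<exists>s. lower_end ?P s) - of_bool (\<exists>s. lower_end (\<lambda>r. ?P (- r)) (- s)))"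
        using infinity_sum[OF \<gamma> ker orth_\<rho> \<rho> \<alpha>(2) \<beta>(2) w] by (simp add: \<psi>1 f1_def)
      finally show ?thesis using ends no by (simp add: J)
    next
      case False
      then have \<tau>: "0 < \<tau>" using \<psi>(5) by (simp add: \<psi>_eq)
      \<comment> \<open>For such a facet, \<open>?H\<close> and
        \<open>ds \<mu> \<times> UNIV\<close> would coincide by dimension, so \<open>?H\<close>
        would contain the time direction, where \<open>\<psi>\<close> has the value
        \<open>\<tau> \<noteq> 0\<close>.\<close>
      have S3: "?S3 = {}"
      proof -
        have False if M: "\<mu> facet_of \<gamma>" "\<alpha> \<subseteq> \<mu>" "\<beta> \<subseteq> \<mu>" for \<mu>
        proof -
          have "?H \<subseteq> ds \<mu> \<times> UNIV"
            using ds_mono[OF M(2)] ds_mono[OF M(3)] subspace_add[OF subspace_ds[of \<mu>]]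
            by (fastforce simp: msum_def shear_def)
          moreover have "dim (ds \<mu> \<times> (UNIV :: real set)) = dim ?H"
            using M(1) dH E(2) by (simp add: dim_Times_UNIV facet_iff_cell_dim cell_dim_def)
          ultimately have "?H = ds \<mu> \<times> UNIV"
            by (intro subspace_dim_equal) (auto simp: subspace_msum ss subspace_Times)
          then have "(0, 1) \<in> ?H" using subspace_0[OF subspace_ds] by simp
          from \<psi>(3)[OF this] show False using False by (simp add: \<psi>_eq)
        qed
        then show ?thesis by blast
      qed
      \<comment> \<open>The parameters at which the time is 0 and 1.\<close>
      define sa sb where "sa = - t0 / \<tau>" and "sb = (1 - t0) / \<tau>"
      have J: "J = {sa..sb}" using \<tau> by (auto simp: J_def sa_def sb_def field_simps)
      have s0: "sa \<le> 0" "0 \<le> sb" using t0 \<tau> by (auto simp: sa_def sb_def field_simps)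
      have tt: "t0 + sa * \<tau> = 0" "t0 + sb * \<tau> = 1" using \<tau> by (auto simp: sa_def sb_def)
      have Pa: "dpair \<gamma> a \<alpha> \<beta> \<longleftrightarrow> ?P sa"
      proof
        assume "dpair \<gamma> a \<alpha> \<beta>"
        then obtain s where "0 = t0 + s * \<tau>" "?P s" using dpair_pencil[of \<alpha> \<beta> 0] by auto
        then show "?P sa" using tt \<tau> by (metis add_left_cancel mult_right_cancel False)
      qed (use pencil_dpair[of \<alpha> \<beta> sa] tt in simp)
      have Pb: "dpair \<gamma> (a + u) \<alpha> \<beta> \<longleftrightarrow> ?P sb"
      proof
        assume "dpair \<gamma> (a + u) \<alpha> \<beta>"
        then obtain s where "1 = t0 + s * \<tau>" "?P s" using dpair_pencil[of \<alpha> \<beta> 1] by auto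
        then show "?P sb" using tt \<tau> by (metis add_left_cancel mult_right_cancel False)
      qed (use pencil_dpair[of \<alpha> \<beta> sb] tt in simp)
      \<comment> \<open>At the extreme times the maximal faces have independent directions, so their
        dimensions add up to at most that of \<open>\<gamma>\<close>, which \<open>\<alpha>\<close>
        and \<open>\<beta>\<close> already reach. Neither can have grown.\<close>
      have stable: "amax \<gamma> (f1 + s *\<^sub>R \<psi>1) = \<alpha> \<and> amax \<gamma> (w + s *\<^sub>R \<rho>) = \<beta>"
        if s: "?P s" "t0 + s * \<tau> = 0 \<or> t0 + s * \<tau> = 1" for s
      proof -
        let ?A = "amax \<gamma> (f1 + s *\<^sub>R \<psi>1)" and ?B = "amax \<gamma> (w + s *\<^sub>R \<rho>)"
        have AB: "\<alpha> \<subseteq> ?A" "\<beta> \<subseteq> ?B" using s(1) by (auto simp: pencil_def)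
        have face: "?A face_of \<gamma>" "?B face_of \<gamma>" using \<gamma> by (simp_all add: amax_face_of polytope_imp_convex)
        have le: "cell_dim \<alpha> \<le> cell_dim ?A" "cell_dim \<beta> \<le> cell_dim ?B" using AB by (simp_all add: cell_dim_mono)
        have "dpair \<gamma> a ?A ?B \<or> dpair \<gamma> (a + u) ?A ?B"
          using pencil_dpair[of ?A ?B s] s(2) by (auto simp: pencil_def)
        then have "ds ?A \<inter> ds ?B = {0}"
          using AB \<alpha>(2) \<beta>(2) le d by (intro hadm_ends[OF adm(1) face(1) _ face(2)]) auto
        then have "cell_dim ?A + cell_dim ?B = dim (msum (ds ?A) (ds ?B))"
          by (simp add: dim_msum cell_dim_def)
        also have "\<dots> \<le> cell_dim \<gamma>"
          unfolding cell_dim_def by (intro dim_subset msum_subset subspace_ds ds_mono amax_subset)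
        finally have "cell_dim ?A \<le> cell_dim \<alpha>" "cell_dim ?B \<le> cell_dim \<beta>" using le d by auto
        moreover have "\<alpha> face_of ?A" "\<beta> face_of ?B"
          using face_of_subset[OF \<alpha>(1) AB(1) amax_subset] face_of_subset[OF \<beta>(1) AB(2) amax_subset] by auto
        moreover have "convex ?A" "convex ?B" using face face_of_imp_convex by auto
        ultimately show ?thesis using face_eqI[of \<alpha> ?A] face_eqI[of \<beta> ?B] \<alpha>(2) \<beta>(2) by auto
      qed
      have lo: "(\<exists>s\<in>{sa..sb}. lower_end ?P s) \<longleftrightarrow> \<not> ?P sa"
      proof (rule interval_lower_end_within[OF pencil_set_closed(1)[OF sub] pencil_set_interval P0 s0])
        show "\<not> lower_end ?P sa"
          using stable[of sa] tt pencil_extend_below[OF simp] by (auto simp: lower_end_def)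
      qed
      have rev: "pencil \<gamma> \<alpha> \<beta> f1 (- \<psi>1) w (- \<rho>) = (\<lambda>r. ?P (- r))"
        by (intro ext) (rule pencil_reverse)
      have "(\<exists>s\<in>{- sb..- sa}. lower_end (\<lambda>r. ?P (- r)) s) \<longleftrightarrow> \<not> ?P (- (- sb))"
      proof (rule interval_lower_end_within[OF pencil_set_closed(2)[OF sub], of _ _ _ _ 0])
        show "?P (- s)" if "?P (- s1)" "?P (- s2)" "s1 \<le> s" "s \<le> s2" for s1 s2 s
          using pencil_set_interval[OF that(2,1), of "- s"] that by simp
        show "\<not> lower_end (\<lambda>r. ?P (- r)) (- sb)"
        proof
          assume l: "lower_end (\<lambda>r. ?P (- r)) (- sb)"
          then have "amax \<gamma> (f1 + (- sb) *\<^sub>R (- \<psi>1)) = \<alpha>" "amax \<gamma> (w + (- sb) *\<^sub>R (- \<rho>)) = \<beta>"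
            using stable[of sb] tt by (auto simp: lower_end_def)
          from pencil_extend_below[OF simple_pencil_reverse[OF simp] this] l rev show False by simp
        qed
      qed (use P0 s0 in auto)
      then have hi: "(\<exists>s\<in>{sa..sb}. lower_end (\<lambda>r. ?P (- r)) (- s)) \<longleftrightarrow> \<not> ?P sb"
        by (metis (mono_tags, lifting) atLeastAtMost_iff minus_le_iff minus_minus neg_le_iff_le)
      \<comment> \<open>The normalisation of \<open>\<psi>\<close> pays off here. The ends
        contribute \<open>\<kappa>\<close> times the indicator at \<open>sb\<close> minus the
        indicator at \<open>sa\<close>, since each end exists exactly when the corresponding
        crossing does not.\<close>
      have "\<omega> ((0, 1) # c) = \<kappa>" using \<kappa>[OF zeroE] \<tau> by (simp add: \<psi>_eq isgn_def)
      then show ?thesis using ends by (simp add: J lo hi S3 Pa Pb)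
    qed
  qed
qed

section \<open>Cochains in coordinates\<close>

definition polytopal :: "'a::euclidean_space set set \<Rightarrow> bool"
  where "polytopal X \<longleftrightarrow> finite X \<and> (\<forall>\<gamma>\<in>X. polytope \<gamma> \<and> \<gamma> \<noteq> {}) \<and>
    (\<forall>\<gamma>\<in>X. \<forall>\<delta>. \<delta> face_of \<gamma> \<and> \<delta> \<noteq> {} \<longrightarrow> \<delta> \<in> X)"

text \<open>Fixing one basis and one orientation per cell turns a cochain into a function on cells.
  Everything else about orientations is then an integer sign.\<close>

definition bas :: "'a::euclidean_space set \<Rightarrow> 'a list"
  where "bas \<delta> = (SOME b. ordered_basis (ds \<delta>) b)"

definition std :: "'a::euclidean_space set \<Rightarrow> 'a orientation"
  where "std \<delta> = (SOME \<omega>. \<omega> \<in> orientations (ds \<delta>) \<and> \<omega> (bas \<delta>) = 1)"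

definition val :: "('a::euclidean_space, 's) cochain \<Rightarrow> 'a set \<Rightarrow> 's"
  where "val r \<delta> = r (\<delta>, std \<delta>)"

definition faces :: "'a::euclidean_space set \<Rightarrow> nat \<Rightarrow> 'a set set"
  where "faces \<gamma> p = {\<delta>. \<delta> face_of \<gamma> \<and> \<delta> \<noteq> {} \<and> cell_dim \<delta> = p}"

lemma bas: "ordered_basis (ds \<delta>) (bas \<delta>)"
  unfolding bas_def by (rule someI_ex[OF ordered_basis_exists[OF subspace_ds]])

lemma length_bas: "length (bas \<delta>) = cell_dim \<delta>"
  using ordered_basis_length[OF bas] by (simp add: cell_dim_def)

lemma std: "std \<delta> \<in> orientations (ds \<delta>)" "std \<delta> (bas \<delta>) = 1"
proof -
  have "\<exists>\<omega>. \<omega> \<in> orientations (ds \<delta>) \<and> \<omega> (bas \<delta>) = 1" using orientation_exists[OF bas, of 1] by auto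
  from someI_ex[OF this] show "std \<delta> \<in> orientations (ds \<delta>)" "std \<delta> (bas \<delta>) = 1" by (auto simp: std_def)
qed

lemma finite_faces: "polytope \<gamma> \<Longrightarrow> finite (faces \<gamma> p)"
  by (rule finite_subset[OF _ finite_polytope_faces]) (auto simp: faces_def)

lemma faces_in: "polytopal X \<Longrightarrow> \<gamma> \<in> X \<Longrightarrow> \<delta> \<in> faces \<gamma> p \<Longrightarrow> \<delta> \<in> X \<and> cell_dim \<delta> = p"
  unfolding polytopal_def faces_def by blast

lemma facet_in: "polytopal X \<Longrightarrow> \<gamma> \<in> X \<Longrightarrow> \<delta> facet_of \<gamma> \<Longrightarrow> \<delta> \<in> X"
  unfolding polytopal_def facet_of_def by blast

lemma cochain_value:
  assumes r: "r \<in> cochains X p" and \<delta>: "\<delta> \<in> X" "cell_dim \<delta> = p" and \<omega>: "\<omega> \<in> orientations (ds \<delta>)"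
  shows "r (\<delta>, \<omega>) = zs (\<omega> (bas \<delta>)) (val r \<delta>)"
proof -
  from orientation_sign(1)[OF \<omega> bas] show ?thesis
  proof
    assume *: "\<omega> (bas \<delta>) = 1"
    have "\<omega> = std \<delta>" by (rule orientation_eqI[OF \<omega> std(1) bas]) (simp add: * std(2))
    then show ?thesis by (simp add: val_def std)
  next
    assume *: "\<omega> (bas \<delta>) = - 1"
    have "- \<omega> = std \<delta>" by (rule orientation_eqI[OF orientation_uminus[OF \<omega>] std(1) bas]) (simp add: * std(2))
    moreover have "r (\<delta>, - \<omega>) = - r (\<delta>, \<omega>)" using r \<delta> \<omega> by (auto simp: cochains_def oriented_cells_def)
    ultimately show ?thesis using * by (simp add: val_def zs_minus[of 1, simplified])
  qed
qed

text \<open>Two orientations of one space change sign together under a change of basis; the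
  cross-multiplied form avoids choosing which one is the reference.\<close>

lemma orientation_compare:
  assumes "\<omega>1 \<in> orientations W" "\<omega>2 \<in> orientations W" "ordered_basis W b" "ordered_basis W b'"
  shows "\<omega>1 b * \<omega>2 b' = \<omega>1 b' * \<omega>2 b"
  using orientation_value[OF assms(1,3,4)] orientation_value[OF assms(2,3,4)] by simp

lemma ordered_basis_outward:
  assumes \<mu>: "polytope \<mu>" and fac: "\<delta> facet_of \<mu>" and b: "ordered_basis (ds \<delta>) b"
  shows "ordered_basis (ds \<mu>) (outward \<mu> \<delta> # b)"
proof -
  obtain g where g: "amax \<mu> g = \<delta>" using polytope_face_amax[OF \<mu>, of \<delta>] fac by (auto simp: facet_of_def)
  show ?thesis
  proof (rule ordered_basis_Cons[where \<psi> = g])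
    show "distinct b" "independent (set b)" using b by (auto simp: ordered_basis_def)
    show "set b \<subseteq> ds \<mu>" using ordered_basis_mem[OF b] ds_mono[OF facet_subset[OF fac]] by blast
    show "dim (ds \<mu>) = length b + 1"
      using ordered_basis_length[OF b] fac by (simp add: facet_iff_cell_dim cell_dim_def)
    show "g \<bullet> x = 0" if "x \<in> set b" for x
      using amax_orthogonal[of \<delta> \<mu> g x] g ordered_basis_mem[OF b] that by blast
    show "g \<bullet> outward \<mu> \<delta> \<noteq> 0" using outward_amax[OF fac g[symmetric]] by simp
  qed (use outward_mem[OF fac] in auto)
qed

lemma boundary_orientation_eq:
  "boundary_orientation \<mu> \<delta> \<omega> = (\<lambda>b. if ordered_basis (ds \<delta>) b then \<omega> (outward \<mu> \<delta> # b) else 0)"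
  unfolding boundary_orientation_def outward_def ..

lemma boundary_orientation:
  assumes \<mu>: "polytope \<mu>" and fac: "\<delta> facet_of \<mu>" and \<omega>: "\<omega> \<in> orientations (ds \<mu>)"
  shows "boundary_orientation \<mu> \<delta> \<omega> \<in> orientations (ds \<delta>)"
    and "ordered_basis (ds \<delta>) b \<Longrightarrow> boundary_orientation \<mu> \<delta> \<omega> b = \<omega> (outward \<mu> \<delta> # b)"
proof -
  have "(\<lambda>b. if ordered_basis (ds \<delta>) b then \<omega> ([outward \<mu> \<delta>] @ map (\<lambda>x. x) b @ []) else 0) \<in> orientations (ds \<delta>)"
    by (rule orientation_pullback[OF \<omega>]) (auto simp: linear_ident ordered_basis_outward[OF \<mu> fac])
  then show "boundary_orientation \<mu> \<delta> \<omega> \<in> orientations (ds \<delta>)" by (simp add: boundary_orientation_eq cong: if_cong)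
qed (simp add: boundary_orientation_eq)

section \<open>Coboundary and product in coordinates\<close>

lemma coboundary_value:
  fixes r :: "('a::euclidean_space, 's::ring) cochain"
  assumes X: "polytopal X" and r: "r \<in> cochains X p" and \<mu>: "(\<mu>, \<omega>) \<in> oriented_cells X (Suc p)"
  shows "coboundary X p r (\<mu>, \<omega>) = (\<Sum>\<delta> | \<delta> facet_of \<mu>. zs (\<omega> (outward \<mu> \<delta> # bas \<delta>)) (val r \<delta>))"
proof -
  have \<mu>': "\<mu> \<in> X" "cell_dim \<mu> = Suc p" "\<omega> \<in> orientations (ds \<mu>)" using \<mu> by (auto simp: oriented_cells_def)
  have poly: "polytope \<mu>" using X \<mu>' by (auto simp: polytopal_def)
  have "r (\<delta>, boundary_orientation \<mu> \<delta> \<omega>) = zs (\<omega> (outward \<mu> \<delta> # bas \<delta>)) (val r \<delta>)" if "\<delta> facet_of \<mu>" for \<delta>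
    using cochain_value[OF r facet_in[OF X \<mu>'(1) that] _ boundary_orientation(1)[OF poly that \<mu>'(3)]]
      boundary_orientation(2)[OF poly that \<mu>'(3) bas] that \<mu>'(2) by (simp add: facet_iff_cell_dim)
  then show ?thesis using \<mu> by (simp add: coboundary_def)
qed

lemma coboundary_cochain:
  fixes r :: "('a::euclidean_space, 's::ring) cochain"
  assumes X: "polytopal X" and r: "r \<in> cochains X p"
  shows "coboundary X p r \<in> cochains X (Suc p)"
proof -
  have "coboundary X p r (\<mu>, - \<omega>) = - coboundary X p r (\<mu>, \<omega>)" if \<mu>: "(\<mu>, \<omega>) \<in> oriented_cells X (Suc p)" for \<mu> \<omega>
  proof -
    have \<mu>': "(\<mu>, - \<omega>) \<in> oriented_cells X (Suc p)" using \<mu> orientation_uminus by (auto simp: oriented_cells_def)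
    show ?thesis
      unfolding coboundary_value[OF X r \<mu>] coboundary_value[OF X r \<mu>'] by (simp add: zs_minus sum_negf)
  qed
  then show ?thesis by (auto simp: cochains_def coboundary_def)
qed

lemma product_term_value:
  fixes r s :: "('a::euclidean_space, 's::ring) cochain"
  assumes r: "r \<in> cochains X p" and s: "s \<in> cochains X q"
    and \<delta>: "\<delta> \<in> X" "cell_dim \<delta> = p" and \<eta>: "\<eta> \<in> X" "cell_dim \<eta> = q"
    and sum: "msum (ds \<delta>) (ds \<eta>) = ds \<gamma>" and int: "ds \<delta> \<inter> ds \<eta> = {0}" and \<omega>: "\<omega> \<in> orientations (ds \<gamma>)"
  shows "product_term r s \<gamma> \<omega> \<delta> \<eta> = zs (\<omega> (bas \<delta> @ bas \<eta>)) (val r \<delta> * val s \<eta>)"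
proof -
  have app: "ordered_basis (ds \<gamma>) (b @ b')" if "ordered_basis (ds \<delta>) b" "ordered_basis (ds \<eta>) b'" for b b'
    using ordered_basis_append[OF that int] sum by simp
  let ?P = "\<lambda>\<alpha> \<beta>. \<alpha> \<in> orientations (ds \<delta>) \<and> \<beta> \<in> orientations (ds \<eta>) \<and>
      oriented_direct_sum (ds \<gamma>) \<omega> (ds \<delta>) \<alpha> (ds \<eta>) \<beta>"
  define e where "e = \<omega> (bas \<delta> @ bas \<eta>)"
  have e: "e = 1 \<or> e = - 1" unfolding e_def by (rule orientation_sign(1)[OF \<omega> app[OF bas bas]])
  \<comment> \<open>A witness for the choice in \<open>product_term\<close>: take the reference
    orientation on \<open>\<eta>\<close> and let \<open>\<omega>\<close> dictate the one on
    \<open>\<delta>\<close>.\<close>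
  define \<alpha>0 where "\<alpha>0 = (\<lambda>b. if ordered_basis (ds \<delta>) b then \<omega> (b @ bas \<eta>) else 0)"
  have \<alpha>0: "\<alpha>0 \<in> orientations (ds \<delta>)"
  proof -
    have "(\<lambda>b. if ordered_basis (ds \<delta>) b then \<omega> ([] @ map (\<lambda>x. x) b @ bas \<eta>) else 0) \<in> orientations (ds \<delta>)"
      by (rule orientation_pullback[OF \<omega>]) (auto simp: linear_ident app bas)
    then show ?thesis by (simp add: \<alpha>0_def cong: if_cong)
  qed
  have right: "(\<lambda>b'. if ordered_basis (ds \<eta>) b' then \<omega> (b @ b') else 0) \<in> orientations (ds \<eta>)"
    if "ordered_basis (ds \<delta>) b" for b
  proof -
    have "(\<lambda>b'. if ordered_basis (ds \<eta>) b' then \<omega> (b @ map (\<lambda>x. x) b' @ []) else 0) \<in> orientations (ds \<eta>)"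
      by (rule orientation_pullback[OF \<omega>]) (auto simp: linear_ident app that)
    then show ?thesis by (simp cong: if_cong)
  qed
  have "oriented_direct_sum (ds \<gamma>) \<omega> (ds \<delta>) \<alpha>0 (ds \<eta>) (std \<eta>)"
    unfolding oriented_direct_sum_def
  proof (intro conjI allI impI)
    show "ds \<gamma> = {x + y |x y. x \<in> ds \<delta> \<and> y \<in> ds \<eta>}" using sum by (simp add: msum_def)
    fix b b' assume bb: "ordered_basis (ds \<delta>) b \<and> ordered_basis (ds \<eta>) b'"
    then show "\<omega> (b @ b') = \<alpha>0 b * std \<eta> b'"
      using orientation_compare[OF right[OF conjunct1[OF bb]] std(1) bas conjunct2[OF bb]]
      by (simp add: \<alpha>0_def bas std)
  qed (rule int)
  then have ex: "\<exists>z. case z of (\<alpha>, \<beta>) \<Rightarrow> ?P \<alpha> \<beta>" using \<alpha>0 std by (intro exI[of _ "(\<alpha>0, std \<eta>)"]) simp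
  obtain \<alpha> \<beta> where ab: "(SOME (\<alpha>, \<beta>). ?P \<alpha> \<beta>) = (\<alpha>, \<beta>)" by (cases "SOME (\<alpha>, \<beta>). ?P \<alpha> \<beta>") auto
  have "?P \<alpha> \<beta>" using someI_ex[OF ex] unfolding ab by simp
  \<comment> \<open>Whatever pair was chosen, only the product of its two signs enters, and
    compatibility with \<open>\<omega>\<close> fixes that product.\<close>
  then have P: "\<alpha> \<in> orientations (ds \<delta>)" "\<beta> \<in> orientations (ds \<eta>)" "\<alpha> (bas \<delta>) * \<beta> (bas \<eta>) = e"
    using bas[of \<delta>] bas[of \<eta>] unfolding oriented_direct_sum_def e_def by auto
  have "product_term r s \<gamma> \<omega> \<delta> \<eta> = r (\<delta>, \<alpha>) * s (\<eta>, \<beta>)"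
    unfolding product_term_def ab by simp
  also have "\<dots> = zs e (val r \<delta> * val s \<eta>)"
    unfolding cochain_value[OF r \<delta> P(1)] cochain_value[OF s \<eta> P(2)]
    by (simp add: zs_mult_left zs_mult_right zs_zs mult.commute P(3)[symmetric])
  finally show ?thesis by (simp add: e_def)
qed

section \<open>Rearranging sums over pairs of faces\<close>

lemma sum_swap_pairs:
  assumes "finite A" "finite B" "finite C"
  shows "(\<Sum>z\<in>{z \<in> A \<times> B. R z}. \<Sum>x\<in>{x \<in> C. Q x z}. f x z) =
    (\<Sum>x\<in>C. \<Sum>z\<in>{z \<in> A \<times> B. R z \<and> Q x z}. f x z)"
proof -
  have "(\<Sum>z\<in>{z \<in> A \<times> B. R z}. \<Sum>x\<in>{x \<in> C. Q x z}. f x z) =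
      (\<Sum>x\<in>C. \<Sum>z\<in>{z \<in> {z \<in> A \<times> B. R z}. Q x z}. f x z)"
    by (rule sum.swap_restrict) (use assms in auto)
  then show ?thesis by (simp add: conj_assoc)
qed

text \<open>Expanding the coboundary and exchanging sums sorts the terms by the small pair
  \<open>(\<alpha>, \<beta>)\<close>, with \<open>A\<close> running over the cells that have
  \<open>\<alpha>\<close> as a facet. The relation \<open>R\<close> and the embeddings are left
  open: \<open>dpair\<close> with identities gives the Leibniz rule, \<open>hpair\<close> with
  shears the homotopy.\<close>

lemma coboundary_left_sum:
  fixes r :: "('a::euclidean_space, 's::ring) cochain" and T1 T2 :: "'a \<Rightarrow> 'e::euclidean_space"
  assumes X: "polytopal X" and \<gamma>: "\<gamma> \<in> X" and r: "r \<in> cochains X p"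
    and T: "linear T1" "inj T1" and \<omega>: "\<omega> \<in> orientations E"
    and bases: "\<And>\<delta> \<eta> b. \<delta> \<in> faces \<gamma> (Suc p) \<Longrightarrow> \<eta> \<in> faces \<gamma> q \<Longrightarrow> R \<delta> \<eta> \<Longrightarrow> ordered_basis (ds \<delta>) b \<Longrightarrow>
      ordered_basis E (map T1 b @ map T2 (bas \<eta>))"
  shows "(\<Sum>(\<delta>, \<eta>) | \<delta> \<in> faces \<gamma> (Suc p) \<and> \<eta> \<in> faces \<gamma> q \<and> R \<delta> \<eta>.
      zs (\<omega> (map T1 (bas \<delta>) @ map T2 (bas \<eta>))) (val (coboundary X p r) \<delta> * y \<eta>)) =
    (\<Sum>(\<alpha>, \<beta>)\<in>faces \<gamma> p \<times> faces \<gamma> q. zs (\<Sum>A | A face_of \<gamma> \<and> \<alpha> facet_of A \<and> R A \<beta>.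
      \<omega> (T1 (outward A \<alpha>) # map T1 (bas \<alpha>) @ map T2 (bas \<beta>))) (val r \<alpha> * y \<beta>))"
proof -
  have poly: "polytope \<gamma>" using X \<gamma> by (auto simp: polytopal_def)
  note fin = finite_faces[OF poly]
  let ?g = "\<lambda>\<delta> \<alpha> \<eta>. zs (\<omega> (T1 (outward \<delta> \<alpha>) # map T1 (bas \<alpha>) @ map T2 (bas \<eta>))) (val r \<alpha> * y \<eta>)"
  have facets: "{\<alpha>. \<alpha> facet_of \<delta>} = {\<alpha> \<in> faces \<gamma> p. \<alpha> facet_of \<delta>}" if "\<delta> \<in> faces \<gamma> (Suc p)" for \<delta>
    using that by (auto simp: faces_def facet_iff_cell_dim intro: face_of_trans)
  have "zs (\<omega> (map T1 (bas \<delta>) @ map T2 (bas \<eta>))) (val (coboundary X p r) \<delta> * y \<eta>) =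
      (\<Sum>\<alpha>\<in>{\<alpha> \<in> faces \<gamma> p. \<alpha> facet_of \<delta>}. ?g \<delta> \<alpha> \<eta>)"
    if \<delta>\<eta>: "\<delta> \<in> faces \<gamma> (Suc p)" "\<eta> \<in> faces \<gamma> q" "R \<delta> \<eta>" for \<delta> \<eta>
  proof -
    have \<delta>: "\<delta> \<in> X" "cell_dim \<delta> = Suc p" using faces_in[OF X \<gamma> \<delta>\<eta>(1)] by auto
    have p\<delta>: "polytope \<delta>" using X \<delta> by (auto simp: polytopal_def)
    have pull: "(\<lambda>b. if ordered_basis (ds \<delta>) b then \<omega> ([] @ map T1 b @ map T2 (bas \<eta>)) else 0) \<in> orientations (ds \<delta>)"
      by (rule orientation_pullback[OF \<omega> T(1) inj_on_subset[OF T(2) subset_UNIV]]) (use bases[OF \<delta>\<eta>] in simp)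
    \<comment> \<open>The pulled-back orientation and \<open>std \<delta>\<close> are compared at
      the bases \<open>bas \<delta>\<close> and
      \<open>outward \<delta> \<alpha> # bas \<alpha>\<close>; at the first of them
      \<open>std \<delta>\<close> is 1.\<close>
    have sgn: "\<omega> (map T1 (bas \<delta>) @ map T2 (bas \<eta>)) * std \<delta> (outward \<delta> \<alpha> # bas \<alpha>) =
        \<omega> (T1 (outward \<delta> \<alpha>) # map T1 (bas \<alpha>) @ map T2 (bas \<eta>))" if \<alpha>: "\<alpha> facet_of \<delta>" for \<alpha>
      using orientation_compare[OF pull std(1) bas ordered_basis_outward[OF p\<delta> \<alpha> bas]]
      by (simp add: bas std ordered_basis_outward[OF p\<delta> \<alpha> bas])
    have "val (coboundary X p r) \<delta> = (\<Sum>\<alpha> | \<alpha> facet_of \<delta>. zs (std \<delta> (outward \<delta> \<alpha> # bas \<alpha>)) (val r \<alpha>))"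
      unfolding val_def[of "coboundary X p r"] using \<delta> std
      by (intro coboundary_value[OF X r]) (auto simp: oriented_cells_def)
    then have "zs (\<omega> (map T1 (bas \<delta>) @ map T2 (bas \<eta>))) (val (coboundary X p r) \<delta> * y \<eta>) =
        (\<Sum>\<alpha> | \<alpha> facet_of \<delta>. ?g \<delta> \<alpha> \<eta>)"
      by (simp add: sum_distrib_right zs_arg_sum zs_mult_left zs_zs sgn)
    then show ?thesis using facets[OF \<delta>\<eta>(1)] by simp
  qed
  then have "(\<Sum>(\<delta>, \<eta>) | \<delta> \<in> faces \<gamma> (Suc p) \<and> \<eta> \<in> faces \<gamma> q \<and> R \<delta> \<eta>.
      zs (\<omega> (map T1 (bas \<delta>) @ map T2 (bas \<eta>))) (val (coboundary X p r) \<delta> * y \<eta>)) =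
    (\<Sum>z\<in>{z \<in> faces \<gamma> (Suc p) \<times> faces \<gamma> q. R (fst z) (snd z)}.
      \<Sum>\<alpha>\<in>{\<alpha> \<in> faces \<gamma> p. \<alpha> facet_of fst z}. ?g (fst z) \<alpha> (snd z))"
    by (intro sum.cong) auto
  also have "\<dots> = (\<Sum>\<alpha>\<in>faces \<gamma> p. \<Sum>z\<in>{z \<in> faces \<gamma> (Suc p) \<times> faces \<gamma> q. R (fst z) (snd z) \<and> \<alpha> facet_of fst z}.
      ?g (fst z) \<alpha> (snd z))"
    by (rule sum_swap_pairs[OF fin fin fin])
  also have "\<dots> = (\<Sum>\<alpha>\<in>faces \<gamma> p. \<Sum>\<beta>\<in>faces \<gamma> q. \<Sum>A | A face_of \<gamma> \<and> \<alpha> facet_of A \<and> R A \<beta>. ?g A \<alpha> \<beta>)"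
  proof (rule sum.cong[OF refl])
    fix \<alpha> assume \<alpha>: "\<alpha> \<in> faces \<gamma> p"
    have eq: "{A. A face_of \<gamma> \<and> \<alpha> facet_of A \<and> R A \<beta>} = {A \<in> faces \<gamma> (Suc p). \<alpha> facet_of A \<and> R A \<beta>}" for \<beta>
      using \<alpha> facet_subset by (auto simp: faces_def facet_iff_cell_dim)
    have "{z \<in> faces \<gamma> (Suc p) \<times> faces \<gamma> q. R (fst z) (snd z) \<and> \<alpha> facet_of fst z} =
        (\<lambda>(\<beta>, A). (A, \<beta>)) ` (SIGMA \<beta>:faces \<gamma> q. {A \<in> faces \<gamma> (Suc p). \<alpha> facet_of A \<and> R A \<beta>})"
      by (auto simp: image_iff)
    then have "(\<Sum>z\<in>{z \<in> faces \<gamma> (Suc p) \<times> faces \<gamma> q. R (fst z) (snd z) \<and> \<alpha> facet_of fst z}. ?g (fst z) \<alpha> (snd z)) =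
        (\<Sum>(\<beta>, A)\<in>(SIGMA \<beta>:faces \<gamma> q. {A \<in> faces \<gamma> (Suc p). \<alpha> facet_of A \<and> R A \<beta>}). ?g A \<alpha> \<beta>)"
      by (simp add: sum.reindex inj_on_def case_prod_beta)
    also have "\<dots> = (\<Sum>\<beta>\<in>faces \<gamma> q. \<Sum>A\<in>{A \<in> faces \<gamma> (Suc p). \<alpha> facet_of A \<and> R A \<beta>}. ?g A \<alpha> \<beta>)"
      by (rule sum.Sigma[symmetric]) (use fin in auto)
    finally show "(\<Sum>z\<in>{z \<in> faces \<gamma> (Suc p) \<times> faces \<gamma> q. R (fst z) (snd z) \<and> \<alpha> facet_of fst z}. ?g (fst z) \<alpha> (snd z)) =
        (\<Sum>\<beta>\<in>faces \<gamma> q. \<Sum>A | A face_of \<gamma> \<and> \<alpha> facet_of A \<and> R A \<beta>. ?g A \<alpha> \<beta>)"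
      unfolding eq .
  qed
  also have "\<dots> = (\<Sum>(\<alpha>, \<beta>)\<in>faces \<gamma> p \<times> faces \<gamma> q. zs (\<Sum>A | A face_of \<gamma> \<and> \<alpha> facet_of A \<and> R A \<beta>.
      \<omega> (T1 (outward A \<alpha>) # map T1 (bas \<alpha>) @ map T2 (bas \<beta>))) (val r \<alpha> * y \<beta>))"
    by (simp add: sum.cartesian_product zs_sum)
  finally show ?thesis .
qed

text \<open>Compared with the left factor, the outward vector now stands behind the basis of the
  \<open>p\<close>-dimensional face; moving it to the front gives the sign.\<close>

lemma coboundary_right_sum:
  fixes s :: "('a::euclidean_space, 's::ring) cochain" and T1 T2 :: "'a \<Rightarrow> 'e::euclidean_space"
  assumes X: "polytopal X" and \<gamma>: "\<gamma> \<in> X" and s: "s \<in> cochains X q"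
    and T: "linear T2" "inj T2" and \<omega>: "\<omega> \<in> orientations E"
    and bases: "\<And>\<delta> \<eta> b. \<delta> \<in> faces \<gamma> p \<Longrightarrow> \<eta> \<in> faces \<gamma> (Suc q) \<Longrightarrow> R \<delta> \<eta> \<Longrightarrow> ordered_basis (ds \<eta>) b \<Longrightarrow>
      ordered_basis E (map T1 (bas \<delta>) @ map T2 b)"
  shows "(\<Sum>(\<delta>, \<eta>) | \<delta> \<in> faces \<gamma> p \<and> \<eta> \<in> faces \<gamma> (Suc q) \<and> R \<delta> \<eta>.
      zs (\<omega> (map T1 (bas \<delta>) @ map T2 (bas \<eta>))) (y \<delta> * val (coboundary X q s) \<eta>)) =
    (\<Sum>(\<alpha>, \<beta>)\<in>faces \<gamma> p \<times> faces \<gamma> q. zs ((- 1) ^ p * (\<Sum>B | B face_of \<gamma> \<and> \<beta> facet_of B \<and> R \<alpha> B.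
      \<omega> (T2 (outward B \<beta>) # map T1 (bas \<alpha>) @ map T2 (bas \<beta>)))) (y \<alpha> * val s \<beta>))"
proof -
  have poly: "polytope \<gamma>" using X \<gamma> by (auto simp: polytopal_def)
  note fin = finite_faces[OF poly]
  let ?g = "\<lambda>\<eta> \<beta> \<delta>. zs ((- 1) ^ p * \<omega> (T2 (outward \<eta> \<beta>) # map T1 (bas \<delta>) @ map T2 (bas \<beta>))) (y \<delta> * val s \<beta>)"
  have facets: "{\<beta>. \<beta> facet_of \<eta>} = {\<beta> \<in> faces \<gamma> q. \<beta> facet_of \<eta>}" if "\<eta> \<in> faces \<gamma> (Suc q)" for \<eta>
    using that by (auto simp: faces_def facet_iff_cell_dim intro: face_of_trans)
  have "zs (\<omega> (map T1 (bas \<delta>) @ map T2 (bas \<eta>))) (y \<delta> * val (coboundary X q s) \<eta>) =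
      (\<Sum>\<beta>\<in>{\<beta> \<in> faces \<gamma> q. \<beta> facet_of \<eta>}. ?g \<eta> \<beta> \<delta>)"
    if \<delta>\<eta>: "\<delta> \<in> faces \<gamma> p" "\<eta> \<in> faces \<gamma> (Suc q)" "R \<delta> \<eta>" for \<delta> \<eta>
  proof -
    have \<eta>: "\<eta> \<in> X" "cell_dim \<eta> = Suc q" using faces_in[OF X \<gamma> \<delta>\<eta>(2)] by auto
    have len: "length (bas \<delta>) = p" using \<delta>\<eta>(1) by (simp add: length_bas faces_def)
    have p\<eta>: "polytope \<eta>" using X \<eta> by (auto simp: polytopal_def)
    have pull: "(\<lambda>b. if ordered_basis (ds \<eta>) b then \<omega> (map T1 (bas \<delta>) @ map T2 b @ []) else 0) \<in> orientations (ds \<eta>)"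
      by (rule orientation_pullback[OF \<omega> T(1) inj_on_subset[OF T(2) subset_UNIV]]) (use bases[OF \<delta>\<eta>] in simp)
    have sgn: "\<omega> (map T1 (bas \<delta>) @ map T2 (bas \<eta>)) * std \<eta> (outward \<eta> \<beta> # bas \<beta>) =
        (- 1) ^ p * \<omega> (T2 (outward \<eta> \<beta>) # map T1 (bas \<delta>) @ map T2 (bas \<beta>))" if \<beta>: "\<beta> facet_of \<eta>" for \<beta>
      using orientation_compare[OF pull std(1) bas ordered_basis_outward[OF p\<eta> \<beta> bas]]
        orientation_move_front[OF \<omega>, of "map T1 (bas \<delta>)" "T2 (outward \<eta> \<beta>)" "map T2 (bas \<beta>)"]
      by (simp add: bas std ordered_basis_outward[OF p\<eta> \<beta> bas] len)
    have "val (coboundary X q s) \<eta> = (\<Sum>\<beta> | \<beta> facet_of \<eta>. zs (std \<eta> (outward \<eta> \<beta> # bas \<beta>)) (val s \<beta>))"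
      unfolding val_def[of "coboundary X q s"] using \<eta> std
      by (intro coboundary_value[OF X s]) (auto simp: oriented_cells_def)
    then have "zs (\<omega> (map T1 (bas \<delta>) @ map T2 (bas \<eta>))) (y \<delta> * val (coboundary X q s) \<eta>) =
        (\<Sum>\<beta> | \<beta> facet_of \<eta>. ?g \<eta> \<beta> \<delta>)"
      by (simp add: sum_distrib_left zs_arg_sum zs_mult_right zs_zs sgn)
    then show ?thesis using facets[OF \<delta>\<eta>(2)] by simp
  qed
  then have "(\<Sum>(\<delta>, \<eta>) | \<delta> \<in> faces \<gamma> p \<and> \<eta> \<in> faces \<gamma> (Suc q) \<and> R \<delta> \<eta>.
      zs (\<omega> (map T1 (bas \<delta>) @ map T2 (bas \<eta>))) (y \<delta> * val (coboundary X q s) \<eta>)) =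
    (\<Sum>z\<in>{z \<in> faces \<gamma> p \<times> faces \<gamma> (Suc q). R (fst z) (snd z)}.
      \<Sum>\<beta>\<in>{\<beta> \<in> faces \<gamma> q. \<beta> facet_of snd z}. ?g (snd z) \<beta> (fst z))"
    by (intro sum.cong) auto
  also have "\<dots> = (\<Sum>\<beta>\<in>faces \<gamma> q. \<Sum>z\<in>{z \<in> faces \<gamma> p \<times> faces \<gamma> (Suc q). R (fst z) (snd z) \<and> \<beta> facet_of snd z}.
      ?g (snd z) \<beta> (fst z))"
    by (rule sum_swap_pairs[OF fin fin fin])
  also have "\<dots> = (\<Sum>\<beta>\<in>faces \<gamma> q. \<Sum>\<alpha>\<in>faces \<gamma> p. \<Sum>B | B face_of \<gamma> \<and> \<beta> facet_of B \<and> R \<alpha> B. ?g B \<beta> \<alpha>)"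
  proof (rule sum.cong[OF refl])
    fix \<beta> assume \<beta>: "\<beta> \<in> faces \<gamma> q"
    have eq: "{B. B face_of \<gamma> \<and> \<beta> facet_of B \<and> R \<alpha> B} = {B \<in> faces \<gamma> (Suc q). \<beta> facet_of B \<and> R \<alpha> B}" for \<alpha>
      using \<beta> facet_subset by (auto simp: faces_def facet_iff_cell_dim)
    have "{z \<in> faces \<gamma> p \<times> faces \<gamma> (Suc q). R (fst z) (snd z) \<and> \<beta> facet_of snd z} =
        (SIGMA \<alpha>:faces \<gamma> p. {B \<in> faces \<gamma> (Suc q). \<beta> facet_of B \<and> R \<alpha> B})"
      by auto
    then have "(\<Sum>z\<in>{z \<in> faces \<gamma> p \<times> faces \<gamma> (Suc q). R (fst z) (snd z) \<and> \<beta> facet_of snd z}. ?g (snd z) \<beta> (fst z)) =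
        (\<Sum>(\<alpha>, B)\<in>(SIGMA \<alpha>:faces \<gamma> p. {B \<in> faces \<gamma> (Suc q). \<beta> facet_of B \<and> R \<alpha> B}). ?g B \<beta> \<alpha>)"
      by (simp add: case_prod_beta)
    also have "\<dots> = (\<Sum>\<alpha>\<in>faces \<gamma> p. \<Sum>B\<in>{B \<in> faces \<gamma> (Suc q). \<beta> facet_of B \<and> R \<alpha> B}. ?g B \<beta> \<alpha>)"
      by (rule sum.Sigma[symmetric]) (use fin in auto)
    finally show "(\<Sum>z\<in>{z \<in> faces \<gamma> p \<times> faces \<gamma> (Suc q). R (fst z) (snd z) \<and> \<beta> facet_of snd z}. ?g (snd z) \<beta> (fst z)) =
        (\<Sum>\<alpha>\<in>faces \<gamma> p. \<Sum>B | B face_of \<gamma> \<and> \<beta> facet_of B \<and> R \<alpha> B. ?g B \<beta> \<alpha>)"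
      unfolding eq .
  qed
  also have "\<dots> = (\<Sum>\<alpha>\<in>faces \<gamma> p. \<Sum>\<beta>\<in>faces \<gamma> q. \<Sum>B | B face_of \<gamma> \<and> \<beta> facet_of B \<and> R \<alpha> B. ?g B \<beta> \<alpha>)"
    by (rule sum.swap)
  also have "\<dots> = (\<Sum>(\<alpha>, \<beta>)\<in>faces \<gamma> p \<times> faces \<gamma> q. zs ((- 1) ^ p * (\<Sum>B | B face_of \<gamma> \<and> \<beta> facet_of B \<and> R \<alpha> B.
      \<omega> (T2 (outward B \<beta>) # map T1 (bas \<alpha>) @ map T2 (bas \<beta>)))) (y \<alpha> * val s \<beta>))"
    by (simp add: sum.cartesian_product zs_sum sum_distrib_left)
  finally show ?thesis .
qed

text \<open>The faces of a facet are the faces of \<open>\<gamma>\<close> contained in it, so the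
  pairs can be indexed by \<open>\<gamma>\<close> alone before the sums are exchanged.\<close>

lemma facet_sum:
  fixes x y :: "'a::euclidean_space set \<Rightarrow> 's::ring"
  assumes \<gamma>: "polytope \<gamma>"
  shows "(\<Sum>\<mu> | \<mu> facet_of \<gamma>. \<Sum>(\<alpha>, \<beta>) | \<alpha> \<in> faces \<mu> p \<and> \<beta> \<in> faces \<mu> q \<and> R \<mu> \<alpha> \<beta>. zs (g \<mu> \<alpha> \<beta>) (x \<alpha> * y \<beta>)) =
    (\<Sum>(\<alpha>, \<beta>)\<in>faces \<gamma> p \<times> faces \<gamma> q.
      zs (\<Sum>\<mu> | \<mu> facet_of \<gamma> \<and> \<alpha> \<subseteq> \<mu> \<and> \<beta> \<subseteq> \<mu> \<and> R \<mu> \<alpha> \<beta>. g \<mu> \<alpha> \<beta>) (x \<alpha> * y \<beta>))"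
proof -
  have sub: "faces \<mu> k = {\<delta> \<in> faces \<gamma> k. \<delta> \<subseteq> \<mu>}" if \<mu>: "\<mu> facet_of \<gamma>" for \<mu> k
    using face_of_subset[OF _ _ facet_subset[OF \<mu>]] \<mu>
    by (auto simp: faces_def facet_of_def dest: face_of_imp_subset intro: face_of_trans)
  have fin: "finite {\<mu>. \<mu> facet_of \<gamma>}"
    by (rule finite_subset[OF _ finite_polytope_faces[OF \<gamma>]]) (auto simp: facet_of_def)
  have "(\<Sum>\<mu> | \<mu> facet_of \<gamma>. \<Sum>(\<alpha>, \<beta>) | \<alpha> \<in> faces \<mu> p \<and> \<beta> \<in> faces \<mu> q \<and> R \<mu> \<alpha> \<beta>. zs (g \<mu> \<alpha> \<beta>) (x \<alpha> * y \<beta>)) =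
      (\<Sum>\<mu>\<in>{\<mu>. \<mu> facet_of \<gamma>}. \<Sum>z\<in>{z \<in> faces \<gamma> p \<times> faces \<gamma> q. fst z \<subseteq> \<mu> \<and> snd z \<subseteq> \<mu> \<and> R \<mu> (fst z) (snd z)}.
        zs (g \<mu> (fst z) (snd z)) (x (fst z) * y (snd z)))"
    by (intro sum.cong refl) (auto simp: sub)
  also have "\<dots> = (\<Sum>z\<in>faces \<gamma> p \<times> faces \<gamma> q. \<Sum>\<mu>\<in>{\<mu> \<in> {\<mu>. \<mu> facet_of \<gamma>}. fst z \<subseteq> \<mu> \<and> snd z \<subseteq> \<mu> \<and> R \<mu> (fst z) (snd z)}.
        zs (g \<mu> (fst z) (snd z)) (x (fst z) * y (snd z)))"
    by (rule sum.swap_restrict[OF fin]) (simp add: finite_faces[OF \<gamma>])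
  also have "\<dots> = (\<Sum>(\<alpha>, \<beta>)\<in>faces \<gamma> p \<times> faces \<gamma> q.
      zs (\<Sum>\<mu> | \<mu> facet_of \<gamma> \<and> \<alpha> \<subseteq> \<mu> \<and> \<beta> \<subseteq> \<mu> \<and> R \<mu> \<alpha> \<beta>. g \<mu> \<alpha> \<beta>) (x \<alpha> * y \<beta>))"
    by (intro sum.cong refl) (auto simp: zs_sum)
  finally show ?thesis .
qed

section \<open>The Leibniz rule\<close>

lemma dual_space_inner:
  fixes W :: "'a::euclidean_space set"
  assumes W: "subspace W" and w: "w \<in> dual_space W"
  obtains a where "\<And>x. x \<in> W \<Longrightarrow> w x = a \<bullet> x"
proof -
  obtain B where B: "B \<subseteq> W" "independent B" "W \<subseteq> span B" by (metis basis_exists)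
  obtain g where g: "linear g" "\<forall>x\<in>B. g x = w x" using linear_independent_extend[OF B(2)] by blast
  have add: "w (x + y) = w x + w y" and scale: "w (c *\<^sub>R x) = c * w x" if "x \<in> W" "y \<in> W" for x y c
    using w that by (auto simp: dual_space_def)
  have w0: "w 0 = 0" using scale[of 0 0 0] subspace_0[OF W] by simp
  have "subspace {x \<in> W. g x = w x}"
    unfolding subspace_def
    using subspace_0[OF W] subspace_add[OF W] subspace_scale[OF W] w0
    by (auto simp: linear_0[OF g(1)] linear_add[OF g(1)] linear_scale[OF g(1)] add scale)
  then have "span B \<subseteq> {x \<in> W. g x = w x}" using B(1) g(2) by (intro span_minimal) auto
  then have eq: "w x = g x" if "x \<in> W" for x using B(3) that by auto
  have "g x = adjoint g 1 \<bullet> x" for x using adjoint_works[OF g(1), of x 1] by (simp add: inner_commute)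
  then show ?thesis using that eq by auto
qed

lemma dual_space_inner_mem:
  "subspace W \<Longrightarrow> (\<lambda>x. if x \<in> W then a \<bullet> x else 0) \<in> dual_space W"
  by (auto simp: dual_space_def subspace_add subspace_scale inner_add_right)

text \<open>The base point of the translation cancels from the inequality. Non-emptiness of
  \<open>\<gamma>\<close> guarantees that there is a base point; otherwise the cone condition would
  be vacuous.\<close>

lemma dual_cone_iff_amax:
  fixes \<gamma> :: "'a::euclidean_space set"
  assumes "\<delta> \<subseteq> \<gamma>" and "\<And>x. x \<in> ds \<gamma> \<Longrightarrow> w x = b \<bullet> x" and "w \<in> dual_space (ds \<gamma>)" and "\<gamma> \<noteq> {}"
  shows "w \<in> dual_cone \<gamma> \<delta> \<longleftrightarrow> \<delta> \<subseteq> amax \<gamma> b"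
proof -
  have "w (x - a) \<le> w (y - a) \<longleftrightarrow> b \<bullet> x \<le> b \<bullet> y" if "a \<in> \<gamma>" "x \<in> \<gamma>" "y \<in> \<delta>" for a x y
  proof -
    have "w (x - a) = b \<bullet> x - b \<bullet> a" "w (y - a) = b \<bullet> y - b \<bullet> a"
      using assms(2)[OF ds_diff] that assms(1) by (auto simp: inner_diff_right)
    then show ?thesis by simp
  qed
  then show ?thesis using assms(1,3,4) by (auto simp: dual_cone_def amax_def)
qed

lemma dual_cones_meet_iff:
  fixes \<gamma> :: "'a::euclidean_space set"
  assumes sub: "\<delta> \<subseteq> \<gamma>" "\<eta> \<subseteq> \<gamma>" and v: "\<And>x. x \<in> ds \<gamma> \<Longrightarrow> v x = a \<bullet> x" and ne: "\<gamma> \<noteq> {}"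
  shows "(+) (restrict_dual \<gamma> v) ` dual_cone \<gamma> \<delta> \<inter> dual_cone \<gamma> \<eta> \<noteq> {} \<longleftrightarrow> dpair \<gamma> a \<delta> \<eta>"
proof
  assume "(+) (restrict_dual \<gamma> v) ` dual_cone \<gamma> \<delta> \<inter> dual_cone \<gamma> \<eta> \<noteq> {}"
  then obtain w where w: "w \<in> dual_cone \<gamma> \<delta>" "restrict_dual \<gamma> v + w \<in> dual_cone \<gamma> \<eta>" by auto
  have wd: "w \<in> dual_space (ds \<gamma>)" "restrict_dual \<gamma> v + w \<in> dual_space (ds \<gamma>)"
    using w by (auto simp: dual_cone_def)
  obtain b where b: "\<And>x. x \<in> ds \<gamma> \<Longrightarrow> w x = b \<bullet> x" using dual_space_inner[OF subspace_ds wd(1)] by blast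
  have ab: "(restrict_dual \<gamma> v + w) x = (a + b) \<bullet> x" if "x \<in> ds \<gamma>" for x
    using that v b by (simp add: restrict_dual_def inner_add_left)
  have "\<delta> \<subseteq> amax \<gamma> b" using dual_cone_iff_amax[OF sub(1) b wd(1) ne] w(1) by simp
  moreover have "\<eta> \<subseteq> amax \<gamma> (a + b)" using dual_cone_iff_amax[OF sub(2) ab wd(2) ne] w(2) by simp
  ultimately show "dpair \<gamma> a \<delta> \<eta>" unfolding dpair_def by (intro exI[of _ "a + b"]) simp
next
  assume "dpair \<gamma> a \<delta> \<eta>"
  then obtain b where b: "\<delta> \<subseteq> amax \<gamma> (b - a)" "\<eta> \<subseteq> amax \<gamma> b" by (auto simp: dpair_def)
  define w1 w2 where "w1 = (\<lambda>x. if x \<in> ds \<gamma> then (b - a) \<bullet> x else 0)" and "w2 = (\<lambda>x. if x \<in> ds \<gamma> then b \<bullet> x else 0)"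
  have "w1 \<in> dual_cone \<gamma> \<delta>"
    using dual_cone_iff_amax[OF sub(1) _ dual_space_inner_mem[OF subspace_ds] ne, of "b - a" "b - a"] b by (simp add: w1_def)
  moreover have "w2 \<in> dual_cone \<gamma> \<eta>"
    using dual_cone_iff_amax[OF sub(2) _ dual_space_inner_mem[OF subspace_ds] ne, of b b] b by (simp add: w2_def)
  moreover have "restrict_dual \<gamma> v + w1 = w2"
    using v by (auto simp: restrict_dual_def w1_def w2_def inner_diff_left fun_eq_iff)
  ultimately show "(+) (restrict_dual \<gamma> v) ` dual_cone \<gamma> \<delta> \<inter> dual_cone \<gamma> \<eta> \<noteq> {}" by blast
qed

lemma product_pairs_eq:
  fixes \<gamma> :: "'a::euclidean_space set"
  assumes v: "\<And>x. x \<in> ds \<gamma> \<Longrightarrow> v x = a \<bullet> x" and ne: "\<gamma> \<noteq> {}"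
  shows "product_pairs p q \<gamma> v = {(\<delta>, \<eta>). \<delta> \<in> faces \<gamma> p \<and> \<eta> \<in> faces \<gamma> q \<and> dpair \<gamma> a \<delta> \<eta>}"
  using dual_cones_meet_iff[OF _ _ v ne] unfolding product_pairs_def faces_def
  by (auto dest: face_of_imp_subset)

lemma adm_direct_sum:
  assumes adm: "adm \<gamma> a" and d: "cell_dim \<gamma> = p + q"
    and f: "\<delta> \<in> faces \<gamma> p" "\<eta> \<in> faces \<gamma> q" "dpair \<gamma> a \<delta> \<eta>"
  shows "ds \<delta> \<inter> ds \<eta> = {0}" "msum (ds \<delta>) (ds \<eta>) = ds \<gamma>"
proof -
  show int: "ds \<delta> \<inter> ds \<eta> = {0}" using admD[OF adm f(3)] f d by (auto simp: faces_def)
  have "\<delta> \<subseteq> \<gamma>" "\<eta> \<subseteq> \<gamma>" using f by (auto simp: faces_def dest: face_of_imp_subset)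
  then have "msum (ds \<delta>) (ds \<eta>) \<subseteq> ds \<gamma>" by (intro msum_subset subspace_ds ds_mono)
  moreover have "dim (msum (ds \<delta>) (ds \<eta>)) = dim (ds \<gamma>)"
    using dim_msum[OF subspace_ds subspace_ds int] f d by (simp add: faces_def cell_dim_def)
  ultimately show "msum (ds \<delta>) (ds \<eta>) = ds \<gamma>"
    by (intro subspace_dim_equal subspace_msum subspace_ds) auto
qed

lemma cochain_product_value:
  fixes r s :: "('a::euclidean_space, 's::ring) cochain"
  assumes X: "polytopal X" and v: "\<And>x. x \<in> ds \<gamma> \<Longrightarrow> v x = a \<bullet> x" and adm: "adm \<gamma> a"
    and r: "r \<in> cochains X p" and s: "s \<in> cochains X q" and \<gamma>: "(\<gamma>, \<omega>) \<in> oriented_cells X (p + q)"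
  shows "cochain_product X v p q r s (\<gamma>, \<omega>) =
    (\<Sum>(\<delta>, \<eta>) | \<delta> \<in> faces \<gamma> p \<and> \<eta> \<in> faces \<gamma> q \<and> dpair \<gamma> a \<delta> \<eta>. zs (\<omega> (bas \<delta> @ bas \<eta>)) (val r \<delta> * val s \<eta>))"
proof -
  have \<gamma>': "\<gamma> \<in> X" "cell_dim \<gamma> = p + q" "\<omega> \<in> orientations (ds \<gamma>)" using \<gamma> by (auto simp: oriented_cells_def)
  have ne: "\<gamma> \<noteq> {}" using X \<gamma>' by (auto simp: polytopal_def)
  have "product_term r s \<gamma> \<omega> \<delta> \<eta> = zs (\<omega> (bas \<delta> @ bas \<eta>)) (val r \<delta> * val s \<eta>)"
    if f: "\<delta> \<in> faces \<gamma> p" "\<eta> \<in> faces \<gamma> q" "dpair \<gamma> a \<delta> \<eta>" for \<delta> \<eta>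
    using faces_in[OF X \<gamma>'(1) f(1)] faces_in[OF X \<gamma>'(1) f(2)] adm_direct_sum[OF adm \<gamma>'(2) f]
    by (intro product_term_value[OF r s _ _ _ _ _ _ \<gamma>'(3)]) auto
  then show ?thesis
    using \<gamma> by (auto simp: cochain_product_def product_pairs_eq[OF v ne] intro!: sum.cong)
qed

lemma cochain_product_cochain:
  fixes r s :: "('a::euclidean_space, 's::ring) cochain"
  assumes X: "polytopal X" and v: "\<And>\<gamma> x. \<gamma> \<in> X \<Longrightarrow> x \<in> ds \<gamma> \<Longrightarrow> v x = a \<bullet> x" and adm: "\<And>\<gamma>. \<gamma> \<in> X \<Longrightarrow> adm \<gamma> a"
    and r: "r \<in> cochains X p" and s: "s \<in> cochains X q"
  shows "cochain_product X v p q r s \<in> cochains X (p + q)"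
proof -
  have "cochain_product X v p q r s (\<gamma>, - \<omega>) = - cochain_product X v p q r s (\<gamma>, \<omega>)"
    if \<gamma>: "(\<gamma>, \<omega>) \<in> oriented_cells X (p + q)" for \<gamma> \<omega>
  proof -
    have \<gamma>': "\<gamma> \<in> X" "(\<gamma>, - \<omega>) \<in> oriented_cells X (p + q)" using \<gamma> orientation_uminus by (auto simp: oriented_cells_def)
    have "cochain_product X v p q r s (\<gamma>, \<omega>') =
        (\<Sum>(\<delta>, \<eta>) | \<delta> \<in> faces \<gamma> p \<and> \<eta> \<in> faces \<gamma> q \<and> dpair \<gamma> a \<delta> \<eta>. zs (\<omega>' (bas \<delta> @ bas \<eta>)) (val r \<delta> * val s \<eta>))"
      if "(\<gamma>, \<omega>') \<in> oriented_cells X (p + q)" for \<omega>'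
      by (rule cochain_product_value[OF X v[OF \<gamma>'(1)] adm[OF \<gamma>'(1)] r s that])
    from this[OF \<gamma>] this[OF \<gamma>'(2)] show ?thesis
      by (simp add: zs_minus sum_negf[symmetric] case_prod_beta)
  qed
  then show ?thesis by (auto simp: cochains_def cochain_product_def)
qed

lemma sum_zs_add:
  "(\<Sum>(\<alpha>, \<beta>)\<in>S. zs (f \<alpha> \<beta>) (g \<alpha> \<beta>)) + (\<Sum>(\<alpha>, \<beta>)\<in>S. zs (f' \<alpha> \<beta>) (g \<alpha> \<beta>)) =
    (\<Sum>(\<alpha>, \<beta>)\<in>S. zs (f \<alpha> \<beta> + f' \<alpha> \<beta>) (g \<alpha> \<beta>))"
  by (simp add: sum.distrib[symmetric] zs_add case_prod_beta)

lemma zs_sum_pairs: "zs k (\<Sum>(\<alpha>, \<beta>)\<in>S. zs (f \<alpha> \<beta>) (g \<alpha> \<beta>)) = (\<Sum>(\<alpha>, \<beta>)\<in>S. zs (k * f \<alpha> \<beta>) (g \<alpha> \<beta>))"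
  by (simp add: zs_arg_sum zs_zs case_prod_beta)

proposition leibniz:
  fixes r s :: "('a::euclidean_space, 's::ring) cochain"
  assumes X: "polytopal X" and v: "\<And>\<gamma> x. \<gamma> \<in> X \<Longrightarrow> x \<in> ds \<gamma> \<Longrightarrow> v x = a \<bullet> x" and adm: "\<And>\<gamma>. \<gamma> \<in> X \<Longrightarrow> adm \<gamma> a"
    and r: "r \<in> cochains X p" and s: "s \<in> cochains X q"
  shows "coboundary X (p + q) (cochain_product X v p q r s) c =
    cochain_product X v (Suc p) q (coboundary X p r) s c +
    zs ((- 1) ^ p) (cochain_product X v p (Suc q) r (coboundary X q s) c)"
proof (cases "c \<in> oriented_cells X (Suc (p + q))")
  case False
  then show ?thesis by (cases c) (simp add: coboundary_def cochain_product_def)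
next
  case True
  obtain \<gamma> \<omega> where c: "c = (\<gamma>, \<omega>)" by (cases c)
  have \<gamma>: "\<gamma> \<in> X" "cell_dim \<gamma> = p + q + 1" "\<omega> \<in> orientations (ds \<gamma>)" using True c by (auto simp: oriented_cells_def)
  have poly: "polytope \<gamma>" using X \<gamma> by (auto simp: polytopal_def)
  let ?v = "\<lambda>\<alpha> \<beta>. val r \<alpha> * val s \<beta>" and ?S = "faces \<gamma> p \<times> faces \<gamma> q"
  let ?A = "\<lambda>\<alpha> \<beta>. \<Sum>A | A face_of \<gamma> \<and> \<alpha> facet_of A \<and> dpair \<gamma> a A \<beta>. \<omega> (outward A \<alpha> # bas \<alpha> @ bas \<beta>)"
  let ?B = "\<lambda>\<alpha> \<beta>. \<Sum>B | B face_of \<gamma> \<and> \<beta> facet_of B \<and> dpair \<gamma> a \<alpha> B. \<omega> (outward B \<beta> # bas \<alpha> @ bas \<beta>)"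
  let ?C = "\<lambda>\<alpha> \<beta>. \<Sum>\<mu> | \<mu> facet_of \<gamma> \<and> \<alpha> \<subseteq> \<mu> \<and> \<beta> \<subseteq> \<mu> \<and> dpair \<mu> a \<alpha> \<beta>. \<omega> (outward \<gamma> \<mu> # bas \<alpha> @ bas \<beta>)"
  have "cochain_product X v (Suc p) q (coboundary X p r) s c =
      (\<Sum>(\<delta>, \<eta>) | \<delta> \<in> faces \<gamma> (Suc p) \<and> \<eta> \<in> faces \<gamma> q \<and> dpair \<gamma> a \<delta> \<eta>.
        zs (\<omega> (bas \<delta> @ bas \<eta>)) (val (coboundary X p r) \<delta> * val s \<eta>))"
    unfolding c using True c
    by (intro cochain_product_value[OF X v[OF \<gamma>(1)] adm[OF \<gamma>(1)] coboundary_cochain[OF X r] s]) auto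
  also have "\<dots> = (\<Sum>(\<alpha>, \<beta>)\<in>?S. zs (?A \<alpha> \<beta>) (?v \<alpha> \<beta>))"
  proof -
    have "ordered_basis (ds \<gamma>) (map (\<lambda>x. x) b @ map (\<lambda>x. x) (bas \<eta>))"
      if "\<delta> \<in> faces \<gamma> (Suc p)" "\<eta> \<in> faces \<gamma> q" "dpair \<gamma> a \<delta> \<eta>" "ordered_basis (ds \<delta>) b" for \<delta> \<eta> b
      using ordered_basis_append[OF that(4) bas[of \<eta>]] adm_direct_sum[OF adm[OF \<gamma>(1)] _ that(1-3)] \<gamma>(2) by simp
    from coboundary_left_sum[OF X \<gamma>(1) r linear_ident _ \<gamma>(3) this]
    show ?thesis by simp
  qed
  finally have left: "cochain_product X v (Suc p) q (coboundary X p r) s c = (\<Sum>(\<alpha>, \<beta>)\<in>?S. zs (?A \<alpha> \<beta>) (?v \<alpha> \<beta>))" .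
  have "cochain_product X v p (Suc q) r (coboundary X q s) c =
      (\<Sum>(\<delta>, \<eta>) | \<delta> \<in> faces \<gamma> p \<and> \<eta> \<in> faces \<gamma> (Suc q) \<and> dpair \<gamma> a \<delta> \<eta>.
        zs (\<omega> (bas \<delta> @ bas \<eta>)) (val r \<delta> * val (coboundary X q s) \<eta>))"
    unfolding c using True c
    by (intro cochain_product_value[OF X v[OF \<gamma>(1)] adm[OF \<gamma>(1)] r coboundary_cochain[OF X s]]) auto
  also have "\<dots> = (\<Sum>(\<alpha>, \<beta>)\<in>?S. zs ((- 1) ^ p * ?B \<alpha> \<beta>) (?v \<alpha> \<beta>))"
  proof -
    have "ordered_basis (ds \<gamma>) (map (\<lambda>x. x) (bas \<delta>) @ map (\<lambda>x. x) b)"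
      if "\<delta> \<in> faces \<gamma> p" "\<eta> \<in> faces \<gamma> (Suc q)" "dpair \<gamma> a \<delta> \<eta>" "ordered_basis (ds \<eta>) b" for \<delta> \<eta> b
      using ordered_basis_append[OF bas[of \<delta>] that(4)] adm_direct_sum[OF adm[OF \<gamma>(1)] _ that(1-3)] \<gamma>(2) by simp
    from coboundary_right_sum[OF X \<gamma>(1) s linear_ident _ \<gamma>(3) this]
    show ?thesis by simp
  qed
  \<comment> \<open>The sign from \<open>coboundary_right_sum\<close> and the sign in the Leibniz
    rule square to 1, leaving the bare sums of \<open>leibniz_coefficient\<close>.\<close>
  finally have right: "zs ((- 1) ^ p) (cochain_product X v p (Suc q) r (coboundary X q s) c) =
      (\<Sum>(\<alpha>, \<beta>)\<in>?S. zs (?B \<alpha> \<beta>) (?v \<alpha> \<beta>))"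
    by (simp add: zs_sum_pairs mult.assoc[symmetric] power_mult_distrib[symmetric])
  have "coboundary X (p + q) (cochain_product X v p q r s) c =
      (\<Sum>\<mu> | \<mu> facet_of \<gamma>. cochain_product X v p q r s (\<mu>, boundary_orientation \<gamma> \<mu> \<omega>))"
    using True c by (simp add: coboundary_def)
  also have "\<dots> = (\<Sum>\<mu> | \<mu> facet_of \<gamma>. \<Sum>(\<alpha>, \<beta>) | \<alpha> \<in> faces \<mu> p \<and> \<beta> \<in> faces \<mu> q \<and> dpair \<mu> a \<alpha> \<beta>.
      zs (\<omega> (outward \<gamma> \<mu> # bas \<alpha> @ bas \<beta>)) (?v \<alpha> \<beta>))"
  proof (intro sum.cong refl)
    fix \<mu> assume "\<mu> \<in> {\<mu>. \<mu> facet_of \<gamma>}"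
    then have \<mu>: "\<mu> facet_of \<gamma>" "\<mu> \<in> X" "cell_dim \<mu> = p + q"
      using facet_in[OF X \<gamma>(1)] \<gamma>(2) by (auto simp: facet_iff_cell_dim)
    have cell: "(\<mu>, boundary_orientation \<gamma> \<mu> \<omega>) \<in> oriented_cells X (p + q)"
      using \<mu> boundary_orientation(1)[OF poly \<mu>(1) \<gamma>(3)] by (auto simp: oriented_cells_def)
    have sgn: "boundary_orientation \<gamma> \<mu> \<omega> (bas \<alpha> @ bas \<beta>) = \<omega> (outward \<gamma> \<mu> # bas \<alpha> @ bas \<beta>)"
      if "\<alpha> \<in> faces \<mu> p" "\<beta> \<in> faces \<mu> q" "dpair \<mu> a \<alpha> \<beta>" for \<alpha> \<beta>
      using ordered_basis_append[OF bas[of \<alpha>] bas[of \<beta>]] adm_direct_sum[OF adm[OF \<mu>(2)] \<mu>(3) that]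
      by (intro boundary_orientation(2)[OF poly \<mu>(1) \<gamma>(3)]) simp
    have "cochain_product X v p q r s (\<mu>, boundary_orientation \<gamma> \<mu> \<omega>) =
        (\<Sum>(\<alpha>, \<beta>) | \<alpha> \<in> faces \<mu> p \<and> \<beta> \<in> faces \<mu> q \<and> dpair \<mu> a \<alpha> \<beta>.
          zs (boundary_orientation \<gamma> \<mu> \<omega> (bas \<alpha> @ bas \<beta>)) (?v \<alpha> \<beta>))"
      by (rule cochain_product_value[OF X v[OF \<mu>(2)] adm[OF \<mu>(2)] r s cell])
    also have "\<dots> = (\<Sum>(\<alpha>, \<beta>) | \<alpha> \<in> faces \<mu> p \<and> \<beta> \<in> faces \<mu> q \<and> dpair \<mu> a \<alpha> \<beta>.
          zs (\<omega> (outward \<gamma> \<mu> # bas \<alpha> @ bas \<beta>)) (?v \<alpha> \<beta>))"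
      by (intro sum.cong refl) (auto simp: sgn)
    finally show "cochain_product X v p q r s (\<mu>, boundary_orientation \<gamma> \<mu> \<omega>) =
        (\<Sum>(\<alpha>, \<beta>) | \<alpha> \<in> faces \<mu> p \<and> \<beta> \<in> faces \<mu> q \<and> dpair \<mu> a \<alpha> \<beta>.
          zs (\<omega> (outward \<gamma> \<mu> # bas \<alpha> @ bas \<beta>)) (?v \<alpha> \<beta>))" .
  qed
  also have "\<dots> = (\<Sum>(\<alpha>, \<beta>)\<in>?S. zs (?C \<alpha> \<beta>) (?v \<alpha> \<beta>))" by (rule facet_sum[OF poly])
  also have "\<dots> = (\<Sum>(\<alpha>, \<beta>)\<in>?S. zs (?A \<alpha> \<beta> + ?B \<alpha> \<beta>) (?v \<alpha> \<beta>))"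
  proof (intro sum.cong refl)
    fix z assume z: "z \<in> ?S"
    obtain \<alpha> \<beta> where ab: "z = (\<alpha>, \<beta>)" by (cases z)
    have "?A \<alpha> \<beta> + ?B \<alpha> \<beta> = ?C \<alpha> \<beta>"
      using z ab \<gamma>(2) facet_in[OF X \<gamma>(1)]
      by (intro leibniz_coefficient[OF poly _ _ _ _ _ adm[OF \<gamma>(1)] adm \<gamma>(3) bas bas]) (auto simp: faces_def)
    then show "(case z of (\<alpha>, \<beta>) \<Rightarrow> zs (?C \<alpha> \<beta>) (?v \<alpha> \<beta>)) = (case z of (\<alpha>, \<beta>) \<Rightarrow> zs (?A \<alpha> \<beta> + ?B \<alpha> \<beta>) (?v \<alpha> \<beta>))"
      by (simp add: ab)
  qed
  also have "\<dots> = (\<Sum>(\<alpha>, \<beta>)\<in>?S. zs (?A \<alpha> \<beta>) (?v \<alpha> \<beta>)) + (\<Sum>(\<alpha>, \<beta>)\<in>?S. zs (?B \<alpha> \<beta>) (?v \<alpha> \<beta>))"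
    by (rule sum_zs_add[symmetric])
  finally show ?thesis unfolding left right .
qed

section \<open>The homotopy\<close>

lemma ordered_basis_time:
  assumes c: "ordered_basis W c" and W: "subspace (W :: 'a::euclidean_space set)"
  shows "ordered_basis (W \<times> (UNIV :: real set)) ((0, 1) # map (shear 0) c)"
proof (rule ordered_basis_Cons[where \<psi> = "(0, 1)"])
  have m: "ordered_basis (shear 0 ` W) (map (shear 0) c)"
    using c by (rule ordered_basis_map) (auto intro: inj_on_subset[OF inj_shear])
  then show "distinct (map (shear 0) c)" "independent (set (map (shear 0) c))" by (simp_all add: ordered_basis_def)
  show "set (map (shear 0) c) \<subseteq> W \<times> UNIV" using ordered_basis_mem[OF m] by (auto simp: shear_def)
  show "dim (W \<times> (UNIV :: real set)) = length (map (shear 0) c) + 1"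
    using ordered_basis_length[OF c] W by (simp add: dim_Times_UNIV)
  show "(0, 1) \<bullet> x = 0" if "x \<in> set (map (shear 0) c)" for x using that by (auto simp: shear_def)
qed (use W in \<open>auto simp: subspace_Times subspace_0\<close>)

text \<open>The product orientation of \<open>W \<times> \<real>\<close> with time first;
  \<open>shear 0\<close> is the embedding of \<open>W\<close> with time coordinate 0.\<close>

definition ext :: "'a::euclidean_space set \<Rightarrow> 'a orientation \<Rightarrow> ('a \<times> real) orientation"
  where "ext W \<omega> = (SOME \<omega>'. \<omega>' \<in> orientations (W \<times> UNIV) \<and>
    (\<forall>c. ordered_basis W c \<longrightarrow> \<omega>' ((0, 1) # map (shear 0) c) = \<omega> c))"

lemma ext:
  assumes W: "subspace (W :: 'a::euclidean_space set)" and \<omega>: "\<omega> \<in> orientations W"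
  shows "ext W \<omega> \<in> orientations (W \<times> UNIV)"
    and "ordered_basis W c \<Longrightarrow> ext W \<omega> ((0, 1) # map (shear 0) c) = \<omega> c"
proof -
  obtain c0 where c0: "ordered_basis W c0" using ordered_basis_exists[OF W] by blast
  obtain \<omega>' where \<omega>': "\<omega>' \<in> orientations (W \<times> UNIV)" "\<omega>' ((0, 1) # map (shear 0) c0) = \<omega> c0"
    using orientation_exists[OF ordered_basis_time[OF c0 W] orientation_sign(1)[OF \<omega> c0]] by blast
  have "(\<lambda>c. if ordered_basis W c then \<omega>' ([(0, 1)] @ map (shear 0) c @ []) else 0) \<in> orientations W"
    by (rule orientation_pullback[OF \<omega>'(1) linear_shear inj_on_subset[OF inj_shear subset_UNIV]])
      (use ordered_basis_time[OF _ W] in simp)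
  from orientation_eqI[OF this \<omega> c0] have "(\<lambda>c. if ordered_basis W c then \<omega>' ([(0, 1)] @ map (shear 0) c @ []) else 0) = \<omega>"
    using \<omega>'(2) c0 by simp
  then have "\<omega>' ((0, 1) # map (shear 0) c) = \<omega> c" if "ordered_basis W c" for c using that by (auto dest: fun_cong[of _ _ c])
  with \<omega>'(1) have "\<exists>\<omega>'. \<omega>' \<in> orientations (W \<times> UNIV) \<and> (\<forall>c. ordered_basis W c \<longrightarrow> \<omega>' ((0, 1) # map (shear 0) c) = \<omega> c)"
    by blast
  from someI_ex[OF this] show "ext W \<omega> \<in> orientations (W \<times> UNIV)"
    "ordered_basis W c \<Longrightarrow> ext W \<omega> ((0, 1) # map (shear 0) c) = \<omega> c"
    unfolding ext_def by blast+
qed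

lemma ext_uminus:
  assumes W: "subspace (W :: 'a::euclidean_space set)" and \<omega>: "\<omega> \<in> orientations W"
  shows "ext W (- \<omega>) = - ext W \<omega>"
proof -
  obtain c where c: "ordered_basis W c" using ordered_basis_exists[OF W] by blast
  show ?thesis
    by (rule orientation_eqI[OF ext(1)[OF W orientation_uminus[OF \<omega>]] orientation_uminus[OF ext(1)[OF W \<omega>]]
          ordered_basis_time[OF c W]])
      (simp add: ext(2)[OF W \<omega> c] ext(2)[OF W orientation_uminus[OF \<omega>] c])
qed

text \<open>The boundary orientation puts the outward vector first, the extension puts the time direction
  first; exchanging the two costs a sign.\<close>

lemma ext_boundary:
  fixes \<gamma> :: "'a::euclidean_space set"
  assumes \<gamma>: "polytope \<gamma>" and \<mu>: "\<mu> facet_of \<gamma>" and \<omega>: "\<omega> \<in> orientations (ds \<gamma>)"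
    and l: "ordered_basis (ds \<mu> \<times> UNIV) l"
  shows "ext (ds \<mu>) (boundary_orientation \<gamma> \<mu> \<omega>) l = - ext (ds \<gamma>) \<omega> (shear 0 (outward \<gamma> \<mu>) # l)"
proof -
  let ?n = "outward \<gamma> \<mu>" and ?e = "ext (ds \<gamma>) \<omega>"
  note bo = boundary_orientation[OF \<gamma> \<mu> \<omega>]
  obtain g where g: "amax \<gamma> g = \<mu>" using polytope_face_amax[OF \<gamma>, of \<mu>] \<mu> by (auto simp: facet_of_def)
  have cons: "ordered_basis (ds \<gamma> \<times> UNIV) (shear 0 ?n # l)" if l: "ordered_basis (ds \<mu> \<times> UNIV) l" for l
  proof (rule ordered_basis_Cons[where \<psi> = "(g, 0)"])
    show "distinct l" "independent (set l)" using l by (auto simp: ordered_basis_def)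
    show "set l \<subseteq> ds \<gamma> \<times> UNIV" using ordered_basis_mem[OF l] ds_mono[OF facet_subset[OF \<mu>]] by auto
    show "dim (ds \<gamma> \<times> (UNIV :: real set)) = length l + 1"
      using ordered_basis_length[OF l] \<mu> by (simp add: facet_iff_cell_dim cell_dim_def dim_Times_UNIV)
    show "(g, 0) \<bullet> x = 0" if "x \<in> set l" for x
    proof -
      have "fst x \<in> ds \<mu>" using ordered_basis_mem[OF l] that by auto
      then have "g \<bullet> fst x = 0" using amax_orthogonal[of \<mu> \<gamma> g] g by blast
      then show ?thesis by (cases x) simp
    qed
    show "(g, 0) \<bullet> shear 0 ?n \<noteq> 0" using outward_amax[OF \<mu> g[symmetric]] by (simp add: shear_def)
    show "shear 0 ?n \<in> ds \<gamma> \<times> UNIV" using outward_mem[OF \<mu>] by (simp add: shear_def)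
  qed (simp add: subspace_Times)
  define P where "P = (\<lambda>l. if ordered_basis (ds \<mu> \<times> UNIV) l then ?e (shear 0 ?n # l) else 0)"
  have "(\<lambda>l. if ordered_basis (ds \<mu> \<times> UNIV) l then ?e ([shear 0 ?n] @ map (\<lambda>x. x) l @ []) else 0)
      \<in> orientations (ds \<mu> \<times> UNIV)"
    by (rule orientation_pullback[OF ext(1)[OF subspace_ds \<omega>] linear_ident]) (use cons in auto)
  then have P: "P \<in> orientations (ds \<mu> \<times> UNIV)" by (simp add: P_def cong: if_cong)
  note time = ordered_basis_time[OF bas[of \<mu>] subspace_ds]
  have "(- P) ((0, 1) # map (shear 0) (bas \<mu>)) = ?e ((0, 1) # map (shear 0) (?n # bas \<mu>))"
    using orientation_swap[OF ext(1)[OF subspace_ds \<omega>], of "[]" "shear 0 ?n" "(0, 1)"] time by (simp add: P_def)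
  also have "\<dots> = \<omega> (?n # bas \<mu>)" by (rule ext(2)[OF subspace_ds \<omega> ordered_basis_outward[OF \<gamma> \<mu> bas]])
  also have "\<dots> = ext (ds \<mu>) (boundary_orientation \<gamma> \<mu> \<omega>) ((0, 1) # map (shear 0) (bas \<mu>))"
    using ext(2)[OF subspace_ds bo(1) bas] bo(2)[OF bas] by simp
  finally have "ext (ds \<mu>) (boundary_orientation \<gamma> \<mu> \<omega>) = - P"
    by (intro orientation_eqI[OF ext(1)[OF subspace_ds bo(1)] orientation_uminus[OF P] time]) simp
  then show ?thesis using l by (simp add: P_def)
qed

text \<open>Modulo \<open>span (set y)\<close> the vectors of \<open>x\<close> do not change, so the
  block that matters is the identity.\<close>

lemma transition_det_shear:
  fixes x x' y :: "'a::real_vector list"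
  assumes ind: "independent (set (x @ y))" and dist: "distinct (x @ y)" and len: "length x' = length x"
    and diff: "\<And>j. j < length x \<Longrightarrow> x' ! j - x ! j \<in> span (set y)"
  shows "transition_det (x @ y) (x' @ y) = 1"
proof -
  let ?R = "representation (set (x @ y))"
  have "?R (x' ! j) (x ! i) = (if i = j then 1 else 0)" if ij: "i < length x" "j < length x" for i j
  proof -
    have d: "x' ! j - x ! j \<in> span (set (x @ y))" using diff[OF ij(2)] span_mono[of "set y" "set (x @ y)"] by auto
    have xj: "x ! j \<in> span (set (x @ y))" using ij by (auto intro: span_base)
    have "x ! i \<notin> set y" using dist ij by (auto simp: disjoint_iff)
    then have "representation (set y) (x' ! j - x ! j) (x ! i) = 0" using representation_ne_zero by metis
    then have z: "?R (x' ! j - x ! j) (x ! i) = 0"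
      using representation_extend[OF ind diff[OF ij(2)]] by simp
    have "?R (x ! j + (x' ! j - x ! j)) (x ! i) = ?R (x ! j) (x ! i)"
      unfolding representation_add[OF ind d xj] using z by simp
    then show ?thesis
      using representation_basis[OF ind, of "x ! j"] ij dist by (auto simp: nth_eq_iff_index_eq)
  qed
  then have "mat (length x) (length x) (\<lambda>(i, j). ?R (x' ! j) (x ! i)) = 1\<^sub>m (length x)"
    by (intro eq_matI) auto
  moreover have "independent (set y)" using ind by (rule independent_mono) auto
  ultimately show ?thesis
    using transition_det_append[OF ind dist len refl] dist by (simp add: span_superset transition_det_self)
qed

text \<open>Shearing alters vectors by multiples of the time direction only. Time is moved to the
  last place, where \<open>transition_det_shear\<close> applies, and the cost of moving it is the
  same for both bases. This identifies the sign at the extreme times with the sign in the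
  product.\<close>

lemma ext_shear:
  fixes W :: "'a::euclidean_space set"
  assumes W: "subspace W" and \<omega>: "\<omega> \<in> orientations W" and b: "ordered_basis W (b @ b')"
  shows "ext W \<omega> ((0, 1) # map (shear u) b @ map (shear 0) b') = \<omega> (b @ b')"
proof -
  let ?e = "ext W \<omega>" and ?x = "map (shear 0) b @ map (shear 0) b'" and ?x' = "map (shear u) b @ map (shear 0) b'"
  let ?t = "[(0, 1)] :: ('a \<times> real) list"
  note e = ext[OF W \<omega>]
  have "ordered_basis (W \<times> UNIV) ((0, 1) # ?x)" using ordered_basis_time[OF b W] by simp
  then have x: "ordered_basis (W \<times> UNIV) (?x @ ?t)" by (subst ordered_basis_permute[of _ "(0, 1) # ?x"]) auto
  have x': "ordered_basis (W \<times> UNIV) (?x' @ ?t)"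
  proof (rule ordered_basisI_span)
    show "length (?x' @ ?t) = dim (W \<times> (UNIV :: real set))" using ordered_basis_length[OF x] by simp
    have t: "(0, 1) \<in> span (set (?x' @ ?t))" by (rule span_base) simp
    have "v \<in> span (set (?x' @ ?t))" if "v \<in> set (?x @ ?t)" for v
    proof -
      show ?thesis
      proof (cases "v \<in> shear 0 ` set b")
        case True
        then obtain y where 1: "v = shear 0 y" "y \<in> set b" by blast
        have "shear u y \<in> span (set (?x' @ ?t))" using 1 by (intro span_base) auto
        then have "shear u y + (u \<bullet> y) *\<^sub>R (0, 1) \<in> span (set (?x' @ ?t))" using t by (intro span_add span_scale)
        then show ?thesis using 1 by (simp add: shear_def)
      next
        case False
        then show ?thesis using that by (intro span_base) auto
      qed
    qed
    then have "span (set (?x @ ?t)) \<subseteq> span (set (?x' @ ?t))" by (intro span_minimal subspace_span subsetI)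
    then have "W \<times> UNIV \<subseteq> span (set (?x' @ ?t))" using x unfolding ordered_basis_def by argo
    moreover have "set (?x' @ ?t) \<subseteq> W \<times> UNIV"
      using ordered_basis_mem[OF b] subspace_0[OF W] by (auto simp: shear_def)
    then have "span (set (?x' @ ?t)) \<subseteq> W \<times> UNIV" by (intro span_minimal subspace_Times W subspace_UNIV)
    ultimately show "span (set (?x' @ ?t)) = W \<times> UNIV" by blast
  qed
  have "?x' ! j - ?x ! j \<in> span (set ?t)" if j: "j < length ?x" for j
  proof -
    have "\<exists>k. ?x' ! j - ?x ! j = k *\<^sub>R (0, 1)"
    proof (cases "j < length b")
      case True
      then have "?x' ! j - ?x ! j = (- (u \<bullet> b ! j)) *\<^sub>R (0, 1)" by (simp add: nth_append shear_def)
      then show ?thesis by blast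
    next
      case False
      then have "?x' ! j - ?x ! j = 0 *\<^sub>R (0, 1)" using j by (simp add: nth_append zero_prod_def)
      then show ?thesis by blast
    qed
    then obtain k where k: "?x' ! j - ?x ! j = k *\<^sub>R (0, 1)" by blast
    show ?thesis unfolding k by (intro span_scale span_base) simp
  qed
  then have "transition_det (?x @ ?t) (?x' @ ?t) = 1"
    using x by (intro transition_det_shear) (auto simp: ordered_basis_def)
  then have "?e (?x' @ ?t) = ?e (?x @ ?t)" using orientation_value[OF e(1) x x'] by simp
  moreover have "?e (?x' @ ?t) = (- 1) ^ length ?x' * ?e ((0, 1) # ?x')" "?e (?x @ ?t) = (- 1) ^ length ?x * ?e ((0, 1) # ?x)"
    using orientation_move_front[OF e(1), of ?x' "(0, 1)" "[]"] orientation_move_front[OF e(1), of ?x "(0, 1)" "[]"] by simp_all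
  ultimately have "?e ((0, 1) # ?x') = ?e ((0, 1) # ?x)" by simp
  also have "\<dots> = \<omega> (b @ b')" using e(2)[OF b] by simp
  finally show ?thesis .
qed

lemma shear_direct_sum:
  fixes \<gamma> :: "'a::euclidean_space set"
  assumes hadm: "hadm \<gamma> a u" and d: "p + q = cell_dim \<gamma> + 1"
    and f: "\<delta> \<in> faces \<gamma> p" "\<eta> \<in> faces \<gamma> q" "hpair \<gamma> a u \<delta> \<eta>"
    and b: "ordered_basis (ds \<delta>) b" "ordered_basis (ds \<eta>) b'"
  shows "ordered_basis (ds \<gamma> \<times> UNIV) (map (shear u) b @ map (shear 0) b')"
proof -
  have "\<forall>x\<in>ds \<delta> \<inter> ds \<eta>. u \<bullet> x = 0 \<longrightarrow> x = 0"
    by (rule hadm_transversal[OF hadm f(3)]) (use f d in \<open>auto simp: faces_def\<close>)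
  then have int: "shear u ` ds \<delta> \<inter> shear 0 ` ds \<eta> = {0}" by (rule shear_Int)
  have sub: "\<delta> \<subseteq> \<gamma>" "\<eta> \<subseteq> \<gamma>" using f by (auto simp: faces_def dest: face_of_imp_subset)
  have E: "subspace (ds \<gamma> \<times> (UNIV :: real set))" by (intro subspace_Times subspace_ds subspace_UNIV)
  have ss: "subspace (shear u ` ds \<delta>)" "subspace (shear 0 ` ds \<eta>)" by (simp_all add: linear_subspace_image)
  have "msum (shear u ` ds \<delta>) (shear 0 ` ds \<eta>) \<subseteq> ds \<gamma> \<times> UNIV"
    using ds_mono[OF sub(1)] ds_mono[OF sub(2)] by (intro msum_subset E) (auto simp: shear_def)
  moreover have "dim (msum (shear u ` ds \<delta>) (shear 0 ` ds \<eta>)) = dim (ds \<gamma> \<times> (UNIV :: real set))"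
    using dim_msum[OF ss int] f d by (simp add: dim_image_inj dim_Times_UNIV faces_def cell_dim_def)
  ultimately have "msum (shear u ` ds \<delta>) (shear 0 ` ds \<eta>) = ds \<gamma> \<times> UNIV"
    by (intro subspace_dim_equal subspace_msum ss E) auto
  then show ?thesis
    using ordered_basis_append[OF ordered_basis_map[OF b(1) linear_shear] ordered_basis_map[OF b(2) linear_shear] int]
    by (metis inj_on_subset inj_shear subset_UNIV)
qed

text \<open>One term for each pair met by the segment in a cell of dimension one less than
  \<open>p + q\<close>, with the sign taken in that cell times \<open>\<real>\<close>. The dimension
  condition is written as a sum so that \<open>p = q = 0\<close> yields the zero cochain.\<close>

definition homotopy ::
    "'a::euclidean_space set set \<Rightarrow> 'a \<Rightarrow> 'a \<Rightarrow> nat \<Rightarrow> nat \<Rightarrow> ('a, 's::ring) cochain \<Rightarrow> ('a, 's) cochain \<Rightarrow> ('a, 's) cochain"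
  where "homotopy X a u p q r s = (\<lambda>(\<gamma>, \<omega>). if \<gamma> \<in> X \<and> cell_dim \<gamma> + 1 = p + q \<and> \<omega> \<in> orientations (ds \<gamma>)
    then \<Sum>(\<delta>, \<eta>) | \<delta> \<in> faces \<gamma> p \<and> \<eta> \<in> faces \<gamma> q \<and> hpair \<gamma> a u \<delta> \<eta>.
      zs (ext (ds \<gamma>) \<omega> (map (shear u) (bas \<delta>) @ map (shear 0) (bas \<eta>))) (val r \<delta> * val s \<eta>)
    else 0)"

lemma homotopy_cochain:
  assumes "p + q = Suc k"
  shows "homotopy X a u p q r s \<in> cochains X k"
proof -
  have "homotopy X a u p q r s (\<gamma>, - \<omega>) = - homotopy X a u p q r s (\<gamma>, \<omega>)"
    if "(\<gamma>, \<omega>) \<in> oriented_cells X k" for \<gamma> \<omega>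
  proof -
    have "\<omega> \<in> orientations (ds \<gamma>)" using that by (simp add: oriented_cells_def)
    then show ?thesis
      by (simp add: homotopy_def orientation_uminus ext_uminus[OF subspace_ds] zs_minus sum_negf[symmetric] case_prod_beta)
  qed
  then show ?thesis using assms by (auto simp: cochains_def homotopy_def oriented_cells_def)
qed

text \<open>For cocycles the sums over enlarged faces vanish, since they are coordinates of the two
  coboundaries; what remains of \<open>homotopy_coefficient\<close> is the difference of the
  products and the facet terms. The right-hand side is a sum over facets instead of a
  \<open>coboundary\<close>, so that degree 0 is covered.\<close>

proposition homotopy_formula:
  fixes r s :: "('a::euclidean_space, 's::ring) cochain"
  assumes X: "polytopal X"
    and v: "\<And>\<gamma> x. \<gamma> \<in> X \<Longrightarrow> x \<in> ds \<gamma> \<Longrightarrow> v x = a \<bullet> x" "\<And>\<gamma> x. \<gamma> \<in> X \<Longrightarrow> x \<in> ds \<gamma> \<Longrightarrow> v' x = (a + u) \<bullet> x"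
    and adm: "\<And>\<gamma>. \<gamma> \<in> X \<Longrightarrow> adm \<gamma> a" "\<And>\<gamma>. \<gamma> \<in> X \<Longrightarrow> adm \<gamma> (a + u)" "\<And>\<gamma>. \<gamma> \<in> X \<Longrightarrow> hadm \<gamma> a u"
    and r: "r \<in> cochains X p" "coboundary X p r = 0" and s: "s \<in> cochains X q" "coboundary X q s = 0"
    and c: "(\<gamma>, \<omega>) \<in> oriented_cells X (p + q)"
  shows "cochain_product X v' p q r s (\<gamma>, \<omega>) - cochain_product X v p q r s (\<gamma>, \<omega>) =
    (\<Sum>\<mu> | \<mu> facet_of \<gamma>. homotopy X a u p q r s (\<mu>, boundary_orientation \<gamma> \<mu> \<omega>))"
proof -
  have \<gamma>: "\<gamma> \<in> X" "cell_dim \<gamma> = p + q" "\<omega> \<in> orientations (ds \<gamma>)" using c by (auto simp: oriented_cells_def)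
  have poly: "polytope \<gamma>" using X \<gamma> by (auto simp: polytopal_def)
  let ?v = "\<lambda>\<alpha> \<beta>. val r \<alpha> * val s \<beta>" and ?S = "faces \<gamma> p \<times> faces \<gamma> q"
  let ?e = "ext (ds \<gamma>) \<omega>"
  let ?l = "\<lambda>\<alpha> \<beta>. map (shear u) (bas \<alpha>) @ map (shear 0) (bas \<beta>)"
  let ?A = "\<lambda>\<alpha> \<beta>. \<Sum>A | A face_of \<gamma> \<and> \<alpha> facet_of A \<and> hpair \<gamma> a u A \<beta>. ?e (shear u (outward A \<alpha>) # ?l \<alpha> \<beta>)"
  let ?B = "\<lambda>\<alpha> \<beta>. \<Sum>B | B face_of \<gamma> \<and> \<beta> facet_of B \<and> hpair \<gamma> a u \<alpha> B. ?e (shear 0 (outward B \<beta>) # ?l \<alpha> \<beta>)"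
  let ?D = "\<lambda>a \<alpha> \<beta>. of_bool (dpair \<gamma> a \<alpha> \<beta>) * \<omega> (bas \<alpha> @ bas \<beta>)"
  \<comment> \<open>The minus sign is that of \<open>ext_boundary\<close>, where the outward vector
    and the time direction change places.\<close>
  let ?M = "\<lambda>\<alpha> \<beta>. \<Sum>\<mu> | \<mu> facet_of \<gamma> \<and> \<alpha> \<subseteq> \<mu> \<and> \<beta> \<subseteq> \<mu> \<and> hpair \<mu> a u \<alpha> \<beta>. - ?e (shear 0 (outward \<gamma> \<mu>) # ?l \<alpha> \<beta>)"
  have e: "?e \<in> orientations (ds \<gamma> \<times> UNIV)" by (rule ext(1)[OF subspace_ds \<gamma>(3)])
  have A: "(\<Sum>(\<alpha>, \<beta>)\<in>?S. zs (?A \<alpha> \<beta>) (?v \<alpha> \<beta>)) = 0"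
  proof -
    have "ordered_basis (ds \<gamma> \<times> UNIV) (map (shear u) b @ map (shear 0) (bas \<eta>))"
      if "\<delta> \<in> faces \<gamma> (Suc p)" "\<eta> \<in> faces \<gamma> q" "hpair \<gamma> a u \<delta> \<eta>" "ordered_basis (ds \<delta>) b" for \<delta> \<eta> b
      using shear_direct_sum[OF adm(3)[OF \<gamma>(1)] _ that(1-3) that(4) bas] \<gamma>(2) by simp
    from coboundary_left_sum[OF X \<gamma>(1) r(1) linear_shear inj_shear e this, where y = "val s"]
    show ?thesis using r(2) by (simp add: val_def)
  qed
  have B: "(\<Sum>(\<alpha>, \<beta>)\<in>?S. zs (?B \<alpha> \<beta>) (?v \<alpha> \<beta>)) = 0"
  proof -
    have "ordered_basis (ds \<gamma> \<times> UNIV) (map (shear u) (bas \<delta>) @ map (shear 0) b)"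
      if "\<delta> \<in> faces \<gamma> p" "\<eta> \<in> faces \<gamma> (Suc q)" "hpair \<gamma> a u \<delta> \<eta>" "ordered_basis (ds \<eta>) b" for \<delta> \<eta> b
      using shear_direct_sum[OF adm(3)[OF \<gamma>(1)] _ that(1-3) bas that(4)] \<gamma>(2) by simp
    from coboundary_right_sum[OF X \<gamma>(1) s(1) linear_shear inj_shear e this, where y = "val r"]
    have "(\<Sum>(\<alpha>, \<beta>)\<in>?S. zs ((- 1) ^ p * ?B \<alpha> \<beta>) (?v \<alpha> \<beta>)) = 0" using s(2) by (simp add: val_def)
    then have "zs ((- 1) ^ p) (\<Sum>(\<alpha>, \<beta>)\<in>?S. zs ((- 1) ^ p * ?B \<alpha> \<beta>) (?v \<alpha> \<beta>)) = 0" by simp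
    then show ?thesis by (simp add: zs_sum_pairs mult.assoc[symmetric] power_mult_distrib[symmetric])
  qed
  have prod: "cochain_product X w p q r s (\<gamma>, \<omega>) = (\<Sum>(\<alpha>, \<beta>)\<in>?S. zs (?D b \<alpha> \<beta>) (?v \<alpha> \<beta>))"
    if w: "\<And>x. x \<in> ds \<gamma> \<Longrightarrow> w x = b \<bullet> x" and adm_b: "adm \<gamma> b" for w b
  proof -
    have "cochain_product X w p q r s (\<gamma>, \<omega>) = (\<Sum>(\<alpha>, \<beta>) | \<alpha> \<in> faces \<gamma> p \<and> \<beta> \<in> faces \<gamma> q \<and> dpair \<gamma> b \<alpha> \<beta>.
        zs (\<omega> (bas \<alpha> @ bas \<beta>)) (?v \<alpha> \<beta>))"
      by (rule cochain_product_value[OF X w adm_b r(1) s(1) c])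
    also have "\<dots> = (\<Sum>(\<alpha>, \<beta>)\<in>?S. zs (?D b \<alpha> \<beta>) (?v \<alpha> \<beta>))"
    proof (rule sum.mono_neutral_cong_left)
      show "\<forall>z\<in>?S - {(\<alpha>, \<beta>). \<alpha> \<in> faces \<gamma> p \<and> \<beta> \<in> faces \<gamma> q \<and> dpair \<gamma> b \<alpha> \<beta>}.
          (case z of (\<alpha>, \<beta>) \<Rightarrow> zs (?D b \<alpha> \<beta>) (?v \<alpha> \<beta>)) = 0"
      proof
        fix z assume z: "z \<in> ?S - {(\<alpha>, \<beta>). \<alpha> \<in> faces \<gamma> p \<and> \<beta> \<in> faces \<gamma> q \<and> dpair \<gamma> b \<alpha> \<beta>}"
        obtain \<alpha> \<beta> where ab: "z = (\<alpha>, \<beta>)" by (cases z)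
        then have "\<not> dpair \<gamma> b \<alpha> \<beta>" using z by auto
        then show "(case z of (\<alpha>, \<beta>) \<Rightarrow> zs (?D b \<alpha> \<beta>) (?v \<alpha> \<beta>)) = 0" unfolding ab by simp
      qed
    qed (auto simp: finite_faces[OF poly])
    finally show ?thesis .
  qed
  have coeff: "?A \<alpha> \<beta> + ?B \<alpha> \<beta> = ?D (a + u) \<alpha> \<beta> - ?D a \<alpha> \<beta> - ?M \<alpha> \<beta>" if ab: "\<alpha> \<in> faces \<gamma> p" "\<beta> \<in> faces \<gamma> q" for \<alpha> \<beta>
  proof -
    \<comment> \<open>Only for a selected pair do the two faces span \<open>ds \<gamma>\<close>,
      which makes the sign identification available; for other pairs the indicator is 0.\<close>
    have time: "?e ((0, 1) # ?l \<alpha> \<beta>) = \<omega> (bas \<alpha> @ bas \<beta>)"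
      if "dpair \<gamma> b \<alpha> \<beta>" "adm \<gamma> b" for b
      using ordered_basis_append[OF bas[of \<alpha>] bas[of \<beta>]] adm_direct_sum[OF that(2) \<gamma>(2) ab that(1)]
      by (intro ext_shear[OF subspace_ds \<gamma>(3)]) simp
    have "(of_bool (dpair \<gamma> (a + u) \<alpha> \<beta>) - of_bool (dpair \<gamma> a \<alpha> \<beta>)) * ?e ((0, 1) # ?l \<alpha> \<beta>) =
        ?D (a + u) \<alpha> \<beta> - ?D a \<alpha> \<beta>"
      using time[OF _ adm(1)[OF \<gamma>(1)]] time[OF _ adm(2)[OF \<gamma>(1)]]
      by (cases "dpair \<gamma> (a + u) \<alpha> \<beta>"; cases "dpair \<gamma> a \<alpha> \<beta>") auto
    moreover have "?A \<alpha> \<beta> + ?B \<alpha> \<beta> =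
      (of_bool (dpair \<gamma> (a + u) \<alpha> \<beta>) - of_bool (dpair \<gamma> a \<alpha> \<beta>)) * ?e ((0, 1) # ?l \<alpha> \<beta>) +
      (\<Sum>\<mu> | \<mu> facet_of \<gamma> \<and> \<alpha> \<subseteq> \<mu> \<and> \<beta> \<subseteq> \<mu> \<and> hpair \<mu> a u \<alpha> \<beta>. ?e (shear 0 (outward \<gamma> \<mu>) # ?l \<alpha> \<beta>))"
      using ab \<gamma>(2) facet_in[OF X \<gamma>(1)]
      by (intro homotopy_coefficient[OF poly _ _ _ _ _ adm(3)[OF \<gamma>(1)] adm(3) e bas bas]) (auto simp: faces_def)
    ultimately show ?thesis by (simp add: sum_negf)
  qed
  have "(\<Sum>\<mu> | \<mu> facet_of \<gamma>. homotopy X a u p q r s (\<mu>, boundary_orientation \<gamma> \<mu> \<omega>)) =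
      (\<Sum>\<mu> | \<mu> facet_of \<gamma>. \<Sum>(\<alpha>, \<beta>) | \<alpha> \<in> faces \<mu> p \<and> \<beta> \<in> faces \<mu> q \<and> hpair \<mu> a u \<alpha> \<beta>.
        zs (- ?e (shear 0 (outward \<gamma> \<mu>) # ?l \<alpha> \<beta>)) (?v \<alpha> \<beta>))"
  proof (intro sum.cong refl)
    fix \<mu> assume "\<mu> \<in> {\<mu>. \<mu> facet_of \<gamma>}"
    then have \<mu>: "\<mu> facet_of \<gamma>" "\<mu> \<in> X" "cell_dim \<mu> + 1 = p + q"
      using facet_in[OF X \<gamma>(1)] \<gamma>(2) by (auto simp: facet_iff_cell_dim)
    have bo: "boundary_orientation \<gamma> \<mu> \<omega> \<in> orientations (ds \<mu>)" by (rule boundary_orientation(1)[OF poly \<mu>(1) \<gamma>(3)])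
    have sgn: "ext (ds \<mu>) (boundary_orientation \<gamma> \<mu> \<omega>) (?l \<alpha> \<beta>) = - ?e (shear 0 (outward \<gamma> \<mu>) # ?l \<alpha> \<beta>)"
      if "\<alpha> \<in> faces \<mu> p" "\<beta> \<in> faces \<mu> q" "hpair \<mu> a u \<alpha> \<beta>" for \<alpha> \<beta>
      by (rule ext_boundary[OF poly \<mu>(1) \<gamma>(3) shear_direct_sum[OF adm(3)[OF \<mu>(2)] \<mu>(3)[symmetric] that bas bas]])
    have "homotopy X a u p q r s (\<mu>, boundary_orientation \<gamma> \<mu> \<omega>) =
        (\<Sum>(\<alpha>, \<beta>) | \<alpha> \<in> faces \<mu> p \<and> \<beta> \<in> faces \<mu> q \<and> hpair \<mu> a u \<alpha> \<beta>.
          zs (ext (ds \<mu>) (boundary_orientation \<gamma> \<mu> \<omega>) (?l \<alpha> \<beta>)) (?v \<alpha> \<beta>))"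
      using \<mu> bo by (simp add: homotopy_def)
    also have "\<dots> = (\<Sum>(\<alpha>, \<beta>) | \<alpha> \<in> faces \<mu> p \<and> \<beta> \<in> faces \<mu> q \<and> hpair \<mu> a u \<alpha> \<beta>.
          zs (- ?e (shear 0 (outward \<gamma> \<mu>) # ?l \<alpha> \<beta>)) (?v \<alpha> \<beta>))"
      by (intro sum.cong refl) (auto simp: sgn)
    finally show "homotopy X a u p q r s (\<mu>, boundary_orientation \<gamma> \<mu> \<omega>) =
        (\<Sum>(\<alpha>, \<beta>) | \<alpha> \<in> faces \<mu> p \<and> \<beta> \<in> faces \<mu> q \<and> hpair \<mu> a u \<alpha> \<beta>.
          zs (- ?e (shear 0 (outward \<gamma> \<mu>) # ?l \<alpha> \<beta>)) (?v \<alpha> \<beta>))" .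
  qed
  also have "\<dots> = (\<Sum>(\<alpha>, \<beta>)\<in>?S. zs (?M \<alpha> \<beta>) (?v \<alpha> \<beta>))" by (rule facet_sum[OF poly])
  finally have M: "(\<Sum>\<mu> | \<mu> facet_of \<gamma>. homotopy X a u p q r s (\<mu>, boundary_orientation \<gamma> \<mu> \<omega>)) =
      (\<Sum>(\<alpha>, \<beta>)\<in>?S. zs (?M \<alpha> \<beta>) (?v \<alpha> \<beta>))" .
  have "(\<Sum>(\<alpha>, \<beta>)\<in>?S. zs (?D (a + u) \<alpha> \<beta>) (?v \<alpha> \<beta>)) =
      (\<Sum>(\<alpha>, \<beta>)\<in>?S. zs (?D a \<alpha> \<beta> + ?M \<alpha> \<beta> + (?A \<alpha> \<beta> + ?B \<alpha> \<beta>)) (?v \<alpha> \<beta>))"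
  proof (intro sum.cong refl)
    fix z assume "z \<in> ?S"
    then show "(case z of (\<alpha>, \<beta>) \<Rightarrow> zs (?D (a + u) \<alpha> \<beta>) (?v \<alpha> \<beta>)) =
        (case z of (\<alpha>, \<beta>) \<Rightarrow> zs (?D a \<alpha> \<beta> + ?M \<alpha> \<beta> + (?A \<alpha> \<beta> + ?B \<alpha> \<beta>)) (?v \<alpha> \<beta>))"
      using coeff[of "fst z" "snd z"] by (cases z) (simp only: mem_Times_iff fst_conv snd_conv prod.case, simp)
  qed
  also have "\<dots> = (\<Sum>(\<alpha>, \<beta>)\<in>?S. zs (?D a \<alpha> \<beta>) (?v \<alpha> \<beta>)) + (\<Sum>(\<alpha>, \<beta>)\<in>?S. zs (?M \<alpha> \<beta>) (?v \<alpha> \<beta>))"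
    unfolding sum_zs_add[symmetric] A B by simp
  finally have "(\<Sum>(\<alpha>, \<beta>)\<in>?S. zs (?D (a + u) \<alpha> \<beta>) (?v \<alpha> \<beta>)) =
      (\<Sum>(\<alpha>, \<beta>)\<in>?S. zs (?D a \<alpha> \<beta>) (?v \<alpha> \<beta>)) + (\<Sum>(\<alpha>, \<beta>)\<in>?S. zs (?M \<alpha> \<beta>) (?v \<alpha> \<beta>))" .
  moreover have "cochain_product X v p q r s (\<gamma>, \<omega>) = (\<Sum>(\<alpha>, \<beta>)\<in>?S. zs (?D a \<alpha> \<beta>) (?v \<alpha> \<beta>))"
    by (rule prod[OF v(1)[OF \<gamma>(1)] adm(1)[OF \<gamma>(1)]])
  moreover have "cochain_product X v' p q r s (\<gamma>, \<omega>) = (\<Sum>(\<alpha>, \<beta>)\<in>?S. zs (?D (a + u) \<alpha> \<beta>) (?v \<alpha> \<beta>))"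
    by (rule prod[OF v(2)[OF \<gamma>(1)] adm(2)[OF \<gamma>(1)]])
  ultimately show ?thesis unfolding M by (simp only: add_diff_cancel_left')
qed

section \<open>Generic displacements\<close>

text \<open>Pick one non-zero vector in each set. The functionals vanishing on it form a hyperplane,
  and finitely many hyperplanes do not cover the space.\<close>

lemma generic_functional:
  fixes \<M> :: "'a::euclidean_space set set"
  assumes fin: "finite \<M>" and ne: "\<And>M. M \<in> \<M> \<Longrightarrow> \<exists>x\<in>M. x \<noteq> 0"
  obtains c where "\<And>M. M \<in> \<M> \<Longrightarrow> \<exists>x\<in>M. c \<bullet> x \<noteq> 0"
proof -
  obtain f where f: "\<And>M. M \<in> \<M> \<Longrightarrow> f M \<in> M \<and> f M \<noteq> 0" using ne by metis
  have "negligible (\<Union>M\<in>\<M>. {y. f M \<bullet> y = 0})"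
    using fin f by (intro negligible_Union) (auto intro: negligible_hyperplane)
  then have "(\<Union>M\<in>\<M>. {y. f M \<bullet> y = 0}) \<noteq> UNIV" using non_negligible_UNIV by metis
  then obtain c where "c \<notin> (\<Union>M\<in>\<M>. {y. f M \<bullet> y = 0})" by blast
  then have "\<exists>x\<in>M. c \<bullet> x \<noteq> 0" if "M \<in> \<M>" for M
    using f[OF that] that by (intro bexI[of _ "f M"]) (auto simp: inner_commute)
  then show ?thesis by (rule that)
qed

text \<open>Read backwards, this is a source of genericity: a displacement that does not vanish on
  \<open>ds A \<inter> ds B\<close> cannot select the pair.\<close>

lemma dpair_orthogonal:
  assumes "dpair \<gamma> a A B" "x \<in> ds A" "x \<in> ds B"
  shows "a \<bullet> x = 0"
proof -
  obtain w where w: "A \<subseteq> amax \<gamma> (w - a)" "B \<subseteq> amax \<gamma> w" using assms(1) by (auto simp: dpair_def)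
  have "(w - a) \<bullet> x = 0" "w \<bullet> x = 0" using amax_orthogonal[OF w(1) assms(2)] amax_orthogonal[OF w(2) assms(3)] by auto
  then show ?thesis by (simp add: inner_diff_left)
qed

text \<open>It suffices to avoid finitely many hyperplanes: if a point of the segment from \<open>a\<close> to \<open>c\<close> other
  than \<open>a\<close> annihilates a space, then \<open>c\<close> annihilates the part of it that \<open>a\<close> annihilates.\<close>

lemma generic_displacement:
  fixes X :: "'a::euclidean_space set set"
  assumes X: "polytopal X" and K: "finite K"
  obtains c where "\<And>\<gamma>. \<gamma> \<in> X \<Longrightarrow> adm \<gamma> c"
    and "\<And>\<gamma> a. \<gamma> \<in> X \<Longrightarrow> a \<in> K \<Longrightarrow> adm \<gamma> a \<Longrightarrow> hadm \<gamma> a (c - a)"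
proof -
  \<comment> \<open>The entry 0 next to \<open>K\<close> yields the full intersections, needed for
    \<open>c\<close> itself; an entry \<open>a\<close> of \<open>K\<close> yields the part that
    \<open>a\<close> annihilates, needed for the segment starting at \<open>a\<close>. Trivial
    spaces are removed, as nothing can be non-zero on them.\<close>
  define \<M> where "\<M> = {M \<in> (\<lambda>(A, B, a). ds A \<inter> ds B \<inter> {y. a \<bullet> y = 0}) ` (X \<times> X \<times> insert 0 K). \<exists>x\<in>M. x \<noteq> 0}"
  have finX: "finite X" and faceX: "\<And>\<gamma> A. \<gamma> \<in> X \<Longrightarrow> A face_of \<gamma> \<Longrightarrow> A \<noteq> {} \<Longrightarrow> A \<in> X"
    using X unfolding polytopal_def by blast+
  have "finite \<M>" unfolding \<M>_def using finX K by simp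
  then obtain c where c: "\<And>M. M \<in> \<M> \<Longrightarrow> \<exists>x\<in>M. c \<bullet> x \<noteq> 0"
    by (rule generic_functional) (auto simp: \<M>_def)
  have gen: "x = 0"
    if "A \<in> X" "B \<in> X" "a \<in> insert 0 K" and x: "x \<in> ds A" "x \<in> ds B" "a \<bullet> x = 0"
      and perp: "\<And>y. y \<in> ds A \<Longrightarrow> y \<in> ds B \<Longrightarrow> a \<bullet> y = 0 \<Longrightarrow> c \<bullet> y = 0" for A B a x
  proof (rule ccontr)
    assume "x \<noteq> 0"
    then have "ds A \<inter> ds B \<inter> {y. a \<bullet> y = 0} \<in> \<M>" unfolding \<M>_def using that by (auto intro!: image_eqI[of _ _ "(A, B, a)"])
    from c[OF this] perp show False by blast
  qed
  have zero: "ds A \<inter> ds B = {0}" if "A \<in> X" "B \<in> X" "dpair \<gamma> c A B" for A B \<gamma>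
    using gen[OF that(1,2), of 0] dpair_orthogonal[OF that(3)] subspace_0[OF subspace_ds[of A]] subspace_0[OF subspace_ds[of B]]
    by auto
  show ?thesis
  proof (rule that)
    show "adm \<gamma> c" if "\<gamma> \<in> X" for \<gamma> unfolding adm_def using zero faceX[OF that] by blast
    fix \<gamma> a assume \<gamma>: "\<gamma> \<in> X" and a: "a \<in> K" and adm: "adm \<gamma> a"
    show "hadm \<gamma> a (c - a)" unfolding hadm_def
    proof (intro allI ballI impI)
      fix A B t
      assume t: "t \<in> {0..1::real}" and AB: "A face_of \<gamma> \<and> A \<noteq> {} \<and> B face_of \<gamma> \<and> B \<noteq> {} \<and>
        dpair \<gamma> (a + t *\<^sub>R (c - a)) A B \<and> cell_dim \<gamma> \<le> cell_dim A + cell_dim B"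
      have ABX: "A \<in> X" "B \<in> X" using faceX[OF \<gamma>] AB by auto
      show "(\<forall>x\<in>ds A \<inter> ds B. (c - a) \<bullet> x = 0 \<longrightarrow> x = 0) \<and> (t = 0 \<or> t = 1 \<longrightarrow> ds A \<inter> ds B = {0})"
      proof (cases "t = 0")
        case True
        then have "ds A \<inter> ds B = {0}" using AB admD[OF adm] by simp
        then show ?thesis by auto
      next
        case False
        \<comment> \<open>At a time other than 0 this makes \<open>c\<close> vanish wherever
          \<open>a\<close> vanishes on the intersection, so by the choice of \<open>c\<close> that
          part is trivial. A vector killed by \<open>c - a\<close> has equal values under
          \<open>a\<close> and \<open>c\<close>, hence both are 0 and it lies in that part.\<close>
        have perp: "(1 - t) * (a \<bullet> y) + t * (c \<bullet> y) = 0" if "y \<in> ds A" "y \<in> ds B" for y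
          using dpair_orthogonal[of \<gamma> "a + t *\<^sub>R (c - a)" A B y] AB that
          by (simp add: inner_add_left inner_diff_left algebra_simps)
        have "x = 0" if x: "x \<in> ds A" "x \<in> ds B" "(c - a) \<bullet> x = 0" for x
        proof (rule gen[OF ABX _ x(1,2)])
          have "c \<bullet> x = a \<bullet> x" using x(3) by (simp add: inner_diff_left)
          then show "a \<bullet> x = 0" using perp[OF x(1,2)] by (simp add: algebra_simps)
          show "c \<bullet> y = 0" if "y \<in> ds A" "y \<in> ds B" "a \<bullet> y = 0" for y using perp[OF that(1,2)] that(3) False by simp
        qed (use a in simp)
        moreover have "ds A \<inter> ds B = {0}" if "t = 1" using zero[OF ABX, of \<gamma>] AB that by simp
        ultimately show ?thesis using False by blast
      qed
    qed
  qed
qed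

section \<open>Convenient points\<close>

definition annihilator :: "'a::euclidean_space set \<Rightarrow> 'a set \<Rightarrow> ('a \<Rightarrow> real) set"
  where "annihilator W S = {w \<in> dual_space W. \<forall>x\<in>S. w x = 0}"

text \<open>Representing functionals by vectors of \<open>W\<close> identifies the annihilator with
  the orthogonal complement of \<open>S\<close> in \<open>W\<close>.\<close>

lemma dim_annihilator:
  fixes W S :: "'a::euclidean_space set"
  assumes W: "subspace W" and S: "subspace S" "S \<subseteq> W"
  shows "dim (annihilator W S) + dim S = dim W"
proof -
  let ?P = "{y \<in> W. \<forall>x\<in>S. orthogonal x y}"
  define \<Phi> where "\<Phi> = (\<lambda>a x. if x \<in> W then a \<bullet> x else 0 :: real)"
  have lin: "linear \<Phi>"
    by (rule linearI) (auto simp: \<Phi>_def fun_eq_iff inner_add_left scaleR_fun_def)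
  have sub: "subspace ?P"
    using W by (auto simp: subspace_def orthogonal_def inner_add_right)
  have inj: "inj_on \<Phi> ?P"
  proof (rule inj_onI)
    fix x y assume xy: "x \<in> ?P" "y \<in> ?P" "\<Phi> x = \<Phi> y"
    then have "x - y \<in> W" using W by (auto intro: subspace_diff)
    then have "(x - y) \<bullet> (x - y) = 0" using fun_cong[OF xy(3), of "x - y"] by (simp add: \<Phi>_def inner_diff_left)
    then show "x = y" by simp
  qed
  have img: "\<Phi> ` ?P = annihilator W S"
  proof
    show "\<Phi> ` ?P \<subseteq> annihilator W S"
      using S(2) dual_space_inner_mem[OF W] by (auto simp: annihilator_def \<Phi>_def orthogonal_def inner_commute)
    show "annihilator W S \<subseteq> \<Phi> ` ?P"
    proof
      fix w assume "w \<in> annihilator W S"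
      then have w: "w \<in> dual_space W" "\<And>x. x \<in> S \<Longrightarrow> w x = 0" by (auto simp: annihilator_def)
      obtain a where a: "\<And>x. x \<in> W \<Longrightarrow> w x = a \<bullet> x" using dual_space_inner[OF W w(1)] by blast
      \<comment> \<open>The representing vector is projected to \<open>W\<close>, where it is
        unique.\<close>
      obtain y z where yz: "y \<in> span W" "\<And>x. x \<in> span W \<Longrightarrow> orthogonal z x" "a = y + z"
        using orthogonal_subspace_decomp_exists[of W a] by blast
      have y: "y \<in> W" using yz(1) W by (simp add: span_eq_iff[THEN iffD2])
      have wy: "w x = y \<bullet> x" if "x \<in> W" for x
        using a[OF that] yz(2)[OF span_base[OF that]] yz(3) by (simp add: orthogonal_def inner_add_left)
      have "w x = 0" if "x \<notin> W" for x using w(1) that by (auto simp: dual_space_def)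
      then have "w = \<Phi> y" using wy by (auto simp: \<Phi>_def fun_eq_iff)
      moreover have "x \<bullet> y = 0" if "x \<in> S" for x using wy[of x] w(2)[OF that] S(2) that by (auto simp: inner_commute)
      then have "y \<in> ?P" using y by (simp add: orthogonal_def)
      ultimately show "w \<in> \<Phi> ` ?P" by blast
    qed
  qed
  \<comment> \<open>The image lies in a function space of infinite dimension, so its dimension is
    read off from the image of a basis.\<close>
  obtain B where B: "B \<subseteq> ?P" "independent B" "?P \<subseteq> span B" "card B = dim ?P" using basis_exists by blast
  have spanB: "span B = ?P" using B(1,3) sub by (simp add: span_minimal subset_antisym)
  have "independent (\<Phi> ` B)" using linear_independent_injective_image[OF lin B(2)] inj spanB by simp
  moreover have "span (\<Phi> ` B) = \<Phi> ` ?P" using linear_span_image[OF lin, of B] spanB by simp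
  moreover have "card (\<Phi> ` B) = card B" using inj B(1) by (intro card_image) (rule inj_on_subset)
  ultimately have "dim (\<Phi> ` ?P) = dim ?P" using B(4) by (metis dim_eq_card_independent dim_span)
  moreover have "dim ?P + dim S = dim W" by (rule dim_subspace_orthogonal_to_vectors[OF S(1) W S(2)])
  ultimately show ?thesis by (simp add: img)
qed

text \<open>Let \<open>g\<close> be maximal exactly on \<open>A\<close> and let \<open>b\<close>
  vanish on \<open>ds A\<close>. For large \<open>s\<close> both \<open>b + s g\<close> and
  \<open>s g\<close> lie in the cone, and their difference is \<open>b\<close>.\<close>

lemma ds_dual_cone:
  fixes \<gamma> :: "'a::euclidean_space set"
  assumes \<gamma>: "polytope \<gamma>" and A: "A face_of \<gamma>" "A \<noteq> {}"
  shows "ds (dual_cone \<gamma> A) = annihilator (ds \<gamma>) (ds A)"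
proof
  have sub: "A \<subseteq> \<gamma>" and ne: "\<gamma> \<noteq> {}" using A face_of_imp_subset by blast+
  have dsub: "ds A \<subseteq> ds \<gamma>" by (rule ds_mono[OF sub])
  show "ds (dual_cone \<gamma> A) \<subseteq> annihilator (ds \<gamma>) (ds A)"
  proof (rule ds_least)
    show "subspace (annihilator (ds \<gamma>) (ds A))"
      by (auto simp: subspace_def annihilator_def dual_space_def scaleR_fun_def algebra_simps)
    then have diff: "f - g \<in> annihilator (ds \<gamma>) (ds A)"
      if "f \<in> annihilator (ds \<gamma>) (ds A)" "g \<in> annihilator (ds \<gamma>) (ds A)" for f g
      using that by (rule subspace_diff)
    have "w \<in> annihilator (ds \<gamma>) (ds A)" if w: "w \<in> dual_cone \<gamma> A" for w
    proof -
      have wd: "w \<in> dual_space (ds \<gamma>)" using w by (simp add: dual_cone_def)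
      obtain b where b: "\<And>x. x \<in> ds \<gamma> \<Longrightarrow> w x = b \<bullet> x" using dual_space_inner[OF subspace_ds wd] by blast
      have "A \<subseteq> amax \<gamma> b" using dual_cone_iff_amax[OF sub b wd ne] w by simp
      then have "w x = 0" if "x \<in> ds A" for x using amax_orthogonal[of A \<gamma> b x] b that dsub by auto
      then show ?thesis using wd by (simp add: annihilator_def)
    qed
    then show "f - g \<in> annihilator (ds \<gamma>) (ds A)" if "f \<in> dual_cone \<gamma> A" "g \<in> dual_cone \<gamma> A" for f g
      using that diff by blast
  qed
  show "annihilator (ds \<gamma>) (ds A) \<subseteq> ds (dual_cone \<gamma> A)"
  proof
    fix w assume w: "w \<in> annihilator (ds \<gamma>) (ds A)"
    then have wd: "w \<in> dual_space (ds \<gamma>)" by (simp add: annihilator_def)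
    obtain b where b: "\<And>x. x \<in> ds \<gamma> \<Longrightarrow> w x = b \<bullet> x" using dual_space_inner[OF subspace_ds wd] by blast
    obtain g where g: "amax \<gamma> g = A" using polytope_face_amax[OF \<gamma> A] .
    have "b \<bullet> z = 0" if "z \<in> ds A" for z using w b[of z] that dsub by (auto simp: annihilator_def)
    then have "A \<subseteq> amax (amax \<gamma> g) b" using g by (simp add: amax_const)
    from amax_add_large[OF \<gamma> this] obtain s0 where s0: "\<And>s. s0 \<le> s \<Longrightarrow> A \<subseteq> amax \<gamma> (b + s *\<^sub>R g)" by blast
    \<comment> \<open>At least 1, so that \<open>s g\<close> is still maximal on
      \<open>A\<close>.\<close>
    define s where "s = max s0 1"
    have s: "A \<subseteq> amax \<gamma> (b + s *\<^sub>R g)" "A \<subseteq> amax \<gamma> (s *\<^sub>R g)"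
      using s0[of s] g amax_scale[of s \<gamma> g] by (auto simp: s_def)
    let ?F = "\<lambda>h x. if x \<in> ds \<gamma> then h \<bullet> x else 0"
    have F: "?F h \<in> dual_cone \<gamma> A" if "A \<subseteq> amax \<gamma> h" for h
      using dual_cone_iff_amax[OF sub _ dual_space_inner_mem[OF subspace_ds] ne, of h h] that by simp
    have "w x = 0" if "x \<notin> ds \<gamma>" for x using wd that by (auto simp: dual_space_def)
    then have "w = ?F (b + s *\<^sub>R g) - ?F (s *\<^sub>R g)" using b by (auto simp: fun_eq_iff inner_add_left)
    then show "w \<in> ds (dual_cone \<gamma> A)" using ds_diff[OF F[OF s(1)] F[OF s(2)]] by simp
  qed
qed

lemma ds_translate: "ds ((+) t ` C) = ds C"
proof -
  have "(t + x) - (t + y) = x - y" for x y by simp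
  then have "{x - y |x y. x \<in> (+) t ` C \<and> y \<in> (+) t ` C} = {x - y |x y. x \<in> C \<and> y \<in> C}"
    unfolding image_iff by (metis (no_types, opaque_lifting))
  then show ?thesis by (simp only: direction_space_def)
qed

text \<open>Annihilators intersect in the annihilator of the sum, whose codimension is the dimension
  of \<open>ds A + ds B\<close>. Additivity of codimensions is therefore additivity of dimensions
  for the sum, which means trivial intersection.\<close>

lemma convenient_adm:
  fixes V :: "'a::euclidean_space set"
  assumes X: "polytopal X" and v: "v \<in> convenient V X" and \<gamma>: "\<gamma> \<in> X"
    and a: "\<And>x. x \<in> ds \<gamma> \<Longrightarrow> v x = a \<bullet> x"
  shows "adm \<gamma> a"
  unfolding adm_def
proof (intro allI impI, elim conjE)
  fix A B
  assume A: "A face_of \<gamma>" "A \<noteq> {}" and B: "B face_of \<gamma>" "B \<noteq> {}" and dp: "dpair \<gamma> a A B"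
    and d: "cell_dim \<gamma> \<le> cell_dim A + cell_dim B"
  have poly: "polytope \<gamma>" and ne: "\<gamma> \<noteq> {}" using X \<gamma> by (auto simp: polytopal_def)
  have sub: "A \<subseteq> \<gamma>" "B \<subseteq> \<gamma>" using A B face_of_imp_subset by blast+
  \<comment> \<open>As \<open>A \<subseteq> \<gamma>\<close>, this is the dimension of
    \<open>A\<close>; the minimum makes \<open>p + q\<close> the dimension of
    \<open>\<gamma>\<close> by arithmetic alone. The cone of \<open>A\<close> then has dimension
    \<open>q\<close> and that of \<open>B\<close> at most \<open>p\<close>, so both lie in the
    required skeleta.\<close>
  define p where "p = min (cell_dim A) (cell_dim \<gamma>)"
  define q where "q = cell_dim \<gamma> - p"
  have pq: "cell_dim \<gamma> = p + q" "p \<le> cell_dim A" "q \<le> cell_dim B" using d by (auto simp: p_def q_def)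
  let ?E = "ds \<gamma>" and ?D = "dual_space (ds \<gamma>)"
  have dimAB: "dim (annihilator ?E (ds A)) + cell_dim A = cell_dim \<gamma>" "dim (annihilator ?E (ds B)) + cell_dim B = cell_dim \<gamma>"
    unfolding cell_dim_def by (intro dim_annihilator subspace_ds ds_mono sub)+
  have "v \<in> convenient_pq V X p q" using v by (auto simp: convenient_def)
  then have tr: "transversal ?D ((\<lambda>C. (+) (restrict_dual \<gamma> v) ` C) ` skeleton q (dual_fan \<gamma>)) (skeleton p (dual_fan \<gamma>))"
    using \<gamma> pq(1) by (auto simp: convenient_pq_def)
  have mem: "dual_cone \<gamma> A \<in> skeleton q (dual_fan \<gamma>)" "dual_cone \<gamma> B \<in> skeleton p (dual_fan \<gamma>)"
  proof -
    have "dual_cone \<gamma> A \<in> dual_fan \<gamma>" "dual_cone \<gamma> B \<in> dual_fan \<gamma>" using A B unfolding dual_fan_def by blast+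
    moreover have "cell_dim (dual_cone \<gamma> A) \<le> q" "cell_dim (dual_cone \<gamma> B) \<le> p"
      using dimAB pq unfolding cell_dim_def[of "dual_cone \<gamma> A"] cell_dim_def[of "dual_cone \<gamma> B"]
        ds_dual_cone[OF poly A] ds_dual_cone[OF poly B] by linarith+
    ultimately show "dual_cone \<gamma> A \<in> skeleton q (dual_fan \<gamma>)" "dual_cone \<gamma> B \<in> skeleton p (dual_fan \<gamma>)"
      by (simp_all add: skeleton_def)
  qed
  have meet: "(+) (restrict_dual \<gamma> v) ` dual_cone \<gamma> A \<inter> dual_cone \<gamma> B \<noteq> {}"
    using dual_cones_meet_iff[OF sub a ne] dp by blast
  have "codim_in ?D (ds ((+) (restrict_dual \<gamma> v) ` dual_cone \<gamma> A) \<inter> ds (dual_cone \<gamma> B)) =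
      codim_in ?D (ds ((+) (restrict_dual \<gamma> v) ` dual_cone \<gamma> A)) + codim_in ?D (ds (dual_cone \<gamma> B))"
    by (rule bspec[OF bspec[OF tr[unfolded transversal_def] imageI[OF mem(1)]] mem(2), THEN mp, OF meet])
  then have eq: "codim_in ?D (annihilator ?E (ds A) \<inter> annihilator ?E (ds B)) =
      codim_in ?D (annihilator ?E (ds A)) + codim_in ?D (annihilator ?E (ds B))"
    by (simp add: ds_translate ds_dual_cone[OF poly A] ds_dual_cone[OF poly B])
  have "dim ?D = dim ?E"
  proof -
    have "w 0 = 0" if w: "w \<in> ?D" for w
    proof -
      obtain b where "\<And>x. x \<in> ds \<gamma> \<Longrightarrow> w x = b \<bullet> x" using dual_space_inner[OF subspace_ds w] by blast
      then show ?thesis using subspace_0[OF subspace_ds[of \<gamma>]] by simp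
    qed
    then have "annihilator ?E {0} = ?D" by (auto simp: annihilator_def)
    then show ?thesis using dim_annihilator[OF subspace_ds, of "{0}" \<gamma>] subspace_0[OF subspace_ds[of \<gamma>]] by simp
  qed
  moreover have "annihilator ?E (ds A) \<inter> annihilator ?E (ds B) = annihilator ?E (msum (ds A) (ds B))"
  proof -
    have "ds A \<subseteq> msum (ds A) (ds B)" "ds B \<subseteq> msum (ds A) (ds B)"
      using subspace_0[OF subspace_ds[of A]] subspace_0[OF subspace_ds[of B]] unfolding msum_def by force+
    moreover have "w z = 0" if w: "w \<in> ?D" "\<forall>x\<in>ds A. w x = 0" "\<forall>x\<in>ds B. w x = 0" "z \<in> msum (ds A) (ds B)" for w z
    proof -
      obtain x y where xy: "x \<in> ds A" "y \<in> ds B" "z = x + y" using w(4) unfolding msum_def by blast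
      then have "x \<in> ?E" "y \<in> ?E" using ds_mono[OF sub(1)] ds_mono[OF sub(2)] by auto
      then show ?thesis using w(1-3) xy by (auto simp: dual_space_def)
    qed
    ultimately show ?thesis unfolding annihilator_def by blast
  qed
  moreover have "dim (annihilator ?E (msum (ds A) (ds B))) + dim (msum (ds A) (ds B)) = dim ?E"
    by (intro dim_annihilator subspace_ds subspace_msum msum_subset ds_mono sub)
  ultimately have "dim (msum (ds A) (ds B)) = dim (ds A) + dim (ds B)"
    using eq dimAB by (simp add: codim_in_def cell_dim_def)
  then have "dim (ds A \<inter> ds B) = 0"
    using dim_sums_Int[OF subspace_ds[of A] subspace_ds[of B]] by (simp add: msum_def)
  then have "ds A \<inter> ds B \<subseteq> {0}" by (simp add: dim_eq_0)
  then show "ds A \<inter> ds B = {0}" using subspace_0[OF subspace_ds[of A]] subspace_0[OF subspace_ds[of B]] by auto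
qed

section \<open>Cohomology classes\<close>

lemma coboundary_add:
  fixes r s :: "('a::euclidean_space, 's::ring) cochain"
  shows "coboundary X p (r + s) = coboundary X p r + coboundary X p s"
  by (auto simp: coboundary_def fun_eq_iff sum.distrib)

lemma coboundary_0: "coboundary X p (0 :: ('a::euclidean_space, 's::ring) cochain) = 0"
  by (auto simp: coboundary_def fun_eq_iff)

lemma coboundary_uminus:
  fixes r :: "('a::euclidean_space, 's::ring) cochain"
  shows "coboundary X p (- r) = - coboundary X p r"
  by (auto simp: coboundary_def fun_eq_iff sum_negf)

lemma cochains_0: "0 \<in> cochains X p"
  by (auto simp: cochains_def)

lemma cochains_add: "r \<in> cochains X p \<Longrightarrow> s \<in> cochains X p \<Longrightarrow> r + s \<in> cochains X p"
  by (auto simp: cochains_def)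

lemma cochains_uminus: "r \<in> cochains X p \<Longrightarrow> - r \<in> cochains X p"
  by (auto simp: cochains_def)

lemma cocycles_iff:
  "r \<in> cocycles X p \<longleftrightarrow> r \<in> cochains X p \<and> coboundary X p r = 0"
  by (auto simp: cocycles_def kernel_def cochain_group_def)

lemma cocycles_add: "r \<in> cocycles X p \<Longrightarrow> s \<in> cocycles X p \<Longrightarrow> r + s \<in> cocycles X p"
  by (simp add: cocycles_iff cochains_add coboundary_add)

lemma coboundaries_0: "0 \<in> coboundaries X p"
  by (cases p) (auto simp: coboundaries_def intro!: image_eqI[of _ _ 0] coboundary_0[symmetric] cochains_0)

lemma coboundaries_add:
  "r \<in> coboundaries X p \<Longrightarrow> s \<in> coboundaries X p \<Longrightarrow> r + s \<in> coboundaries X p"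
  by (cases p) (auto simp: coboundaries_def coboundary_add[symmetric] intro!: imageI cochains_add)

lemma coboundaries_uminus: "r \<in> coboundaries X p \<Longrightarrow> - r \<in> coboundaries X p"
  by (cases p) (auto simp: coboundaries_def coboundary_uminus[symmetric] intro!: imageI cochains_uminus)

lemma cohomology_class_eq:
  "cohomology_class X p r = {h + r |h. h \<in> coboundaries X p}"
  by (auto simp: cohomology_class_def r_coset_def cocycle_group_def cochain_group_def)

lemma cohomology_class_eq_iff:
  "cohomology_class X p r = cohomology_class X p s \<longleftrightarrow> r - s \<in> coboundaries X p"
proof
  assume eq: "cohomology_class X p r = cohomology_class X p s"
  have "0 + r \<in> cohomology_class X p r" using coboundaries_0 unfolding cohomology_class_eq by blast
  then obtain h where "h \<in> coboundaries X p" "0 + r = h + s" unfolding eq by (auto simp: cohomology_class_eq)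
  then show "r - s \<in> coboundaries X p" by simp
next
  have sub: "cohomology_class X p x \<subseteq> cohomology_class X p y" if "x - y \<in> coboundaries X p" for x y
  proof
    fix z assume "z \<in> cohomology_class X p x"
    then obtain h where h: "h \<in> coboundaries X p" "z = h + x" by (auto simp: cohomology_class_eq)
    then have "z = (h + (x - y)) + y" by simp
    then show "z \<in> cohomology_class X p y" using coboundaries_add[OF h(1) that] unfolding cohomology_class_eq by blast
  qed
  assume "r - s \<in> coboundaries X p"
  then show "cohomology_class X p r = cohomology_class X p s"
    using sub[of r s] sub[of s r] coboundaries_uminus[of "r - s" X p] by simp
qed

lemma carrier_cohomology: "carrier (cohomology X p) = cohomology_class X p ` cocycles X p"
  by (auto simp: cohomology_def FactGroup_def RCOSETS_def cohomology_class_def cocycle_group_def)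

lemma mult_cohomology:
  fixes r s :: "('a::euclidean_space, 's::ring) cochain"
  shows "mult (cohomology X p) (cohomology_class X p r) (cohomology_class X p s) = cohomology_class X p (r + s)"
proof -
  have "mult (cohomology X p) A B = {a + b |a b. a \<in> A \<and> b \<in> B}"
    for A B :: "('a, 's) cochain set"
    by (auto simp: cohomology_def FactGroup_def set_mult_def cocycle_group_def cochain_group_def)
  moreover have "{a + b |a b. a \<in> cohomology_class X p r \<and> b \<in> cohomology_class X p s} = cohomology_class X p (r + s)"
  proof (intro equalityI subsetI)
    fix x assume "x \<in> {a + b |a b. a \<in> cohomology_class X p r \<and> b \<in> cohomology_class X p s}"
    then obtain h k where hk: "h \<in> coboundaries X p" "k \<in> coboundaries X p" "x = (h + r) + (k + s)"
      by (auto simp: cohomology_class_eq)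
    then have "x = (h + k) + (r + s)" by simp
    then show "x \<in> cohomology_class X p (r + s)" using coboundaries_add[OF hk(1,2)] unfolding cohomology_class_eq by blast
  next
    fix x assume "x \<in> cohomology_class X p (r + s)"
    then obtain h where h: "h \<in> coboundaries X p" "x = h + (r + s)" by (auto simp: cohomology_class_eq)
    then have "x = (h + r) + (0 + s)" by (simp add: add.assoc)
    then show "x \<in> {a + b |a b. a \<in> cohomology_class X p r \<and> b \<in> cohomology_class X p s}"
      using h(1) coboundaries_0 unfolding cohomology_class_eq by blast
  qed
  ultimately show ?thesis by simp
qed

section \<open>The induced product on cohomology\<close>

lemma product_term_add_left: "product_term (r + r') s \<gamma> \<omega> \<delta> \<eta> = product_term r s \<gamma> \<omega> \<delta> \<eta> + product_term r' s \<gamma> \<omega> \<delta> \<eta>"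
  by (simp add: product_term_def Let_def split_beta distrib_right)

lemma product_term_add_right: "product_term r (s + s') \<gamma> \<omega> \<delta> \<eta> = product_term r s \<gamma> \<omega> \<delta> \<eta> + product_term r s' \<gamma> \<omega> \<delta> \<eta>"
  by (simp add: product_term_def Let_def split_beta distrib_left)

lemma cochain_product_add_left:
  "cochain_product X v p q (r + r') s = cochain_product X v p q r s + cochain_product X v p q r' s"
  by (auto simp: cochain_product_def fun_eq_iff product_term_add_left sum.distrib[symmetric] split_beta)

lemma cochain_product_add_right:
  "cochain_product X v p q r (s + s') = cochain_product X v p q r s + cochain_product X v p q r s'"
  by (auto simp: cochain_product_def fun_eq_iff product_term_add_right sum.distrib[symmetric] split_beta)

lemma cochain_product_0_left: "cochain_product X v p q 0 s = 0"
  using cochain_product_add_left[of X v p q 0 0 s] by simp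

lemma cochain_product_0_right: "cochain_product X v p q r 0 = 0"
  using cochain_product_add_right[of X v p q r 0 0] by simp

definition represents :: "'a::euclidean_space set set \<Rightarrow> ('a \<Rightarrow> real) \<Rightarrow> 'a \<Rightarrow> bool"
  where "represents X v a \<longleftrightarrow> (\<forall>\<gamma>\<in>X. (\<forall>x\<in>ds \<gamma>. v x = a \<bullet> x) \<and> adm \<gamma> a)"

lemma product_cocycle:
  assumes X: "polytopal X" and v: "represents X v a"
    and r: "r \<in> cocycles X p" and s: "s \<in> cocycles X q"
  shows "cochain_product X v p q r s \<in> cocycles X (p + q)"
proof -
  have v': "\<And>\<gamma> x. \<gamma> \<in> X \<Longrightarrow> x \<in> ds \<gamma> \<Longrightarrow> v x = a \<bullet> x" "\<And>\<gamma>. \<gamma> \<in> X \<Longrightarrow> adm \<gamma> a" using v by (auto simp: represents_def)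
  have rs: "r \<in> cochains X p" "coboundary X p r = 0" "s \<in> cochains X q" "coboundary X q s = 0"
    using r s by (auto simp: cocycles_iff)
  have "cochain_product X v p q r s \<in> cochains X (p + q)" by (rule cochain_product_cochain[OF X v' rs(1,3)])
  moreover have "coboundary X (p + q) (cochain_product X v p q r s) c = 0" for c
    using leibniz[where v = v and a = a and c = c, OF X v' rs(1,3)]
    by (simp add: rs(2,4) cochain_product_0_left cochain_product_0_right)
  ultimately show ?thesis by (auto simp: cocycles_iff)
qed

text \<open>If \<open>r\<close> is the coboundary of \<open>y\<close>, the Leibniz rule makes the
  product the coboundary of the product of \<open>y\<close> and \<open>s\<close>, because
  \<open>s\<close> is closed.\<close>

lemma product_coboundary_left:
  assumes X: "polytopal X" and v: "represents X v a"
    and r: "r \<in> coboundaries X p" and s: "s \<in> cocycles X q"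
  shows "cochain_product X v p q r s \<in> coboundaries X (p + q)"
proof (cases p)
  case 0
  then show ?thesis using r by (simp add: coboundaries_def[of X 0] cochain_product_0_left coboundaries_0)
next
  case (Suc k)
  have v': "\<And>\<gamma> x. \<gamma> \<in> X \<Longrightarrow> x \<in> ds \<gamma> \<Longrightarrow> v x = a \<bullet> x" "\<And>\<gamma>. \<gamma> \<in> X \<Longrightarrow> adm \<gamma> a" using v by (auto simp: represents_def)
  obtain y where y: "y \<in> cochains X k" "r = coboundary X k y" using r Suc by (auto simp: coboundaries_def)
  have s': "s \<in> cochains X q" "coboundary X q s = 0" using s by (auto simp: cocycles_iff)
  have "coboundary X (k + q) (cochain_product X v k q y s) c = cochain_product X v (Suc k) q (coboundary X k y) s c" for c
    using leibniz[where v = v and a = a and c = c, OF X v' y(1) s'(1)] by (simp add: s'(2) cochain_product_0_right)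
  then have "cochain_product X v p q r s = coboundary X (k + q) (cochain_product X v k q y s)" using Suc y(2) by auto
  then show ?thesis
    using cochain_product_cochain[where v = v and a = a, OF X v' y(1) s'(1)] Suc by (simp add: coboundaries_def)
qed

lemma product_coboundary_right:
  assumes X: "polytopal X" and v: "represents X v a"
    and r: "r \<in> cocycles X p" and s: "s \<in> coboundaries X q"
  shows "cochain_product X v p q r s \<in> coboundaries X (p + q)"
proof (cases q)
  case 0
  then show ?thesis using s by (simp add: coboundaries_def[of X 0] cochain_product_0_right coboundaries_0)
next
  case (Suc k)
  have v': "\<And>\<gamma> x. \<gamma> \<in> X \<Longrightarrow> x \<in> ds \<gamma> \<Longrightarrow> v x = a \<bullet> x" "\<And>\<gamma>. \<gamma> \<in> X \<Longrightarrow> adm \<gamma> a" using v by (auto simp: represents_def)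
  obtain y where y: "y \<in> cochains X k" "s = coboundary X k y" using s Suc by (auto simp: coboundaries_def)
  have r': "r \<in> cochains X p" "coboundary X p r = 0" using r by (auto simp: cocycles_iff)
  let ?y = "cochain_product X v p k r y"
  have c: "coboundary X (p + k) ?y c = zs ((- 1) ^ p) (cochain_product X v p q r s c)" for c
    using leibniz[where v = v and a = a and c = c, OF X v' r'(1) y(1)]
    by (simp add: r'(2) cochain_product_0_left y(2) Suc)
  have mem: "coboundary X (p + k) ?y \<in> coboundaries X (p + q)"
    using cochain_product_cochain[where v = v and a = a, OF X v' r'(1) y(1)] Suc by (simp add: coboundaries_def)
  show ?thesis
  \<comment> \<open>The Leibniz rule gives the product only up to the sign acting through
    \<open>zs\<close>; coboundaries are closed under negation.\<close>
  proof (cases "even p")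
    case True
    then have "cochain_product X v p q r s = coboundary X (p + k) ?y" by (simp add: c fun_eq_iff)
    then show ?thesis using mem by simp
  next
    case False
    then have "cochain_product X v p q r s = - coboundary X (p + k) ?y"
      by (simp add: c fun_eq_iff zs_minus[of 1, simplified])
    then show ?thesis using coboundaries_uminus[OF mem] by simp
  qed
qed

lemma product_class_cong:
  assumes X: "polytopal X" and v: "represents X v a"
    and r: "r \<in> cocycles X p" "r' \<in> cocycles X p" "cohomology_class X p r = cohomology_class X p r'"
    and s: "s \<in> cocycles X q" "s' \<in> cocycles X q" "cohomology_class X q s = cohomology_class X q s'"
  shows "cohomology_class X (p + q) (cochain_product X v p q r s) =
    cohomology_class X (p + q) (cochain_product X v p q r' s')"
proof -
  have "cochain_product X v p q (r' + (r - r')) s = cochain_product X v p q r' s + cochain_product X v p q (r - r') s"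
    by (rule cochain_product_add_left)
  moreover have "cochain_product X v p q r' (s' + (s - s')) = cochain_product X v p q r' s' + cochain_product X v p q r' (s - s')"
    by (rule cochain_product_add_right)
  ultimately have "cochain_product X v p q r s - cochain_product X v p q r' s' =
      cochain_product X v p q (r - r') s + cochain_product X v p q r' (s - s')" by simp
  also have "\<dots> \<in> coboundaries X (p + q)"
    using r s by (intro coboundaries_add product_coboundary_left[OF X v] product_coboundary_right[OF X v])
      (simp_all add: cohomology_class_eq_iff)
  finally show ?thesis by (simp add: cohomology_class_eq_iff)
qed

lemma induced_product_exists:
  assumes X: "polytopal X" and v: "represents X v a"
  shows "\<exists>m :: ('a::euclidean_space, 's::ring) cohomology_product. induced_product X v p q m"
proof -
  let ?cl = "cohomology_class X :: nat \<Rightarrow> ('a, 's) cochain \<Rightarrow> _"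
  define rep :: "nat \<Rightarrow> ('a, 's) cochain set \<Rightarrow> ('a, 's) cochain"
    where "rep p A = (SOME r. r \<in> cocycles X p \<and> ?cl p r = A)" for p A
  have rep: "rep p (?cl p r) \<in> cocycles X p \<and> ?cl p (rep p (?cl p r)) = ?cl p r" if "r \<in> cocycles X p" for p r
    unfolding rep_def by (rule someI[of _ r]) (use that in simp)
  \<comment> \<open>Chosen representatives, with the function restricted to the carriers:
    extensionality there is what makes the product unique as a function.\<close>
  define m :: "('a, 's) cohomology_product" where
    "m = (\<lambda>(A, B)\<in>carrier (cohomology X p) \<times> carrier (cohomology X q).
      ?cl (p + q) (cochain_product X v p q (rep p A) (rep q B)))"
  have m: "m (?cl p r, ?cl q s) = ?cl (p + q) (cochain_product X v p q r s)"
    if "r \<in> cocycles X p" "s \<in> cocycles X q" for r s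
  proof -
    have "m (?cl p r, ?cl q s) = ?cl (p + q) (cochain_product X v p q (rep p (?cl p r)) (rep q (?cl q s)))"
      using that by (simp add: m_def carrier_cohomology)
    also have "\<dots> = ?cl (p + q) (cochain_product X v p q r s)"
      using rep that by (intro product_class_cong[OF X v]) auto
    finally show ?thesis .
  qed
  have closed: "m (A, B) \<in> carrier (cohomology X (p + q))"
    if "A \<in> carrier (cohomology X p)" "B \<in> carrier (cohomology X q)" for A B
    using that by (auto simp: carrier_cohomology m intro!: imageI product_cocycle[OF X v])
  have "m \<in> extensional (carrier (cohomology X p) \<times> carrier (cohomology X q))" by (simp add: m_def)
  then have "m \<in> carrier (cohomology X p) \<times> carrier (cohomology X q) \<rightarrow>\<^sub>E carrier (cohomology X (p + q))"
    using closed by (auto simp: PiE_def)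
  moreover have "biadditive (cohomology X p) (cohomology X q) (cohomology X (p + q)) m"
    unfolding biadditive_def
  proof (intro conjI ballI)
    fix B assume B: "B \<in> carrier (cohomology X q :: ('a, 's) cochain set monoid)"
    show "(\<lambda>A. m (A, B)) \<in> hom (cohomology X p) (cohomology X (p + q))"
    proof (rule homI)
      fix A A' :: "('a, 's) cochain set" assume "A \<in> carrier (cohomology X p)" "A' \<in> carrier (cohomology X p)"
      then show "m (A \<otimes>\<^bsub>cohomology X p\<^esub> A', B) = m (A, B) \<otimes>\<^bsub>cohomology X (p + q)\<^esub> m (A', B)"
        using B by (auto simp: carrier_cohomology mult_cohomology m cocycles_add cochain_product_add_left)
    qed (use closed B in auto)
  next
    fix A assume A: "A \<in> carrier (cohomology X p :: ('a, 's) cochain set monoid)"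
    show "(\<lambda>B. m (A, B)) \<in> hom (cohomology X q) (cohomology X (p + q))"
    proof (rule homI)
      fix B B' :: "('a, 's) cochain set" assume "B \<in> carrier (cohomology X q)" "B' \<in> carrier (cohomology X q)"
      then show "m (A, B \<otimes>\<^bsub>cohomology X q\<^esub> B') = m (A, B) \<otimes>\<^bsub>cohomology X (p + q)\<^esub> m (A, B')"
        using A by (auto simp: carrier_cohomology mult_cohomology m cocycles_add cochain_product_add_right)
    qed (use closed A in auto)
  qed
  ultimately have "induced_product X v p q m" using m by (simp add: induced_product_def)
  then show ?thesis by blast
qed

lemma induced_product_unique:
  fixes m m' :: "('a::euclidean_space, 's::ring) cohomology_product"
  assumes m: "induced_product X v p q m" and m': "induced_product X v' p q m'"
    and eq: "\<And>r s :: ('a, 's) cochain. r \<in> cocycles X p \<Longrightarrow> s \<in> cocycles X q \<Longrightarrow>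
      cohomology_class X (p + q) (cochain_product X v p q r s) = cohomology_class X (p + q) (cochain_product X v' p q r s)"
  shows "m = m'"
proof (rule PiE_ext)
  show "m \<in> carrier (cohomology X p) \<times> carrier (cohomology X q) \<rightarrow>\<^sub>E carrier (cohomology X (p + q))"
    "m' \<in> carrier (cohomology X p) \<times> carrier (cohomology X q) \<rightarrow>\<^sub>E carrier (cohomology X (p + q))"
    using m m' by (auto simp: induced_product_def)
  fix z assume "z \<in> carrier (cohomology X p :: ('a, 's) cochain set monoid) \<times> carrier (cohomology X q :: ('a, 's) cochain set monoid)"
  then obtain r s where rs: "r \<in> cocycles X p" "s \<in> cocycles X q" "z = (cohomology_class X p r, cohomology_class X q s)"
    by (auto simp: carrier_cohomology)
  then show "m z = m' z" using m m' eq[OF rs(1,2)] by (simp add: induced_product_def)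
qed

lemma product_class_homotopic:
  fixes r s :: "('a::euclidean_space, 's::ring) cochain"
  assumes X: "polytopal X" and v: "represents X v a" and v': "represents X v' c"
    and hadm: "\<And>\<gamma>. \<gamma> \<in> X \<Longrightarrow> hadm \<gamma> a (c - a)" and r: "r \<in> cocycles X p" and s: "s \<in> cocycles X q"
  shows "cohomology_class X (p + q) (cochain_product X v p q r s) = cohomology_class X (p + q) (cochain_product X v' p q r s)"
proof -
  have rs: "r \<in> cochains X p" "coboundary X p r = 0" "s \<in> cochains X q" "coboundary X q s = 0"
    using r s by (auto simp: cocycles_iff)
  have a: "\<And>\<gamma> x. \<gamma> \<in> X \<Longrightarrow> x \<in> ds \<gamma> \<Longrightarrow> v x = a \<bullet> x" "\<And>\<gamma>. \<gamma> \<in> X \<Longrightarrow> adm \<gamma> a"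
    using v by (auto simp: represents_def)
  have c: "\<And>\<gamma> x. \<gamma> \<in> X \<Longrightarrow> x \<in> ds \<gamma> \<Longrightarrow> v' x = (a + (c - a)) \<bullet> x" "\<And>\<gamma>. \<gamma> \<in> X \<Longrightarrow> adm \<gamma> (a + (c - a))"
    using v' by (auto simp: represents_def)
  let ?h = "homotopy X a (c - a) p q r s"
  have formula: "cochain_product X v' p q r s (\<gamma>, \<omega>) - cochain_product X v p q r s (\<gamma>, \<omega>) =
      (\<Sum>\<mu> | \<mu> facet_of \<gamma>. ?h (\<mu>, boundary_orientation \<gamma> \<mu> \<omega>))"
    if "(\<gamma>, \<omega>) \<in> oriented_cells X (p + q)" for \<gamma> \<omega>
    by (rule homotopy_formula[OF X a(1) c(1) a(2) c(2) hadm rs that])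
  have outside: "cochain_product X v' p q r s z - cochain_product X v p q r s z = 0" if "z \<notin> oriented_cells X (p + q)" for z
    using that by (cases z) (simp add: cochain_product_def)
  have "cochain_product X v' p q r s - cochain_product X v p q r s \<in> coboundaries X (p + q)"
  proof (cases "p + q")
    \<comment> \<open>There is no cochain of degree -1, but a cell of dimension 0 has no facets, so
      the homotopy formula gives equality of the products themselves.\<close>
    case 0
    have "cochain_product X v' p q r s z - cochain_product X v p q r s z = 0" for z
    proof (cases "z \<in> oriented_cells X (p + q)")
      case True
      obtain \<gamma> \<omega> where z: "z = (\<gamma>, \<omega>)" by (cases z)
      have "{\<mu>. \<mu> facet_of \<gamma>} = {}" using True 0 z by (auto simp: oriented_cells_def facet_iff_cell_dim)
      then show ?thesis using formula[of \<gamma> \<omega>] True z by simp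
    qed (rule outside)
    then have "cochain_product X v' p q r s - cochain_product X v p q r s = 0" by (simp add: fun_eq_iff)
    then show ?thesis by (simp only: coboundaries_0)
  next
    case (Suc k)
    have "cochain_product X v' p q r s z - cochain_product X v p q r s z = coboundary X k ?h z" for z
    proof (cases "z \<in> oriented_cells X (p + q)")
      case True
      obtain \<gamma> \<omega> where z: "z = (\<gamma>, \<omega>)" by (cases z)
      show ?thesis using formula[of \<gamma> \<omega>] True z Suc by (simp add: coboundary_def)
    next
      case False
      then show ?thesis using outside[OF False] Suc by (cases z) (simp add: coboundary_def)
    qed
    then have "cochain_product X v' p q r s - cochain_product X v p q r s = coboundary X k ?h" by (simp add: fun_eq_iff)
    then show ?thesis unfolding Suc by (simp add: coboundaries_def homotopy_cochain[OF Suc])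
  qed
  then show ?thesis by (metis cohomology_class_eq_iff)
qed

section \<open>From compact P-complexes and convenient points to generic vectors\<close>

lemma P_complex_polytopal:
  assumes "P_complex V X" "\<forall>\<gamma>\<in>X. compact \<gamma>"
  shows "polytopal X"
proof -
  note P = assms(1)[unfolded P_complex_def]
  have "\<forall>\<gamma>\<in>X. polytope \<gamma> \<and> \<gamma> \<noteq> {}"
    using conjunct1[OF conjunct2[OF P]] assms(2) by (simp add: polytope_eq_bounded_polyhedron compact_imp_bounded)
  then show ?thesis
    unfolding polytopal_def using conjunct1[OF P] conjunct1[OF conjunct2[OF conjunct2[OF P]]] by (intro conjI)
qed

text \<open>One vector serves all cells at once because \<open>v\<close> is linear on all of
  \<open>V\<close>, which contains every direction space.\<close>

lemma convenient_represents:
  fixes V :: "'a::euclidean_space set"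
  assumes V: "subspace V" and X: "P_complex V X" "polytopal X" and v: "v \<in> convenient V X"
  obtains a where "represents X v a"
proof -
  have "v \<in> dual_space V" using v by (auto simp: convenient_def convenient_pq_def)
  then obtain a where a: "\<And>x. x \<in> V \<Longrightarrow> v x = a \<bullet> x" using dual_space_inner[OF V] by blast
  have va: "v x = a \<bullet> x" if "\<gamma> \<in> X" "x \<in> ds \<gamma>" for \<gamma> x
  proof -
    have "\<gamma> \<subseteq> V" using X(1) that(1) by (auto simp: P_complex_def)
    then have "ds \<gamma> \<subseteq> V" by (intro ds_least V subspace_diff[OF V]) auto
    then show ?thesis using a that by auto
  qed
  then have "represents X v a" using convenient_adm[OF X(2) v] by (simp add: represents_def)
  then show ?thesis by (rule that)
qed

theorem corollary7:
  fixes V :: "'a::euclidean_space set"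
    and X :: "'a set set"
    and G :: "bool \<Rightarrow> 's::ring set"
  assumes "subspace V"
    and "P_complex V X"
    and "\<forall>\<gamma>\<in>X. compact \<gamma>"
    and "supercommutative_grading G"
  shows "\<forall>p q.
    (\<forall>v\<in>convenient V X. \<exists>!m :: ('a, 's) cohomology_product. induced_product X v p q m) \<and>
    (\<forall>v\<in>convenient V X. \<forall>v'\<in>convenient V X. \<forall>m m' :: ('a, 's) cohomology_product.
      induced_product X v p q m \<and> induced_product X v' p q m' \<longrightarrow> m = m')"
proof (intro allI conjI ballI impI)
  have X: "polytopal X" using assms(2,3) by (rule P_complex_polytopal)
  fix p q v
  assume v: "v \<in> convenient V X"
  obtain a where a: "represents X v a" using convenient_represents[OF assms(1,2) X v] .
  obtain m :: "('a, 's) cohomology_product" where m: "induced_product X v p q m"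
    using induced_product_exists[OF X a] by blast
  show "\<exists>!m :: ('a, 's) cohomology_product. induced_product X v p q m"
  proof (rule ex1I)
    show "m' = m" if "induced_product X v p q m'" for m' :: "('a, 's) cohomology_product"
      by (rule induced_product_unique[OF that m refl])
  qed (rule m)
  fix v' and m1 m2 :: "('a, 's) cohomology_product"
  assume v': "v' \<in> convenient V X" and m12: "induced_product X v p q m1 \<and> induced_product X v' p q m2"
  obtain a' where a': "represents X v' a'" using convenient_represents[OF assms(1,2) X v'] .
  obtain c where adm: "\<And>\<gamma>. \<gamma> \<in> X \<Longrightarrow> adm \<gamma> c"
    and hadm: "\<And>\<gamma> b. \<gamma> \<in> X \<Longrightarrow> b \<in> {a, a'} \<Longrightarrow> adm \<gamma> b \<Longrightarrow> hadm \<gamma> b (c - b)"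
    using generic_displacement[OF X, of "{a, a'}"] by blast
  \<comment> \<open>The comparison functional is not cut off outside \<open>V\<close>, hence need
    not be a convenient point in the formal sense; the product sees only its restrictions to the
    cells.\<close>
  have c: "represents X ((\<bullet>) c) c" using adm by (simp add: represents_def)
  have h: "hadm \<gamma> a (c - a)" "hadm \<gamma> a' (c - a')" if "\<gamma> \<in> X" for \<gamma>
    using hadm[OF that] a a' that by (auto simp: represents_def)
  show "m1 = m2"
  proof (rule induced_product_unique[OF conjunct1[OF m12] conjunct2[OF m12]])
    fix r s :: "('a, 's) cochain"
    assume rs: "r \<in> cocycles X p" "s \<in> cocycles X q"
    show "cohomology_class X (p + q) (cochain_product X v p q r s) =
        cohomology_class X (p + q) (cochain_product X v' p q r s)"
      \<comment> \<open>Both products are homotopic to the one for \<open>c\<close>, along the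
        segments from \<open>a\<close> and from \<open>a'\<close>.\<close>
      using product_class_homotopic[OF X a c h(1) rs] product_class_homotopic[OF X a' c h(2) rs] by simp
  qed
qed

end
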